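(* Let $\{\Gamma_t\}_{t\in[0,T)}$, $0<T\le\infty$, be a curve shortening flow on the unit round sphere $S^2\subset\mathbb{R}^3$ starting from a simple closed curve $\Gamma_0$, with Euclidean chordlength $d$, arclength $\ell$ and total length $L$. Suppose that for some $a>0$, at time $t=0$, \[ \frac{d}{L}\ \ge\ \frac{1}{a}\arctan\left(\frac{a}{\pi}\sin\left(\frac{\pi\ell}{L}\right)\right) \] for all pairs of points of the curve. Then, at every time $t\in[0,T)$ and for all pairs of points of the curve, \[ \frac{d}{L}\ \ge\ \frac{1}{a\,e^{-4\pi^2\tau}}\arctan\left(\frac{a\,e^{-4\pi^2\tau}}{\pi}\sin\left(\frac{\pi\ell}{L}\right)\right), \] where $\tau(t):=\int_0^t L(t')^{-2}\,dt'$.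
   Context: $S^2$ is the unit sphere in $\mathbb{R}^3$. A family $\{\Gamma_t\}_{t\in[0,T)}$ of closed curves in $S^2$ evolves by curve shortening flow if there is a smooth map $\gamma:S^1\times[0,T)\to S^2$ (with $S^1$ the circle) such that each $\gamma(\cdot,t)$ is a smooth immersion with image $\Gamma_t=\gamma(S^1,t)$ and $\partial_t\gamma=\vec\kappa$, where $\vec\kappa(\cdot,t)$ is the (geodesic) curvature vector of $\gamma(\cdot,t)$ in $S^2$. The curve $\Gamma_0$ is simple if $\gamma(\cdot,0)$ is injective. For parameters $x,y\in S^1$ and $t\in[0,T)$: $d=d(x,y,t):=|\gamma(x,t)-\gamma(y,t)|$ is the Euclidean chordlength in $\mathbb{R}^3$ (not the spherical distance); $\ell=\ell(x,y,t)$ is the arclength along $\Gamma_t$ between the two points (of the shorter of the two portions joining them; using the other portion replaces $\ell$ by $L-\ell$, which does not change $\sin(\pi\ell/L)$); and $L=L(t)$ is the total length of $\Gamma_t$. *)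

theory Defs
  imports "HOL-Analysis.Analysis" "HOL-Library.Extended_Real"
begin

text \<open>
  The circle is \<open>\<real> / 2\<pi>\<int>\<close>: a closed curve is a \<open>2\<pi>\<close>-periodic map on the reals,
  and the points of the circle are represented by the parameters in \<open>{0..<2\<pi>}\<close>.
\<close>

definition circle_params :: "real set" where
  "circle_params = {0..<2 * pi}"

text \<open>
  The time interval \<open>[0,T)\<close>, where \<open>T\<close> may be infinite.
\<close>

definition time_interval :: "ereal \<Rightarrow> real set" where
  "time_interval T = {t. 0 \<le> t \<and> ereal t < T}"

text \<open>
  Joint smoothness of \<open>f\<close> on \<open>\<real> \<times> J\<close>: all iterated partial derivatives exist and are
  continuous, where \<open>D i j\<close> is the partial derivative of order \<open>i\<close> in the first and \<open>j\<close> in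
  the second variable. Derivatives in the second variable are taken within the interval \<open>J\<close>,
  so they are one-sided at an endpoint of \<open>J\<close> that belongs to \<open>J\<close>.
\<close>

definition jointly_smooth_on ::
    "real set \<Rightarrow> (real \<Rightarrow> real \<Rightarrow> 'a::real_normed_vector) \<Rightarrow> bool" where
  "jointly_smooth_on J f \<longleftrightarrow>
     (\<exists>D :: nat \<Rightarrow> nat \<Rightarrow> real \<Rightarrow> real \<Rightarrow> 'a.
        (\<forall>x. \<forall>t\<in>J. D 0 0 x t = f x t) \<and>
        (\<forall>i j. continuous_on (UNIV \<times> J) (\<lambda>(x, t). D i j x t)) \<and>
        (\<forall>i j x. \<forall>t\<in>J.
           ((\<lambda>y. D i j y t) has_vector_derivative D (Suc i) j x t) (at x) \<and>
           ((\<lambda>s. D i j x s) has_vector_derivative D i (Suc j) x t) (at t within J)))"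

definition velocity :: "(real \<Rightarrow> real^3) \<Rightarrow> real \<Rightarrow> real^3" where
  "velocity c x = vector_derivative c (at x)"

definition unit_tangent :: "(real \<Rightarrow> real^3) \<Rightarrow> real \<Rightarrow> real^3" where
  "unit_tangent c x = velocity c x /\<^sub>R norm (velocity c x)"

text \<open>
  The orthogonal projection of \<open>v\<close> to the tangent plane of the unit sphere at \<open>p\<close>.
\<close>

definition sphere_tangential :: "real^3 \<Rightarrow> real^3 \<Rightarrow> real^3" where
  "sphere_tangential p v = v - (v \<bullet> p) *\<^sub>R p"

text \<open>
  The geodesic curvature vector in the unit sphere: the covariant derivative of the unit
  tangent with respect to arclength, i.e. the part tangential to the sphere of its arclength
  derivative in the ambient space.
\<close>

definition geodesic_curvature_vector :: "(real \<Rightarrow> real^3) \<Rightarrow> real \<Rightarrow> real^3" where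
  "geodesic_curvature_vector c x =
     sphere_tangential (c x)
       (vector_derivative (unit_tangent c) (at x) /\<^sub>R norm (velocity c x))"

definition curve_shortening_flow :: "ereal \<Rightarrow> (real \<Rightarrow> real \<Rightarrow> real^3) \<Rightarrow> bool" where
  "curve_shortening_flow T \<gamma> \<longleftrightarrow>
     jointly_smooth_on (time_interval T) \<gamma> \<and>
     (\<forall>t\<in>time_interval T. \<forall>x.
        \<gamma> (x + 2 * pi) t = \<gamma> x t \<and>
        \<gamma> x t \<in> sphere 0 1 \<and>
        velocity (\<lambda>y. \<gamma> y t) x \<noteq> 0 \<and>
        ((\<lambda>s. \<gamma> x s) has_vector_derivative geodesic_curvature_vector (\<lambda>y. \<gamma> y t) x)
          (at t within time_interval T))"

definition simple_closed :: "(real \<Rightarrow> real^3) \<Rightarrow> bool" where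
  "simple_closed c \<longleftrightarrow> inj_on c circle_params"

definition arc_length :: "(real \<Rightarrow> real^3) \<Rightarrow> real \<Rightarrow> real \<Rightarrow> real" where
  "arc_length c x y = integral {x..y} (\<lambda>z. norm (velocity c z))"

definition total_length :: "(real \<Rightarrow> real^3) \<Rightarrow> real" where
  "total_length c = arc_length c 0 (2 * pi)"

text \<open>
  The length of the shorter of the two portions joining the points with parameters \<open>x\<close> and
  \<open>y\<close> in \<open>{0..<2\<pi>}\<close>; the second portion passes through the parameter \<open>2\<pi>\<close>.
\<close>

definition arclength_dist :: "(real \<Rightarrow> real^3) \<Rightarrow> real \<Rightarrow> real \<Rightarrow> real" where
  "arclength_dist c x y =
     min (arc_length c (min x y) (max x y)) (arc_length c (max x y) (min x y + 2 * pi))"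

definition rescaled_time :: "(real \<Rightarrow> real \<Rightarrow> real^3) \<Rightarrow> real \<Rightarrow> real" where
  "rescaled_time \<gamma> t = integral {0..t} (\<lambda>s. 1 / (total_length (\<lambda>y. \<gamma> y s))\<^sup>2)"

definition chord_arc_bound :: "real \<Rightarrow> (real \<Rightarrow> real^3) \<Rightarrow> bool" where
  "chord_arc_bound a c \<longleftrightarrow>
     (\<forall>x\<in>circle_params. \<forall>y\<in>circle_params.
        dist (c x) (c y) / total_length c \<ge>
          1 / a * arctan (a / pi * sin (pi * arclength_dist c x y / total_length c)))"

end

theory Submission
  imports Defs
begin

text \<open>
  Write \<open>P\<close> for the right-hand side of the asserted inequality multiplied by \<open>L\<close>, a function of
  \<open>\<ell>\<close>, \<open>L\<close> and \<open>\<tau>\<close>. If \<open>d \<ge> P\<close> fails at a later time, then \<open>d \<ge> \<mu> P\<close>, with \<open>\<mu> < 1\<close>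
  slowly decreasing in time, is violated for the first time at some pair \<open>p \<noteq> q\<close>, since
  \<open>P \<le> \<ell>\<close> while \<open>d\<close> is asymptotic to \<open>\<ell>\<close> near the diagonal. At such a pair \<open>d = \<mu> P\<close>.

  No point of the curve lies on the minimal geodesic \<open>pq\<close>: the function \<open>2 arcsin (\<mu> P / 2)\<close>
  is strictly subadditive in \<open>\<ell>\<close>, and spherical distances add along a geodesic. As the curve is
  simple, its tangents at \<open>p\<close> and \<open>q\<close> then point to opposite sides of the plane spanned by \<open>p\<close> and
  \<open>q\<close>. Together with the first order conditions this gives \<open>\<langle>T\<^sub>p, T\<^sub>q\<rangle> = 2 c\<^sup>2 - 1\<close> for the unit tangents, where
  \<open>c = \<mu> P'\<close> and the prime is the derivative in \<open>\<ell>\<close>. The second variation in the direction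
  \<open>\<partial>\<^sub>p - \<partial>\<^sub>q\<close> then reads \<open>\<partial>\<^sub>t d \<ge> d + 4 \<mu> P''\<close>.

  This contradicts the minimality in time: the curve has total absolute curvature at least \<open>2 \<pi>\<close>
  in space, its arc from \<open>p\<close> to \<open>q\<close> has total absolute curvature at least \<open>2 arccos c\<close>, both of
  which bound the decrease of \<open>L\<close> and \<open>\<ell>\<close> from below, and with these bounds \<open>P\<close> is a subsolution
  because \<open>arccos\<^sup>2\<close> is convex.
\<close>

section \<open>Calculus\<close>

text \<open>The squared curvature in space exceeds the squared geodesic curvature by 1, so
  Cauchy-Schwarz turns the two total curvature bounds into
  \<open>L - \<partial>\<^sub>t L \<ge> 4 \<pi>\<^sup>2 / L\<close> and \<open>\<ell> -
  \<partial>\<^sub>t \<ell> \<ge> 4 arccos\<^sup>2 c / \<ell>\<close>. Since \<open>P\<close> is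
  homogeneous of degree one in \<open>L\<close> and \<open>\<ell>\<close>, the added lengths
  contribute exactly \<open>P\<close> to its time derivative, which matches the extra
  \<open>d\<close> in the second variation. The rate \<open>4 \<pi>\<^sup>2\<close> in the exponent
  is the constant of the bound for \<open>L\<close>: the decay of \<open>a\<close> produces a term
  \<open>4 \<pi>\<^sup>2 P / L\<^sup>2\<close>, and Fenchel's theorem takes it away again.

  The second variation is taken along \<open>\<partial>\<^sub>p - \<partial>\<^sub>q\<close> because
  its term \<open>|T\<^sub>p + T\<^sub>q|\<^sup>2 = 4 c\<^sup>2\<close> then cancels the square of
  the first derivative of the bound. This value depends on the sides to which the tangents point,
  and the wrong configuration can only be excluded globally. Inversion at \<open>p\<close> makes the
  curve planar and turns the geodesic, which the curve misses, into a ray.\<close>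

lemma one_plus_square_neq_0: "1 + (x::real)\<^sup>2 \<noteq> 0"
  by (metis add_pos_nonneg less_irrefl zero_le_power2 zero_less_one)

lemma x_cos_le_sin:
  fixes x :: real
  assumes "0 \<le> x" "x \<le> pi"
  shows "x * cos x \<le> sin x"
proof -
  have "(\<lambda>y. sin y - y * cos y) 0 \<le> (\<lambda>y. sin y - y * cos y) x"
  proof (rule DERIV_nonneg_imp_nondecreasing[OF assms(1)])
    fix y assume y: "0 \<le> y" "y \<le> x"
    have "((\<lambda>y. sin y - y * cos y) has_real_derivative y * sin y) (at y)"
      by (auto intro!: derivative_eq_intros)
    moreover have "y * sin y \<ge> 0" using y assms by (intro mult_nonneg_nonneg sin_ge_zero) auto
    ultimately show "\<exists>d. ((\<lambda>y. sin y - y * cos y) has_real_derivative d) (at y) \<and> 0 \<le> d" by blast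
  qed
  then show ?thesis by simp
qed

text \<open>Supplies a sign in the next lemma: after multiplication by \<open>m * M\<close> it says
  that the one negative term of the derivative taken there is outweighed.\<close>

lemma arctan_quotient_mono:
  fixes m M :: real
  assumes "0 < m" "m < M"
  shows "2 * (arctan m)\<^sup>2 + arctan m / m < 2 * (arctan M)\<^sup>2 + arctan M / M"
proof (rule DERIV_pos_imp_increasing[OF assms(2)])
  fix x assume "m \<le> x" "x \<le> M"
  then have x: "x > 0" using assms by simp
  have t: "arctan x > 0" "arctan x \<le> x" using x arctan_le_self[of x] by auto
  have "((\<lambda>x. 2 * (arctan x)\<^sup>2 + arctan x / x) has_real_derivative
      (x - arctan x + 3 * x\<^sup>2 * arctan x) / (x\<^sup>2 * (1 + x\<^sup>2))) (at x)"
  proof -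
    have nz: "1 + x\<^sup>2 \<noteq> 0" by (rule one_plus_square_neq_0)
    have "((\<lambda>x. 2 * (arctan x)\<^sup>2 + arctan x / x) has_real_derivative
      2 * (2 * arctan x * (1 / (1 + x\<^sup>2))) + (1 / (1 + x\<^sup>2) * x - arctan x) / x\<^sup>2) (at x)"
      using x by (auto intro!: derivative_eq_intros simp: inverse_eq_divide power2_eq_square)
    also have "2 * (2 * arctan x * (1 / (1 + x\<^sup>2))) + (1 / (1 + x\<^sup>2) * x - arctan x) / x\<^sup>2
      = (x - arctan x + 3 * x\<^sup>2 * arctan x) / (x\<^sup>2 * (1 + x\<^sup>2))"
      using x nz by (simp add: divide_simps) (simp add: algebra_simps)
    finally show ?thesis .
  qed
  moreover have "(x - arctan x + 3 * x\<^sup>2 * arctan x) / (x\<^sup>2 * (1 + x\<^sup>2)) > 0"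
    using x t by (intro divide_pos_pos add_nonneg_pos mult_pos_pos) (auto simp: add_pos_nonneg)
  ultimately show "\<exists>y. ((\<lambda>x. 2 * (arctan x)\<^sup>2 + arctan x / x) has_real_derivative y) (at x) \<and> 0 < y"
    by blast
qed

text \<open>For \<open>M = A\<close> and \<open>b = 1 / arctan A\<close> this is, up to a positive
  factor, the positivity of the derivative of \<open>R\<close> below. Both sides vanish at
  \<open>M = m\<close>, so it is enough to let \<open>M\<close> grow from there.\<close>

lemma arctan_core_inequality:
  fixes m M :: real
  assumes "0 < m" "m < M"
  shows "arctan m * (M\<^sup>2 - m\<^sup>2) < m * (1 + 2 * M\<^sup>2 - m\<^sup>2) * ((arctan M)\<^sup>2 - (arctan m)\<^sup>2)"
proof -
  define h where "h = (\<lambda>M. m * (1 + 2 * M\<^sup>2 - m\<^sup>2) * ((arctan M)\<^sup>2 - (arctan m)\<^sup>2) - arctan m * (M\<^sup>2 - m\<^sup>2))"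
  have "h m < h M"
  proof (rule DERIV_pos_imp_increasing_open[OF assms(2)])
    fix x assume mx: "m < x" "x < M"
    then have x: "x > 0" using assms by simp
    have sq: "m\<^sup>2 < x\<^sup>2" using mx assms by (simp add: power_strict_mono)
    let ?d = "m * (4 * x * ((arctan x)\<^sup>2 - (arctan m)\<^sup>2) + (1 + 2 * x\<^sup>2 - m\<^sup>2) * (2 * arctan x / (1 + x\<^sup>2)))
       - 2 * x * arctan m"
    have "(h has_real_derivative ?d) (at x)"
      unfolding h_def using x
      by (auto intro!: derivative_eq_intros simp: add_nonneg_eq_0_iff)
        (simp add: field_simps)
    moreover have "?d > 0"
    proof -
      have "2 * (arctan m)\<^sup>2 + arctan m / m < 2 * (arctan x)\<^sup>2 + arctan x / x"
        by (rule arctan_quotient_mono) (use assms mx in auto)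
      then have "m * x * (2 * (arctan m)\<^sup>2 + arctan m / m) < m * x * (2 * (arctan x)\<^sup>2 + arctan x / x)"
        using x assms by simp
      moreover have "m * x * (2 * (arctan m)\<^sup>2 + arctan m / m) = 2 * m * x * (arctan m)\<^sup>2 + arctan m * x"
        "m * x * (2 * (arctan x)\<^sup>2 + arctan x / x) = 2 * m * x * (arctan x)\<^sup>2 + m * arctan x"
        using x assms by (simp_all add: algebra_simps)
      ultimately have 1: "arctan m * x < 2 * m * x * ((arctan x)\<^sup>2 - (arctan m)\<^sup>2) + m * arctan x"
        by (simp add: algebra_simps)
      have "(1 + 2 * x\<^sup>2 - m\<^sup>2) * (2 * arctan x / (1 + x\<^sup>2)) \<ge> (1 + x\<^sup>2) * (2 * arctan x / (1 + x\<^sup>2))"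
        using x sq by (intro mult_right_mono) (auto simp: add_nonneg_pos)
      moreover have "1 + x\<^sup>2 \<noteq> 0" by (rule one_plus_square_neq_0)
      ultimately have 2: "(1 + 2 * x\<^sup>2 - m\<^sup>2) * (2 * arctan x / (1 + x\<^sup>2)) \<ge> 2 * arctan x"
        by simp
      have "m * ((1 + 2 * x\<^sup>2 - m\<^sup>2) * (2 * arctan x / (1 + x\<^sup>2))) \<ge> m * (2 * arctan x)"
        using 2 assms by (intro mult_left_mono) auto
      then show ?thesis using 1 by (simp add: algebra_simps)
    qed
    ultimately show "\<exists>y. (h has_real_derivative y) (at x) \<and> 0 < y" by blast
  next
    have "x \<in> {m..M} \<Longrightarrow> isCont h x" for x unfolding h_def by (intro continuous_intros)
    then show "continuous_on {m..M} h" by (simp add: continuous_at_imp_continuous_on)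
  qed
  then show ?thesis unfolding h_def by simp
qed

section \<open>Concavity and strict subadditivity of the spherical distance prescribed by the
  profile\<close>

context
  fixes A b :: real
  assumes A: "0 < A" and b: "0 < b" and bA: "b * arctan A \<le> 1"
begin

text \<open>Half the spherical distance that belongs to the chord \<open>\<mu> P\<close>, written
  with \<open>u = \<pi> \<ell> / L\<close>, \<open>A = \<alpha> / \<pi>\<close> and
  \<open>b = \<mu> L / (2 \<alpha>)\<close>. The assumption \<open>b * arctan A \<le> 1\<close> then
  says that the chord prescribed at half length is at most the diameter 2.\<close>

private definition F :: "real \<Rightarrow> real" where "F u = arcsin (b * arctan (A * sin u))"

text \<open>With \<open>m = A * sin u\<close> the derivative of \<open>F\<close> is
  \<open>b / sqrt (R m)\<close>, because \<open>A\<^sup>2 - m\<^sup>2 = (A * cos u)\<^sup>2\<close>.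
  Concavity of \<open>F\<close> thus becomes monotonicity of \<open>R\<close>, in which sine and
  cosine no longer occur.\<close>

private definition R :: "real \<Rightarrow> real" where
  "R m = (1 + m\<^sup>2)\<^sup>2 * (1 - b\<^sup>2 * (arctan m)\<^sup>2) / (A\<^sup>2 - m\<^sup>2)"

private lemma b_arctan_less: "\<lbrakk>0 \<le> m; m < A\<rbrakk> \<Longrightarrow> b * arctan m < 1"
  using bA mult_strict_left_mono[OF arctan_monotone b, of m A] by linarith

private lemma R_strict_mono:
  assumes "0 \<le> m" "m < m'" "m' < A"
  shows "R m < R m'"
proof (rule DERIV_pos_imp_increasing_open[OF assms(2)])
  fix x assume x: "m < x" "x < m'"
  then have x0: "x > 0" "x < A" using assms by auto
  have sq: "x\<^sup>2 < A\<^sup>2" using x0 by (simp add: power_strict_mono)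
  define \<theta> where "\<theta> = arctan x"
  let ?B = "x * (1 + 2 * A\<^sup>2 - x\<^sup>2) * (1 - b\<^sup>2 * \<theta>\<^sup>2) - b\<^sup>2 * \<theta> * (A\<^sup>2 - x\<^sup>2)"
  have nz: "1 + x\<^sup>2 \<noteq> 0" by (rule one_plus_square_neq_0)
  have "(R has_real_derivative
     ((2 * (1 + x\<^sup>2) * (2 * x) * (1 - b\<^sup>2 * \<theta>\<^sup>2) + (1 + x\<^sup>2)\<^sup>2 * (- (b\<^sup>2 * (2 * \<theta> * (1 / (1 + x\<^sup>2)))))) * (A\<^sup>2 - x\<^sup>2)
      - (1 + x\<^sup>2)\<^sup>2 * (1 - b\<^sup>2 * \<theta>\<^sup>2) * (- (2 * x))) / (A\<^sup>2 - x\<^sup>2)\<^sup>2) (at x)"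
    unfolding R_def \<theta>_def using sq nz
    by (auto intro!: derivative_eq_intros simp: inverse_eq_divide power2_eq_square)
  also have "((2 * (1 + x\<^sup>2) * (2 * x) * (1 - b\<^sup>2 * \<theta>\<^sup>2) + (1 + x\<^sup>2)\<^sup>2 * (- (b\<^sup>2 * (2 * \<theta> * (1 / (1 + x\<^sup>2)))))) * (A\<^sup>2 - x\<^sup>2)
      - (1 + x\<^sup>2)\<^sup>2 * (1 - b\<^sup>2 * \<theta>\<^sup>2) * (- (2 * x))) = 2 * (1 + x\<^sup>2) * ?B"
  proof -
    have "(1 + x\<^sup>2)\<^sup>2 * (- (b\<^sup>2 * (2 * \<theta> * (1 / (1 + x\<^sup>2))))) = - ((1 + x\<^sup>2) * b\<^sup>2 * 2 * \<theta>)"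
      using nz by (simp add: power2_eq_square)
    moreover have "(2 * (1 + x\<^sup>2) * (2 * x) * (1 - b\<^sup>2 * \<theta>\<^sup>2) + - ((1 + x\<^sup>2) * b\<^sup>2 * 2 * \<theta>)) * (A\<^sup>2 - x\<^sup>2)
      - (1 + x\<^sup>2)\<^sup>2 * (1 - b\<^sup>2 * \<theta>\<^sup>2) * (- (2 * x)) = 2 * (1 + x\<^sup>2) * ?B"
      by algebra
    ultimately show ?thesis by (simp only:)
  qed
  finally have D: "(R has_real_derivative 2 * (1 + x\<^sup>2) * ?B / (A\<^sup>2 - x\<^sup>2)\<^sup>2) (at x)" .
  \<comment> \<open>\<open>?B\<close> decreases in \<open>b\<close>, so
    \<open>b * arctan A = 1\<close> is the extreme case. Replacing 1 by
    \<open>b\<^sup>2 * (arctan A)\<^sup>2\<close> lets \<open>b\<^sup>2\<close> factor out and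
    leaves the core inequality.\<close>
  have "?B > 0"
  proof -
    have b2: "b\<^sup>2 * (arctan A)\<^sup>2 \<le> 1"
      using bA A b by (simp add: power_mult_distrib[symmetric] power_le_one)
    have c: "\<theta> * (A\<^sup>2 - x\<^sup>2) < x * (1 + 2 * A\<^sup>2 - x\<^sup>2) * ((arctan A)\<^sup>2 - \<theta>\<^sup>2)"
      unfolding \<theta>_def by (rule arctan_core_inequality) (use x0 in auto)
    have "b\<^sup>2 * (\<theta> * (A\<^sup>2 - x\<^sup>2)) < b\<^sup>2 * (x * (1 + 2 * A\<^sup>2 - x\<^sup>2) * ((arctan A)\<^sup>2 - \<theta>\<^sup>2))"
      using c b by (intro mult_strict_left_mono) auto
    also have "\<dots> = x * (1 + 2 * A\<^sup>2 - x\<^sup>2) * (b\<^sup>2 * (arctan A)\<^sup>2 - b\<^sup>2 * \<theta>\<^sup>2)"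
      by (simp add: algebra_simps)
    also have "\<dots> \<le> x * (1 + 2 * A\<^sup>2 - x\<^sup>2) * (1 - b\<^sup>2 * \<theta>\<^sup>2)"
      using b2 x0 sq zero_le_power2[of A] by (intro mult_left_mono mult_nonneg_nonneg) linarith+
    finally show ?thesis by (simp add: algebra_simps)
  qed
  moreover have "(A\<^sup>2 - x\<^sup>2)\<^sup>2 > 0" using sq by simp
  moreover have "1 + x\<^sup>2 > 0" by (simp add: add_pos_nonneg)
  ultimately have "2 * (1 + x\<^sup>2) * ?B / (A\<^sup>2 - x\<^sup>2)\<^sup>2 > 0" by simp
  with D show "\<exists>y. (R has_real_derivative y) (at x) \<and> 0 < y" by blast
next
  have "A\<^sup>2 - x\<^sup>2 \<noteq> 0" if "x \<in> {m..m'}" for x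
    using that assms by (simp add: power2_eq_iff)
  then show "continuous_on {m..m'} R" unfolding R_def by (intro continuous_intros) auto
qed

private lemma F_arg_bounds: "\<lbrakk>0 \<le> u; u \<le> pi\<rbrakk> \<Longrightarrow> 0 \<le> b * arctan (A * sin u) \<and> b * arctan (A * sin u) \<le> 1"
proof -
  assume u: "0 \<le> u" "u \<le> pi"
  have "sin u \<ge> 0" "sin u \<le> 1" using u sin_ge_zero by auto
  then have "0 \<le> A * sin u" "A * sin u \<le> A" using A by (auto simp: mult_left_le)
  then have "0 \<le> arctan (A * sin u)" "arctan (A * sin u) \<le> arctan A" by (auto simp: arctan_le_iff)
  then have "0 \<le> b * arctan (A * sin u)" "b * arctan (A * sin u) \<le> b * arctan A"
    using b by (auto intro: mult_left_mono simp del: mult_le_cancel_left_pos)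
  then show ?thesis using bA by linarith
qed

private lemma F_deriv:
  assumes "0 < u" "u < pi / 2"
  shows "(F has_real_derivative b / sqrt (R (A * sin u))) (at u)"
proof -
  define m where "m = A * sin u"
  have su: "0 < sin u" "0 < cos u" using assms by (auto intro: sin_gt_zero cos_gt_zero)
  have "sin u < 1" using sin_monotone_2pi[of u "pi/2"] assms by simp
  then have m: "0 < m" "m < A" unfolding m_def using su A by auto
  have l: "b * arctan m < 1" "0 < b * arctan m" using b_arctan_less[of m] m b by auto
  then have l2: "1 - (b * arctan m)\<^sup>2 > 0" by (simp add: abs_square_less_1)
  have nz: "1 + m\<^sup>2 > 0" by (simp add: add_pos_nonneg)
  have "R m = ((1 + m\<^sup>2) * sqrt (1 - (b * arctan m)\<^sup>2) / (A * cos u))\<^sup>2"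
  proof -
    have "(A * cos u)\<^sup>2 = A\<^sup>2 - m\<^sup>2" unfolding m_def by (simp add: power_mult_distrib cos_squared_eq algebra_simps)
    then show ?thesis unfolding R_def power_divide power_mult_distrib using l2 by (simp add: power_mult_distrib)
  qed
  moreover have "(1 + m\<^sup>2) * sqrt (1 - (b * arctan m)\<^sup>2) / (A * cos u) > 0"
    using nz l2 A su by simp
  ultimately have sR: "sqrt (R m) = (1 + m\<^sup>2) * sqrt (1 - (b * arctan m)\<^sup>2) / (A * cos u)"
    using real_sqrt_unique[of _ "R m"] by (metis less_imp_le)
  have "(F has_real_derivative inverse (sqrt (1 - (b * arctan m)\<^sup>2)) * (b * (inverse (1 + m\<^sup>2) * (A * cos u)))) (at u)"
    unfolding F_def m_def
    using l[unfolded m_def]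
    by (auto intro!: derivative_eq_intros simp del: power_mult_distrib)
  also have "inverse (sqrt (1 - (b * arctan m)\<^sup>2)) * (b * (inverse (1 + m\<^sup>2) * (A * cos u))) = b / sqrt (R m)"
    unfolding sR by (simp add: divide_simps)
  finally show ?thesis unfolding m_def .
qed

private lemma F_deriv_decreasing:
  assumes "0 < u" "u < w" "w < pi / 2"
  shows "b / sqrt (R (A * sin w)) < b / sqrt (R (A * sin u))"
proof -
  have "0 < sin u" using assms by (auto intro: sin_gt_zero)
  moreover have "sin u < sin w" "sin w < sin (pi/2)" using assms by (auto intro!: sin_monotone_2pi simp del: sin_pi_half)
  ultimately have m: "0 < A * sin u" "A * sin u < A * sin w" "A * sin w < A" using A by auto
  have "0 < R (A * sin u)"
  proof -
    have "(A * sin u)\<^sup>2 < A\<^sup>2" using m by (intro power_strict_mono) linarith+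
    moreover have "(b * arctan (A * sin u))\<^sup>2 < 1"
      using b_arctan_less[OF less_imp_le[OF m(1)] order.strict_trans[OF m(2,3)]] m b
      by (simp only: abs_square_less_1) simp
    moreover have "1 + (A * sin u)\<^sup>2 > 0" by (simp add: add_pos_nonneg)
    ultimately show ?thesis unfolding R_def by (simp add: power_mult_distrib)
  qed
  moreover have "R (A * sin u) < R (A * sin w)" using m by (intro R_strict_mono) auto
  ultimately show ?thesis using b by (simp add: divide_strict_left_mono)
qed

private lemma F_cont: "continuous_on {0..pi} F"
  unfolding F_def using F_arg_bounds by (intro continuous_intros) (auto intro: order_trans[of _ 0])

private lemma F_mono: "\<lbrakk>0 \<le> u; u \<le> w; w \<le> pi / 2\<rbrakk> \<Longrightarrow> F u \<le> F w"
proof -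
  assume u: "0 \<le> u" "u \<le> w" "w \<le> pi / 2"
  then have "A * sin u \<le> A * sin w" using A by (simp add: sin_monotone_2pi_le)
  then have "b * arctan (A * sin u) \<le> b * arctan (A * sin w)" using b by (simp add: arctan_le_iff)
  then show ?thesis unfolding F_def using F_arg_bounds[of u] F_arg_bounds[of w] u
    by (intro arcsin_le_arcsin) auto
qed

private lemma F_pos: "\<lbrakk>0 < u; u < pi\<rbrakk> \<Longrightarrow> 0 < F u"
proof -
  assume u: "0 < u" "u < pi"
  then have "0 < b * arctan (A * sin u)" using A b sin_gt_zero by simp
  then show ?thesis unfolding F_def using F_arg_bounds[of u] u arcsin_less_arcsin[of 0 "b * arctan (A * sin u)"] by simp
qed

private lemma F_reflect: "F (pi - u) = F u" unfolding F_def by simp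

text \<open>Concavity makes the increment of \<open>F\<close> over an interval of length
  \<open>w\<close> shrink as its left end moves from 0 to \<open>u\<close>; at 0 the increment is
  \<open>F w\<close>, since \<open>F 0 = 0\<close>.\<close>

private lemma F_subadd_half:
  assumes "0 < u" "0 < w" "u + w \<le> pi / 2"
  shows "F (u + w) < F u + F w"
proof -
  have "(\<lambda>s. F (s + w) - F s) u < (\<lambda>s. F (s + w) - F s) 0"
  proof (rule DERIV_neg_imp_decreasing_open[OF assms(1)])
    fix s assume s: "0 < s" "s < u"
    have "((\<lambda>s. F (s + w) - F s) has_real_derivative b / sqrt (R (A * sin (s + w))) * 1 - b / sqrt (R (A * sin s))) (at s)"
      by (rule derivative_intros DERIV_chain'[of "\<lambda>s. s + w" 1 s UNIV F] F_deriv derivative_eq_intros refl | use s assms in simp)+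
    moreover have "b / sqrt (R (A * sin (s + w))) * 1 - b / sqrt (R (A * sin s)) < 0"
      using F_deriv_decreasing[of s "s + w"] s assms by simp
    ultimately show "\<exists>y. ((\<lambda>s. F (s + w) - F s) has_real_derivative y) (at s) \<and> y < 0" by blast
  next
    have "continuous_on {0..u} (\<lambda>s. F (s + w))"
      by (rule continuous_on_compose2[OF F_cont]) (use assms in \<open>auto intro!: continuous_intros\<close>)
    moreover have "continuous_on {0..u} F"
      by (rule continuous_on_subset[OF F_cont]) (use assms in auto)
    ultimately show "continuous_on {0..u} (\<lambda>s. F (s + w) - F s)" by (intro continuous_intros)
  qed
  moreover have "F 0 = 0" by (simp add: F_def)
  ultimately show ?thesis by simp
qed

text \<open>Concavity is available up to \<pi> / 2 only. Beyond it, the reflection of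
  \<open>u\<close> to \<pi> - \<open>u\<close> and monotonicity take over, and strictness comes from
  \<open>F > 0\<close> or from the half interval.\<close>

lemma arcsin_arctan_sin_subadd:
  assumes "0 < u" "0 < w" "u + w < pi"
  shows "arcsin (b * arctan (A * sin (u + w))) < arcsin (b * arctan (A * sin u)) + arcsin (b * arctan (A * sin w))"
proof -
  have big: "F (u + w) < F u + F w" if "0 < u" "0 < w" "u + w < pi" "pi / 2 < u" for u w
    using F_reflect[of u] F_reflect[of "u + w"] F_mono[of "pi - (u + w)" "pi - u"] F_pos[of w] that by auto
  have "F (u + w) < F u + F w"
  proof -
    consider "u + w \<le> pi / 2" | "pi / 2 < u" | "pi / 2 < w"
      | "pi / 2 < u + w" "pi / 2 = u" | "pi / 2 < u + w" "u < pi / 2" "w \<le> pi / 2" by linarith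
    then show ?thesis
    proof cases
      case 1 then show ?thesis using F_subadd_half assms by simp
    next
      case 2 then show ?thesis using big assms by simp
    next
      case 3 then show ?thesis using big[of w u] assms by (simp add: add.commute)
    next
      case 4
      then have "F (pi - (u + w)) \<le> F (pi / 2)" using assms by (intro F_mono) auto
      then show ?thesis using F_reflect[of "u + w"] F_pos[of w] assms 4(2) by auto
    next
      case 5
      \<comment> \<open>\<open>F\<close> is maximal at \<pi> / 2, and \<open>w\<close> is at least
        \<pi> / 2 - \<open>u\<close>. So the sum may be cut back to \<pi> / 2, where the half
        interval case applies.\<close>
      have "F (u + w) \<le> F (pi / 2)"
        using F_reflect[of "u + w"] F_mono[of "pi - (u + w)" "pi/2"] assms 5 by auto
      also have "\<dots> < F u + F (pi / 2 - u)" using F_subadd_half[of u "pi/2 - u"] 5 assms by simp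
      also have "\<dots> \<le> F u + F w" using F_mono[of "pi/2 - u" w] 5 assms by simp
      finally show ?thesis .
    qed
  qed
  then show ?thesis unfolding F_def .
qed

end

text \<open>The convex function arccos^2 lies above its tangent at cos \<open>u\<close>, whose slope
  is \<open>- 2 * u / sin u\<close>. The proof rests on the monotonicity of sin x / x.\<close>

lemma angle_square_convexity:
  fixes u \<omega> :: real
  assumes "0 < u" "u \<le> \<omega>" "\<omega> \<le> pi / 2"
  shows "2 * u / sin u * (cos u - cos \<omega>) \<le> \<omega>\<^sup>2 - u\<^sup>2"
proof -
  have su: "sin u > 0" using assms by (intro sin_gt_zero) auto
  have "(\<lambda>w. w\<^sup>2 + 2 * u / sin u * cos w) u \<le> (\<lambda>w. w\<^sup>2 + 2 * u / sin u * cos w) \<omega>"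
  proof (rule DERIV_nonneg_imp_nondecreasing[OF assms(2)])
    fix w assume w: "u \<le> w" "w \<le> \<omega>"
    have "(\<lambda>x. sin x / x) w \<le> (\<lambda>x. sin x / x) u"
    proof (rule DERIV_nonpos_imp_nonincreasing[OF w(1)])
      fix x assume x: "u \<le> x" "x \<le> w"
      then have x0: "0 < x" "x \<le> pi / 2" using assms w by auto
      have "x * cos x \<le> sin x" using x0 by (intro x_cos_le_sin) auto
      then have "(cos x * x - sin x) / (x * x) \<le> 0" using x0 by (simp add: divide_le_0_iff mult.commute)
      moreover have "((\<lambda>x. sin x / x) has_real_derivative (cos x * x - sin x * 1) / (x * x)) (at x)"
        by (rule derivative_intros refl | use x0 in simp)+
      ultimately show "\<exists>y. ((\<lambda>x. sin x / x) has_real_derivative y) (at x) \<and> y \<le> 0" by auto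
    qed
    then have "u * sin w \<le> w * sin u" using assms w by (simp add: field_simps)
    then have "u * sin w / sin u \<le> w" using su by (simp add: field_simps)
    then have "2 * w - 2 * u / sin u * sin w \<ge> 0" by simp
    moreover have "((\<lambda>w. w\<^sup>2 + 2 * u / sin u * cos w) has_real_derivative 2 * w - 2 * u / sin u * sin w) (at w)"
      using su by (auto intro!: derivative_eq_intros)
    ultimately show "\<exists>y. ((\<lambda>w. w\<^sup>2 + 2 * u / sin u * cos w) has_real_derivative y) (at w) \<and> 0 \<le> y" by blast
  qed
  then show ?thesis by (simp only: right_diff_distrib)
qed

lemma second_derivative_test_min:
  fixes f f' :: "real \<Rightarrow> real"
  assumes "\<delta> > 0"
    and f: "\<And>h. \<bar>h\<bar> < \<delta> \<Longrightarrow> (f has_real_derivative f' h) (at h)"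
    and f2: "(f' has_real_derivative c) (at 0)"
    and min: "\<And>h. \<bar>h\<bar> < \<delta> \<Longrightarrow> f 0 \<le> f h"
  shows "f' 0 = 0" "0 \<le> c"
proof -
  show 0: "f' 0 = 0"
    by (rule DERIV_local_min[OF f[of 0] assms(1)]) (use assms in auto)
  show "0 \<le> c"
  proof (rule ccontr)
    assume "\<not> 0 \<le> c"
    then obtain e where e: "e > 0" "\<And>h. \<lbrakk>0 < h; h < e\<rbrakk> \<Longrightarrow> f' h < f' 0"
      using DERIV_neg_dec_right[OF f2] by auto
    define k where "k = min e \<delta> / 2"
    have k: "0 < k" "k < e" "k < \<delta>" using e assms(1) by (auto simp: k_def)
    have "f k < f 0"
    proof (rule DERIV_neg_imp_decreasing_open[OF k(1)])
      fix h assume "0 < h" "h < k"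
      then show "\<exists>y. (f has_real_derivative y) (at h) \<and> y < 0" using f[of h] e(2)[of h] 0 k by auto
    next
      have "isCont f h" if "h \<in> {0..k}" for h
        using DERIV_isCont[OF f[of h]] that k by simp
      then show "continuous_on {0..k} f" by (simp add: continuous_at_imp_continuous_on)
    qed
    then show False using min[of k] k by simp
  qed
qed

section \<open>Geometry of the sphere and chords of simple closed curves\<close>

text \<open>Expansion of \<open>a\<close> in the frame of \<open>p\<close>, \<open>q\<close> and
  their cross product, multiplied by the Gram determinant of \<open>p\<close> and \<open>q\<close>,
  so that it is a polynomial identity in the coordinates.\<close>

lemma gram_decomposition:
  fixes p q a :: "real^3"
  shows "((p \<bullet> p) * (q \<bullet> q) - (p \<bullet> q)\<^sup>2) *\<^sub>R a =
    ((q \<bullet> q) * (a \<bullet> p) - (p \<bullet> q) * (a \<bullet> q)) *\<^sub>R p + ((p \<bullet> p) * (a \<bullet> q) - (p \<bullet> q) * (a \<bullet> p)) *\<^sub>R q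
      + (a \<bullet> (cross3 p q)) *\<^sub>R (cross3 p q)"
  unfolding vec_eq_iff forall_3
  by (simp add: cross3_def inner_vec_def sum_3 power2_eq_square algebra_simps)

context
  fixes p q :: "real^3"
  assumes p: "norm p = 1" and q: "norm q = 1" and pq: "\<bar>p \<bullet> q\<bar> < 1"
begin

lemma inner_decomposition:
  "(1 - (p \<bullet> q)\<^sup>2) * (a \<bullet> b) = (a \<bullet> p - (p \<bullet> q) * (a \<bullet> q)) * (p \<bullet> b)
     + (a \<bullet> q - (p \<bullet> q) * (a \<bullet> p)) * (q \<bullet> b) + (a \<bullet> (cross3 p q)) * (b \<bullet> (cross3 p q))"
proof -
  have "p \<bullet> p = 1" "q \<bullet> q = 1" using p q by (auto simp: norm_eq_1)
  then have "((1 - (p \<bullet> q)\<^sup>2) *\<^sub>R a) \<bullet> b = ((a \<bullet> p - (p \<bullet> q) * (a \<bullet> q)) *\<^sub>R p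
     + (a \<bullet> q - (p \<bullet> q) * (a \<bullet> p)) *\<^sub>R q + (a \<bullet> (cross3 p q)) *\<^sub>R (cross3 p q)) \<bullet> b"
    using gram_decomposition[of p q a] by simp
  then show ?thesis by (simp only: inner_add_left inner_scaleR_left) (simp add: inner_commute)
qed

lemma gram_pos: "1 - (p \<bullet> q)\<^sup>2 > 0"
  using pq by (simp add: abs_square_less_1)

lemma orthogonal_to_frame_eq_0:
  assumes "a \<bullet> p = 0" "a \<bullet> q = 0" "a \<bullet> (cross3 p q) = 0"
  shows "a = 0"
  using inner_decomposition[of a a] assms gram_pos by simp

text \<open>The components of \<open>a\<close> and \<open>b\<close> along the normal of the plane of
  \<open>p\<close> and \<open>q\<close> have equal squares, as both vectors have norm 1 and the
  in-plane parts agree in size. Opposite signs lead to the formula; with equal signs one would find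
  \<open>1 - s\<^sup>2 / (1 + g)\<close> instead, where \<open>s = a \<bullet> q\<close> and
  \<open>g = p \<bullet> q\<close>.\<close>

lemma inner_tangents_opposite_sides:
  assumes a: "norm a = 1" "a \<bullet> p = 0" and b: "norm b = 1" "b \<bullet> q = 0"
    and ab: "a \<bullet> q = - (b \<bullet> p)" and side: "(a \<bullet> (cross3 p q)) * (b \<bullet> (cross3 p q)) \<le> 0"
  shows "a \<bullet> b = 2 * ((a \<bullet> q) / dist p q)\<^sup>2 - 1"
proof -
  define g s where "g = p \<bullet> q" and "s = a \<bullet> q"
  define A B where "A = a \<bullet> (cross3 p q)" and "B = b \<bullet> (cross3 p q)"
  have unit: "p \<bullet> p = 1" "q \<bullet> q = 1" "a \<bullet> a = 1" "b \<bullet> b = 1" using p q a b by (auto simp: norm_eq_1)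
  have d: "(dist p q)\<^sup>2 = 2 * (1 - g)"
    unfolding dist_norm power2_norm_eq_inner by (simp add: unit inner_diff inner_commute g_def algebra_simps)
  have g: "1 - g\<^sup>2 = (1 - g) * (1 + g)" by (simp add: power2_eq_square algebra_simps)
  have "1 - g\<^sup>2 = s\<^sup>2 + A\<^sup>2"
    using inner_decomposition[of a a] a unit by (simp add: g_def s_def A_def power2_eq_square inner_commute)
  moreover have "1 - g\<^sup>2 = s\<^sup>2 + B\<^sup>2"
    using inner_decomposition[of b b] b unit ab by (simp add: g_def s_def B_def power2_eq_square inner_commute)
  moreover have "A * B \<le> 0" using side by (simp add: A_def B_def)
  ultimately have "A\<^sup>2 = B\<^sup>2" "A * B \<le> 0" and A: "A\<^sup>2 = 1 - g\<^sup>2 - s\<^sup>2" by auto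
  then have "A = - B"
    by (metis mult_le_0_iff power2_eq_iff add.inverse_inverse add.inverse_neutral antisym
        linorder_not_le not_square_less_zero zero_less_mult_iff)
  then have "A * B = - A\<^sup>2" by (simp add: power2_eq_square)
  moreover have "(1 - g\<^sup>2) * (a \<bullet> b) = g * s\<^sup>2 + A * B"
    using inner_decomposition[of a b] a b unit ab
    by (simp add: g_def s_def A_def B_def power2_eq_square inner_commute)
  ultimately have "(1 + g) * ((1 - g) * (a \<bullet> b)) = (1 + g) * (s\<^sup>2 - (1 - g))"
    using A g by (simp add: algebra_simps power2_eq_square)
  moreover have "1 + g > 0" "1 - g > 0" using pq by (auto simp: g_def)
  ultimately have "(1 - g) * (a \<bullet> b) = s\<^sup>2 - (1 - g)" by simp
  then show ?thesis using \<open>1 - g > 0\<close> unfolding power_divide d s_def[symmetric] by (simp add: field_simps)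
qed

text \<open>Unit vectors that are positive combinations of \<open>p\<close> and \<open>q\<close> are
  the interior points of the minimal geodesic; below, the geodesic appears only in this algebraic
  form. The sum of the two angles has cosine \<open>p \<bullet> q\<close> and positive sine, hence
  is less than \<pi>.\<close>

lemma arccos_add_geodesic:
  assumes m: "norm m = 1" and A: "0 < A" and B: "0 < B" and comb: "m = A *\<^sub>R p + B *\<^sub>R q"
  shows "arccos (p \<bullet> m) + arccos (m \<bullet> q) = arccos (p \<bullet> q)"
proof -
  define g where "g = p \<bullet> q"
  define s where "s = sqrt (1 - g\<^sup>2)"
  have unit: "p \<bullet> p = 1" "q \<bullet> q = 1" "m \<bullet> m = 1" using p q m by (auto simp: norm_eq_1)
  have s: "s > 0" "s\<^sup>2 = 1 - g\<^sup>2" using gram_pos by (auto simp: s_def g_def)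
  have pm: "p \<bullet> m = A + B * g" and mq: "m \<bullet> q = B + A * g"
    unfolding comb by (simp_all add: inner_add unit g_def)
  have one: "A\<^sup>2 + B\<^sup>2 + 2 * A * B * g = 1"
    using unit(3) unfolding comb by (simp add: inner_add unit g_def inner_commute power2_eq_square algebra_simps)
  have "\<bar>p \<bullet> m\<bar> \<le> 1" "\<bar>m \<bullet> q\<bar> \<le> 1" "\<bar>g\<bar> \<le> 1"
    using Cauchy_Schwarz_ineq2[of p m] Cauchy_Schwarz_ineq2[of m q] p q m pq by (auto simp: g_def)
  note bd = this[unfolded pm mq]
  have "1 - (A + B * g)\<^sup>2 = (B * s)\<^sup>2" "1 - (B + A * g)\<^sup>2 = (A * s)\<^sup>2"
    using one s(2) by algebra+
  then have sn: "sin (arccos (A + B * g)) = B * s" "sin (arccos (B + A * g)) = A * s"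
    using bd A B s by (auto simp: sin_arccos_abs)
  define \<theta> where "\<theta> = arccos (A + B * g) + arccos (B + A * g)"
  have "cos \<theta> = (A + B * g) * (B + A * g) - A * B * s\<^sup>2"
    unfolding \<theta>_def cos_add sn using bd by (simp add: power2_eq_square)
  also have "\<dots> = g * (A\<^sup>2 + B\<^sup>2 + 2 * A * B * g)" unfolding s(2) by algebra
  finally have c: "cos \<theta> = g" using one by simp
  have "sin \<theta> = s * (A\<^sup>2 + B\<^sup>2 + 2 * A * B * g)"
    unfolding \<theta>_def sin_add sn using bd by (simp add: power2_eq_square algebra_simps)
  then have sp: "sin \<theta> > 0" using one s by simp
  have "0 \<le> \<theta>" "\<theta> \<le> 2 * pi"
    unfolding \<theta>_def using bd arccos_lbound[of "A + B * g"] arccos_lbound[of "B + A * g"]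
      arccos_ubound[of "A + B * g"] arccos_ubound[of "B + A * g"] by linarith+
  moreover have "\<theta> \<le> pi"
    using sp sin_le_zero[of \<theta>] \<open>\<theta> \<le> 2 * pi\<close> by (cases "\<theta> = 2 * pi") (simp, linarith)
  ultimately have "\<theta> = arccos g" using c arccos_cos by metis
  then show ?thesis unfolding pm mq \<theta>_def g_def by simp
qed

end

section \<open>A rotation angle argument for the inverted curve\<close>

lemma continuous_connected_between:
  fixes H :: "'a::topological_space \<Rightarrow> real"
  assumes "connected S" "continuous_on S H" "a \<in> S" "lo < H a" "H a < hi"
    and "\<And>s. s \<in> S \<Longrightarrow> H s \<noteq> lo \<and> H s \<noteq> hi" and "b \<in> S"
  shows "lo < H b \<and> H b < hi"
proof -
  have "connected (H ` S)" using assms by (intro connected_continuous_image)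
  then have "u \<in> H ` S" if "u \<in> closed_segment (H a) (H b)" for u
    using that assms(3,7) connected_contains_Icc[of "H ` S"]
    by (fastforce simp: closed_segment_eq_real_ivl simp del: image_iff split: if_splits)
  then have "lo \<notin> closed_segment (H a) (H b)" "hi \<notin> closed_segment (H a) (H b)" using assms(6) by auto
  then show ?thesis using assms(4,5) by (auto simp: closed_segment_eq_real_ivl split: if_splits)
qed

lemma sin_neg_shift:
  fixes x :: real
  assumes "sin x < 0"
  obtains k :: int where "- pi < x - 2 * pi * k" "x - 2 * pi * k < 0"
proof -
  define k where "k = \<lceil>x / (2 * pi)\<rceil>"
  have "x / (2 * pi) \<le> k" "k - 1 < x / (2 * pi)" unfolding k_def by linarith+
  then have "x \<le> 2 * pi * k" "2 * pi * k - 2 * pi < x" by (simp_all add: field_simps)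
  then have y: "x - 2 * pi * k \<le> 0" "- 2 * pi < x - 2 * pi * k" by auto
  have "sin (x - 2 * pi * k) = sin x"
    using sin_int_2pin[of k] cos_int_2pin[of k] by (simp add: sin_diff)
  then have s: "sin (x - 2 * pi * k) < 0" using assms by simp
  have "- pi < x - 2 * pi * k"
  proof (rule ccontr)
    assume "\<not> ?thesis"
    then have "sin (x - 2 * pi * k + 2 * pi) \<ge> 0" using y by (intro sin_ge_zero) auto
    then show False using s by simp
  qed
  moreover have "x - 2 * pi * k \<noteq> 0" using s by auto
  ultimately show ?thesis using that[of k] y by auto
qed

lemma has_vector_derivative_imp_tendsto:
  fixes f :: "real \<Rightarrow> 'a::real_normed_vector"
  assumes "(f has_vector_derivative D) (at x)"
  shows "((\<lambda>z. (f z - f x) /\<^sub>R (z - x)) \<longlongrightarrow> D) (at x)"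
proof -
  have "((\<lambda>z. norm ((f z - f x - (z - x) *\<^sub>R D) /\<^sub>R norm (z - x))) \<longlongrightarrow> 0) (at x)"
    using assms by (intro tendsto_norm_zero) (simp add: has_vector_derivative_def has_derivative_at_within)
  then have "((\<lambda>z. norm ((f z - f x) /\<^sub>R (z - x) - D)) \<longlongrightarrow> 0) (at x)"
  proof (rule Lim_transform_eventually)
    have "norm ((f z - f x - (z - x) *\<^sub>R D) /\<^sub>R norm (z - x)) = norm ((f z - f x) /\<^sub>R (z - x) - D)"
      if "z \<noteq> x" for z
    proof -
      have "(f z - f x) /\<^sub>R (z - x) - D = (f z - f x - (z - x) *\<^sub>R D) /\<^sub>R (z - x)"
        using that by (simp add: scaleR_diff_right)
      then show ?thesis by simp
    qed
    then show "\<forall>\<^sub>F z in at x. norm ((f z - f x - (z - x) *\<^sub>R D) /\<^sub>R norm (z - x))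
        = norm ((f z - f x) /\<^sub>R (z - x) - D)"
      by (auto simp: eventually_at intro!: exI[of _ 1])
  qed
  then show ?thesis using Lim_null tendsto_norm_zero_iff by blast
qed

lemma convex_open_triangle:
  fixes a b :: real
  shows "convex {(z, w). a < z \<and> z < w \<and> w < b}"
proof -
  have "{(z, w). a < z \<and> z < w \<and> w < b} = {p. (- 1, 0) \<bullet> p < - a} \<inter> {p. (1, - 1) \<bullet> p < 0} \<inter> {p. (0, 1) \<bullet> p < b}"
    by auto
  then show ?thesis by (simp add: convex_Int convex_halfspace_lt)
qed

context
  fixes c V :: "real \<Rightarrow> real^3" and x0 x1 y0 :: real and n :: "real^3"
  assumes c: "\<And>z. (c has_vector_derivative V z) (at z)"
    and V: "continuous_on UNIV V"
    and unit: "\<And>z. norm (c z) = 1"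
    and closed: "c x1 = c x0" "V x1 = V x0"
    and y0: "x0 < y0" "y0 < x1"
    and inj: "\<And>z w. \<lbrakk>x0 \<le> z; z < w; w < x1\<rbrakk> \<Longrightarrow> c z \<noteq> c w"
    and free: "\<And>z A B. \<lbrakk>x0 < z; z < x1; z \<noteq> y0; 0 < A; 0 < B\<rbrakk> \<Longrightarrow> c z \<noteq> A *\<^sub>R c x0 + B *\<^sub>R c y0"
    and pq: "\<bar>c x0 \<bullet> c y0\<bar> < 1"
    and n: "n \<bullet> c x0 = 0" "n \<bullet> c y0 = 0" "\<And>a. a \<bullet> n = 0 \<Longrightarrow> a \<bullet> (cross3 (c x0) (c y0)) = 0"
    and side: "n \<bullet> V x0 > 0" "n \<bullet> V y0 > 0"
begin

private definition N where "N z = (norm (c z - c x0))\<^sup>2"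
text \<open>Inversion at \<open>c x0\<close>. Since the sphere passes through the centre, its image
  is a plane, namely the one where the inner product with \<open>c x0\<close> is -1/2. Up to scale,
  \<open>X\<close> and \<open>Y\<close> are coordinates in this plane, along the part
  \<open>v\<close> of \<open>c y0\<close> orthogonal to \<open>c x0\<close> and along the normal
  \<open>n\<close> of the plane of the geodesic.\<close>

private definition I where "I z = (c z - c x0) /\<^sub>R N z"
private definition v where "v = c y0 - (c x0 \<bullet> c y0) *\<^sub>R c x0"
private definition X where "X z = I z \<bullet> v"
private definition Y where "Y z = I z \<bullet> n"

private lemma N_pos: "\<lbrakk>x0 < z; z < x1\<rbrakk> \<Longrightarrow> 0 < N z"
  using inj[of x0 z] by (simp add: N_def)

private lemma inner_self: "c z \<bullet> c z = 1"
  using unit[of z] by (simp add: norm_eq_1)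

private lemma Y_eq: "Y z = (c z \<bullet> n) / N z"
  using n(1) by (simp add: Y_def I_def inner_diff inner_commute divide_inverse mult.commute)

private lemma c_cont: "continuous_on S c"
  using c by (meson continuous_at_imp_continuous_on has_vector_derivative_continuous)

private lemma I_cont: "continuous_on {x0<..<x1} I"
  unfolding I_def using N_pos
  by (intro continuous_intros c_cont) (auto simp: N_def intro!: continuous_intros c_cont)

private lemma I_inner_x0: "\<lbrakk>x0 < z; z < x1\<rbrakk> \<Longrightarrow> I z \<bullet> c x0 = - 1 / 2"
proof -
  assume z: "x0 < z" "z < x1"
  have "N z = 2 - 2 * (c z \<bullet> c x0)"
    unfolding N_def power2_norm_eq_inner by (simp add: inner_diff inner_self inner_commute)
  then have "(c z - c x0) \<bullet> c x0 = - N z / 2" by (simp add: inner_diff_left inner_self)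
  then show ?thesis using N_pos[OF z] by (simp add: I_def)
qed

private lemma I_inner_self: "\<lbrakk>x0 < z; z < x1\<rbrakk> \<Longrightarrow> I z \<bullet> I z = 1 / N z"
  using N_pos[of z] by (simp add: I_def N_def power2_norm_eq_inner divide_inverse)

private lemma v_inner: "v \<bullet> c x0 = 0" "v \<bullet> n = 0" "v \<bullet> v = 1 - (c x0 \<bullet> c y0)\<^sup>2" "0 < v \<bullet> v"
proof -
  show "v \<bullet> v = 1 - (c x0 \<bullet> c y0)\<^sup>2" 
    by (simp add: v_def inner_diff inner_self inner_commute power2_eq_square)
  then show "0 < v \<bullet> v" using gram_pos[OF unit unit pq] by simp
qed (use n in \<open>simp_all add: v_def inner_diff inner_self inner_commute\<close>)

private lemma frame_zero:
  assumes "a \<bullet> c x0 = 0" "a \<bullet> v = 0" "a \<bullet> n = 0"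
  shows "a = 0"
proof (rule orthogonal_to_frame_eq_0[OF unit unit pq])
  show "a \<bullet> c y0 = 0" using assms by (simp add: v_def inner_diff_right)
qed (use assms n in auto)

text \<open>The third coordinate of the image is constant, so \<open>X\<close> and \<open>Y\<close>
  determine \<open>I z\<close>; its squared norm \<open>1 / N z\<close> then gives back
  \<open>N z\<close> and with it \<open>c z\<close>.\<close>

private lemma inversion_inj:
  assumes "x0 < z" "z < w" "w < x1"
  shows "\<not> (X z = X w \<and> Y z = Y w)"
proof
  assume "X z = X w \<and> Y z = Y w"
  then have "I w - I z = 0"
    using assms I_inner_x0[of z] I_inner_x0[of w]
    by (intro frame_zero) (auto simp: inner_diff_left X_def Y_def)
  then have eq: "I w = I z" by simp
  have nz: "N z > 0" "N w > 0" using N_pos assms by auto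
  have "1 / N w = 1 / N z" using I_inner_self[of z] I_inner_self[of w] assms eq by simp
  then have "N z = N w" by simp
  then have "c w = c z" using eq nz by (simp add: I_def)
  then show False using inj[of z w] assms by simp
qed

text \<open>Inversion in the sphere around \<open>c x0\<close> maps the geodesic from \<open>c y0\<close> to \<open>c x0\<close> to a ray.\<close>

private lemma inversion_ray:
  assumes z: "x0 < z" "z < x1" "z \<noteq> y0" and Yeq: "Y z = Y y0"
  shows "X z \<le> X y0"
proof (rule ccontr)
  assume less: "\<not> ?thesis"
  define r where "r = (X z - X y0) / (v \<bullet> v)"
  define g where "g = c x0 \<bullet> c y0"
  have r: "r > 0" using less v_inner(4) by (simp add: r_def)
  have "I z - I y0 - r *\<^sub>R v = 0"
    using I_inner_x0[OF z(1,2)] I_inner_x0[OF y0] v_inner Yeq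
    by (intro frame_zero) (auto simp: inner_diff_left Y_def X_def r_def)
  then have Iz: "I z = I y0 + r *\<^sub>R v" by (simp add: algebra_simps)
  have Np: "N z > 0" "N y0 > 0" using N_pos z y0 by auto
  have Ny: "N y0 = 2 * (1 - g)"
    unfolding N_def power2_norm_eq_inner by (simp add: inner_diff inner_self inner_commute g_def)
  have "I y0 \<bullet> v = ((c y0 - c x0) \<bullet> v) / N y0" by (simp add: I_def divide_inverse mult.commute)
  also have "(c y0 - c x0) \<bullet> v = (1 - g) * (1 + g)"
    using v_inner(1) by (simp add: v_def inner_diff inner_self inner_commute g_def algebra_simps)
  also have "(1 - g) * (1 + g) / N y0 = (1 + g) / 2"
    using Np(2) unfolding Ny by (subst mult_divide_mult_cancel_left[of "1 - g" "1 + g" 2, symmetric]) (auto simp: mult.commute)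
  finally have Iyv: "I y0 \<bullet> v = (1 + g) / 2" .
  have "1 / N z = I y0 \<bullet> I y0 + 2 * r * (I y0 \<bullet> v) + r\<^sup>2 * (v \<bullet> v)"
    unfolding I_inner_self[OF z(1,2), symmetric] Iz
    by (simp add: inner_add inner_commute power2_eq_square algebra_simps)
  also have "\<dots> = 1 / N y0 + r * (1 + g) + r\<^sup>2 * (v \<bullet> v)" by (simp add: I_inner_self y0 Iyv)
  \<comment> \<open>This makes the coefficient of \<open>c x0\<close> below positive, so that
    \<open>c z\<close> would be a positive combination of \<open>c x0\<close> and
    \<open>c y0\<close>, contrary to \<open>free\<close>.\<close>
  finally have "1 / N z > 1 / N y0 + r * g" using r v_inner(4) by (simp add: algebra_simps add_pos_pos)
  then have A: "1 - N z * (1 / N y0 + r * g) > 0" using Np by (simp add: field_simps)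
  have "c z = c x0 + N z *\<^sub>R I z" using Np by (simp add: I_def)
  also have "\<dots> = (1 - N z * (1 / N y0 + r * g)) *\<^sub>R c x0 + (N z * (1 / N y0 + r)) *\<^sub>R c y0"
    unfolding Iz by (simp add: I_def v_def g_def algebra_simps inverse_eq_divide)
  finally have comb: "c z = (1 - N z * (1 / N y0 + r * g)) *\<^sub>R c x0 + (N z * (1 / N y0 + r)) *\<^sub>R c y0" .
  have "0 < N z * (1 / N y0 + r)" using Np r by (intro mult_pos_pos add_pos_pos) auto
  from free[OF z A this] comb show False by blast
qed

text \<open>Near either end of the period \<open>Y\<close> behaves like a positive multiple of
  \<open>1 / (z - x)\<close>. The sign of \<open>z - x\<close> decides between the limits: plus
  infinity on leaving the pole, minus infinity on returning to it.\<close>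

private lemma Y_at_pole:
  assumes "c x = c x0" "V x = V x0"
  shows "((\<lambda>z. (z - x) * Y z) \<longlongrightarrow> (n \<bullet> V x0) / (V x0 \<bullet> V x0)) (at x)"
proof -
  define Q where "Q = (\<lambda>z. (c z - c x) /\<^sub>R (z - x))"
  have "(Q \<longlongrightarrow> V x0) (at x)"
    unfolding Q_def by (rule has_vector_derivative_imp_tendsto) (use c[of x] assms(2) in simp)
  moreover have "V x0 \<noteq> 0" using side(1) by auto
  ultimately have "((\<lambda>z. (n \<bullet> Q z) / (Q z \<bullet> Q z)) \<longlongrightarrow> (n \<bullet> V x0) / (V x0 \<bullet> V x0)) (at x)"
    by (intro tendsto_intros) auto
  then show ?thesis
  proof (rule Lim_transform_eventually)
    have "(n \<bullet> Q z) / (Q z \<bullet> Q z) = (z - x) * Y z" if "z \<noteq> x" for z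
      using that n(1) assms(1)
      by (simp add: Y_eq Q_def N_def power2_norm_eq_inner inner_diff_left inner_diff_right inner_commute divide_simps)
    then show "\<forall>\<^sub>F z in at x. (n \<bullet> Q z) / (Q z \<bullet> Q z) = (z - x) * Y z"
      by (auto simp: eventually_at intro!: exI[of _ 1])
  qed
qed

private lemma pole_value_pos: "(n \<bullet> V x0) / (V x0 \<bullet> V x0) > 0"
  using side(1) by (intro divide_pos_pos) auto

private lemma Y_at_left_end: "filterlim Y at_top (at_right x0)"
proof -
  have "((\<lambda>z. (z - x0) * Y z) \<longlongrightarrow> (n \<bullet> V x0) / (V x0 \<bullet> V x0)) (at_right x0)"
    using Y_at_pole[of x0] by (simp add: filterlim_at_split)
  moreover have "filterlim (\<lambda>z. inverse (z - x0)) at_top (at_right x0)"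
    by (intro filterlim_inverse_at_top) (auto intro!: tendsto_eq_intros simp: eventually_at_filter)
  ultimately have "filterlim (\<lambda>z. ((z - x0) * Y z) * inverse (z - x0)) at_top (at_right x0)"
    using pole_value_pos by (intro filterlim_tendsto_pos_mult_at_top)
  then show ?thesis
    by (rule filterlim_mono_eventually) (auto simp: eventually_at_filter)
qed

private lemma Y_at_right_end: "filterlim Y at_bot (at_left x1)"
proof -
  have "((\<lambda>z. (z - x1) * Y z) \<longlongrightarrow> (n \<bullet> V x0) / (V x0 \<bullet> V x0)) (at_left x1)"
    using Y_at_pole[OF closed] by (simp add: filterlim_at_split)
  moreover have "filterlim (\<lambda>z. inverse (z - x1)) at_bot (at_left x1)"
    by (intro filterlim_inverse_at_bot) (auto intro!: tendsto_eq_intros simp: eventually_at_filter)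
  ultimately have "filterlim (\<lambda>z. ((z - x1) * Y z) * inverse (z - x1)) at_bot (at_left x1)"
    using pole_value_pos by (intro filterlim_tendsto_pos_mult_at_bot)
  then show ?thesis
    by (rule filterlim_mono_eventually) (auto simp: eventually_at_filter)
qed

private lemma Y_cont: "continuous_on {x0<..<x1} Y"
  unfolding Y_def by (intro continuous_intros I_cont)

private lemma X_cont: "continuous_on {x0<..<x1} X"
  unfolding X_def by (intro continuous_intros I_cont)

text \<open>On the part from \<open>y0\<close> to \<open>x1\<close> the function \<open>Y\<close> is
  bounded above, by compactness away from \<open>x1\<close> and by its negative sign near
  \<open>x1\<close>, whereas it is unbounded above near \<open>x0\<close>. All chords from such an
  \<open>x\<close> to this part point downwards.\<close>

private lemma Y_left_dominates:
  obtains x where "x0 < x" "x < y0" "\<And>z. \<lbrakk>y0 \<le> z; z < x1\<rbrakk> \<Longrightarrow> Y z < Y x"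
proof -
  have "\<forall>\<^sub>F z in at_left x1. Y z < 0"
    using Y_at_right_end by (simp add: filterlim_at_bot_dense)
  then obtain b where b: "b < x1" "\<And>z. \<lbrakk>b < z; z < x1\<rbrakk> \<Longrightarrow> Y z < 0"
    using y0 by (auto simp: eventually_at_left[of y0])
  have "compact (Y ` {y0..max b y0})"
    using b y0 by (intro compact_continuous_image continuous_on_subset[OF Y_cont]) auto
  then obtain M where M: "\<And>z. \<lbrakk>y0 \<le> z; z \<le> max b y0\<rbrakk> \<Longrightarrow> Y z \<le> M"
    using bounded_imp_bdd_above[OF compact_imp_bounded] by (fastforce simp: bdd_above_def)
  have "\<forall>\<^sub>F z in at_right x0. Y z > max M 0"
    using Y_at_left_end by (simp add: filterlim_at_top_dense del: max_less_iff_conj)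
  then obtain d where d: "x0 < d" "\<And>z. \<lbrakk>x0 < z; z < d\<rbrakk> \<Longrightarrow> Y z > max M 0"
    using y0 by (auto simp: eventually_at_right[of x0 y0])
  define x where "x = (x0 + min d y0) / 2"
  have x: "x0 < x" "x < d" "x < y0" using d(1) y0 by (auto simp: x_def)
  show ?thesis
  proof (rule that[OF x(1,3)])
    fix z assume z: "y0 \<le> z" "z < x1"
    show "Y z < Y x"
    proof (cases "z \<le> max b y0")
      case True then show ?thesis using M[OF z(1) True] d(2)[OF x(1,2)] by simp
    next
      case False then show ?thesis using b(2)[of z] z d(2)[OF x(1,2)] by fastforce
    qed
  qed
qed

private lemma Y_right_dominated:
  obtains x where "y0 < x" "x < x1" "\<And>z. \<lbrakk>x0 < z; z \<le> y0\<rbrakk> \<Longrightarrow> Y x < Y z"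
proof -
  have "\<forall>\<^sub>F z in at_right x0. Y z > 0"
    using Y_at_left_end by (simp add: filterlim_at_top_dense)
  then obtain b where b: "x0 < b" "\<And>z. \<lbrakk>x0 < z; z < b\<rbrakk> \<Longrightarrow> Y z > 0"
    using y0 by (auto simp: eventually_at_right[of x0 y0])
  have "compact (Y ` {min b y0..y0})"
    using b y0 by (intro compact_continuous_image continuous_on_subset[OF Y_cont]) auto
  then obtain M where M: "\<And>z. \<lbrakk>min b y0 \<le> z; z \<le> y0\<rbrakk> \<Longrightarrow> M \<le> Y z"
    using bounded_imp_bdd_below[OF compact_imp_bounded] by (fastforce simp: bdd_below_def)
  have "\<forall>\<^sub>F z in at_left x1. Y z < min M 0"
    using Y_at_right_end by (simp add: filterlim_at_bot_dense del: min_less_iff_conj)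
  then obtain d where d: "d < x1" "\<And>z. \<lbrakk>d < z; z < x1\<rbrakk> \<Longrightarrow> Y z < min M 0"
    using y0 by (auto simp: eventually_at_left[of y0])
  define x where "x = (x1 + max d y0) / 2"
  have x: "x < x1" "d < x" "y0 < x" using d(1) y0 by (auto simp: x_def)
  show ?thesis
  proof (rule that[OF x(3,1)])
    fix z assume z: "x0 < z" "z \<le> y0"
    show "Y x < Y z"
    proof (cases "min b y0 \<le> z")
      case True then show ?thesis using M[OF True z(2)] d(2)[OF x(2,1)] by simp
    next
      case False then show ?thesis using b(2)[of z] z d(2)[OF x(2,1)] by fastforce
    qed
  qed
qed

text \<open>As \<open>c y0\<close> is orthogonal to \<open>n\<close>, the derivative of
  \<open>Y\<close> at \<open>y0\<close> reduces to \<open>(n \<bullet> V y0) / N y0\<close>, which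
  is positive.\<close>

private lemma Y_increasing_near:
  obtains \<delta> where "\<delta> > 0" "x0 < y0 - \<delta>" "y0 + \<delta> < x1"
    "\<And>z w. \<lbrakk>y0 - \<delta> < z; z < w; w < y0 + \<delta>\<rbrakk> \<Longrightarrow> Y z < Y w"
proof -
  define Y' where "Y' = (\<lambda>z. ((V z \<bullet> n) * N z - (c z \<bullet> n) * (2 * ((c z - c x0) \<bullet> V z))) / (N z * N z))"
  have N': "N = (\<lambda>z. (c z - c x0) \<bullet> (c z - c x0))" by (auto simp: N_def power2_norm_eq_inner)
  have D: "(Y has_real_derivative Y' z) (at z)" if "x0 < z" "z < x1" for z
  proof -
    have c': "(c has_derivative (\<lambda>h. h *\<^sub>R V z)) (at z)" using c[of z] by (simp add: has_vector_derivative_def)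
    have 1: "((\<lambda>z. c z \<bullet> n) has_real_derivative V z \<bullet> n) (at z)"
      unfolding has_field_derivative_def by (auto intro!: derivative_eq_intros c')
    have 2: "(N has_real_derivative 2 * ((c z - c x0) \<bullet> V z)) (at z)"
      unfolding has_field_derivative_def N'
      by (auto intro!: derivative_eq_intros c' simp: inner_commute algebra_simps)
    have "((\<lambda>z. (c z \<bullet> n) / N z) has_real_derivative Y' z) (at z)"
      unfolding Y'_def using DERIV_divide[OF 1 2] N_pos[OF that] by simp
    then show ?thesis by (simp add: Y_eq[abs_def])
  qed
  have V': "continuous_on S V" for S using V continuous_on_subset by blast
  have "continuous_on {x0<..<x1} Y'"
    unfolding Y'_def using N_pos by (intro continuous_intros V' c_cont) (auto simp: N' intro!: continuous_intros c_cont)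
  then have "isCont Y' y0" using y0 by (simp add: continuous_on_eq_continuous_at)
  moreover have "Y' y0 > 0"
    unfolding Y'_def using side(2) N_pos[OF y0] n(2) by (simp add: inner_commute)
  ultimately have "\<forall>\<^sub>F z in at y0. Y' z > 0" by (simp add: isCont_def order_tendsto_iff)
  then obtain e where e: "e > 0" "\<And>z. \<lbrakk>z \<noteq> y0; dist z y0 < e\<rbrakk> \<Longrightarrow> Y' z > 0"
    by (auto simp: eventually_at)
  define \<delta> where "\<delta> = min e (min (y0 - x0) (x1 - y0)) / 2"
  have \<delta>: "\<delta> > 0" "\<delta> < e" "x0 < y0 - \<delta>" "y0 + \<delta> < x1"
    using e(1) y0 by (auto simp: \<delta>_def min_def field_simps)
  show ?thesis
  proof (rule that[OF \<delta>(1,3,4)])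
    fix z w assume zw: "y0 - \<delta> < z" "z < w" "w < y0 + \<delta>"
    show "Y z < Y w"
    proof (rule DERIV_pos_imp_increasing[OF zw(2)])
      fix u assume u: "z \<le> u" "u \<le> w"
      have "Y' u > 0" using e(2)[of u] \<open>Y' y0 > 0\<close> u zw \<delta> by (cases "u = y0") (auto simp: dist_real_def)
      then show "\<exists>y. (Y has_real_derivative y) (at u) \<and> 0 < y" using D[of u] u zw \<delta> by auto
    qed
  qed
qed

text \<open>
  The idea is that of Hopf's proof of the rotation number theorem: the direction of the chord
  from \<open>I z\<close> to \<open>I w\<close>, \<open>z < w\<close>, has a continuous angle on the triangle of all
  such pairs. It points downwards when one of the two points is near the pole, it avoids
  a half line when one of the points is \<open>I y0\<close>, and it points upwards near the diagonal at
  \<open>y0\<close>; reaching the diagonal from the two sides gives different angles.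
\<close>

lemma chord_not_crossed_from_same_side: False
proof -
  define D where "D = {(z, w). x0 < z \<and> z < w \<and> w < x1}"
  define G where "G = (\<lambda>(z, w). Complex (X w - X z) (Y w - Y z))"
  have "convex D" unfolding D_def by (rule convex_open_triangle)
  moreover have "continuous_on D G"
  proof -
    have "continuous_on D (\<lambda>s. X (snd s))" "continuous_on D (\<lambda>s. X (fst s))"
      "continuous_on D (\<lambda>s. Y (snd s))" "continuous_on D (\<lambda>s. Y (fst s))"
      by (rule continuous_on_compose2[OF X_cont] continuous_on_compose2[OF Y_cont];
          auto simp: D_def intro!: continuous_intros)+
    then show ?thesis unfolding G_def case_prod_unfold Complex_eq by (intro continuous_intros)
  qed
  moreover have "G s \<noteq> 0" if "s \<in> D" for s
    using that inversion_inj[of "fst s" "snd s"] by (auto simp: D_def G_def complex_eq_iff)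
  ultimately obtain g where g: "continuous_on D g" "\<And>s. s \<in> D \<Longrightarrow> G s = exp (g s)"
    using continuous_logarithm_on_contractible[OF _ convex_imp_contractible] by metis
  obtain x where x: "x0 < x" "x < y0" "\<And>z. \<lbrakk>y0 \<le> z; z < x1\<rbrakk> \<Longrightarrow> Y z < Y x"
    by (rule Y_left_dominates) blast
  obtain y where y: "y0 < y" "y < x1" "\<And>z. \<lbrakk>x0 < z; z \<le> y0\<rbrakk> \<Longrightarrow> Y y < Y z"
    by (rule Y_right_dominated) blast
  obtain \<delta> where \<delta>: "\<delta> > 0" "x0 < y0 - \<delta>" "y0 + \<delta> < x1"
    "\<And>z w. \<lbrakk>y0 - \<delta> < z; z < w; w < y0 + \<delta>\<rbrakk> \<Longrightarrow> Y z < Y w"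
    by (rule Y_increasing_near) blast
  \<comment> \<open>\<open>SA\<close> runs from (x, y0) through the corner (x, y) to (y0, y), and
    all its chords point downwards. From its two ends \<open>SB1\<close> and \<open>SB2\<close>
    approach the diagonal point (y0, y0), around which \<open>SC\<close> lies.\<close>
  define SA where "SA = {x} \<times> {y0..y} \<union> {x..y0} \<times> {y}"
  define SB1 where "SB1 = {x..<y0} \<times> {y0}"
  define SB2 where "SB2 = {y0} \<times> {y0<..y}"
  define SC where "SC = {(z, w). y0 - \<delta> < z \<and> z < w \<and> w < y0 + \<delta>}"
  have sub: "SA \<subseteq> D" "SB1 \<subseteq> D" "SB2 \<subseteq> D" "SC \<subseteq> D"
    using x y y0 \<delta> by (auto simp: SA_def SB1_def SB2_def SC_def D_def)
  have conn: "connected SB1" "connected SB2"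
    by (auto simp: SB1_def SB2_def intro!: convex_connected convex_Times)
  have "connected SA"
    unfolding SA_def
  proof (rule connected_Un)
    have "(x, y) \<in> {x} \<times> {y0..y} \<inter> {x..y0} \<times> {y}" using x y by simp
    then show "{x} \<times> {y0..y} \<inter> {x..y0} \<times> {y} \<noteq> {}" by blast
  qed (auto intro!: convex_connected convex_Times)
  have "convex SC" unfolding SC_def by (rule convex_open_triangle)
  then have connC: "connected SC" by (rule convex_connected)
  have ReG: "Re (G s) = exp (Re (g s)) * cos (Im (g s))"
    and ImG: "Im (G s) = exp (Re (g s)) * sin (Im (g s))" if "s \<in> D" for s
    using g(2)[OF that] by (auto simp: Re_exp Im_exp)
  have xy: "(x, y0) \<in> SA" "(y0, y) \<in> SA" "(x, y0) \<in> SB1" "(y0, y) \<in> SB2"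
    using x y by (auto simp: SA_def SB1_def SB2_def)
  have sA: "sin (Im (g s)) < 0" if "s \<in> SA" for s
  proof -
    have "Im (G s) < 0" using that x y y0 by (auto simp: SA_def G_def)
    then show ?thesis using ImG[of s] that sub by (auto simp: mult_less_0_iff)
  qed
  obtain k :: int where k: "- pi < Im (g (x, y0)) - 2 * pi * k" "Im (g (x, y0)) - 2 * pi * k < 0"
    using sin_neg_shift[OF sA[OF xy(1)]] by blast
  define H where "H = (\<lambda>s. Im (g s) - 2 * pi * k)"
  have Hs: "sin (H s) = sin (Im (g s))" "cos (H s) = cos (Im (g s))" for s
    using sin_int_2pin[of k] cos_int_2pin[of k] by (simp_all add: H_def sin_diff cos_diff)
  have Hc: "continuous_on S H" if "S \<subseteq> D" for S
    unfolding H_def using g(1) that by (intro continuous_intros continuous_on_subset[OF g(1)])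
  have Ha: "- pi < H (x, y0)" "H (x, y0) < 0" using k by (auto simp: H_def)
  have nA: "H s \<noteq> - pi \<and> H s \<noteq> 0" if "s \<in> SA" for s
  proof -
    have "sin (H s) < 0" using sA[OF that] Hs by simp
    then show ?thesis by (metis less_irrefl sin_zero sin_minus sin_pi neg_0_equal_iff_equal)
  qed
  have Hb: "- pi < H (y0, y) \<and> H (y0, y) < 0"
    by (rule continuous_connected_between[OF \<open>connected SA\<close> Hc[OF sub(1)] xy(1) Ha nA xy(2)])
  \<comment> \<open>On \<open>SB1\<close> the chord ends at \<open>I y0\<close>. A horizontal chord
    in the negative \<open>X\<close> direction would start on the forbidden ray, so the angle cannot
    pass \<pi> or -\<pi>.\<close>
  have B1: "- pi < H s \<and> H s < pi" if "s \<in> SB1" for s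
  proof (rule continuous_connected_between[OF conn(1) Hc[OF sub(2)] xy(3) Ha(1) _ _ that])
    show "H (x, y0) < pi" using Ha(2) pi_gt_zero by linarith
    fix s assume s: "s \<in> SB1"
    then obtain z where z: "s = (z, y0)" "x \<le> z" "z < y0" by (auto simp: SB1_def)
    show "H s \<noteq> - pi \<and> H s \<noteq> pi"
    proof (rule ccontr)
      assume "\<not> ?thesis"
      then have "sin (H s) = 0" "cos (H s) = - 1" by auto
      then have "Re (G s) < 0" "Im (G s) = 0" using ReG[of s] ImG[of s] s sub Hs[of s] by auto
      then show False using inversion_ray[of z] z x y0 by (auto simp: G_def)
    qed
  qed
  \<comment> \<open>On \<open>SB2\<close> the chord starts at \<open>I y0\<close>, so the positive
    \<open>X\<close> direction is now the forbidden one and the angle cannot pass 0 or -2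
    \<pi>.\<close>
  have B2: "- 2 * pi < H s \<and> H s < 0" if "s \<in> SB2" for s
  proof (rule continuous_connected_between[OF conn(2) Hc[OF sub(3)] xy(4) _ _ _ that])
    show "- 2 * pi < H (y0, y)" using Hb pi_gt_zero by linarith
    fix s assume s: "s \<in> SB2"
    then obtain z where z: "s = (y0, z)" "y0 < z" "z \<le> y" by (auto simp: SB2_def)
    show "H s \<noteq> - 2 * pi \<and> H s \<noteq> 0"
    proof (rule ccontr)
      assume "\<not> ?thesis"
      then have "sin (H s) = 0" "cos (H s) = 1" by auto
      then have "Re (G s) > 0" "Im (G s) = 0" using ReG[of s] ImG[of s] s sub Hs[of s] by auto
      then show False using inversion_ray[of z] z y y0 by (auto simp: G_def)
    qed
  qed (use Hb in simp)
  have sC: "sin (H s) > 0" if "s \<in> SC" for s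
  proof -
    have "Im (G s) > 0" using that \<delta>(4) by (auto simp: SC_def G_def)
    then show ?thesis using ImG[of s] Hs[of s] that sub by (auto simp: zero_less_mult_iff)
  qed
  define z where "z = max x (y0 - \<delta> / 2)"
  define w where "w = min y (y0 + \<delta> / 2)"
  have zC: "(z, y0) \<in> SC" "(y0, w) \<in> SC" and zB: "(z, y0) \<in> SB1" "(y0, w) \<in> SB2"
    using x y \<delta> by (auto simp: z_def w_def SC_def SB1_def SB2_def)
  have "H (z, y0) > 0"
  proof (rule ccontr)
    assume "\<not> ?thesis"
    then have "sin (- H (z, y0)) \<ge> 0" using B1[OF zB(1)] by (intro sin_ge_zero) auto
    then show False using sC[OF zC(1)] by simp
  qed
  \<comment> \<open>Upward chords keep the angle between 0 and \<pi> on the connected set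
    \<open>SC\<close>. It thus arrives at \<open>SB2\<close> with a positive value, while
    \<open>SB2\<close> admits only negative ones.\<close>
  then have "0 < H (y0, w) \<and> H (y0, w) < pi"
  proof (intro continuous_connected_between[OF connC Hc[OF sub(4)] zC(1) _ _ _ zC(2)])
    show "H s \<noteq> 0 \<and> H s \<noteq> pi" if "s \<in> SC" for s
      using sC[OF that] by (metis less_irrefl sin_zero sin_pi)
  qed (use B1[OF zB(1)] in auto)
  then show False using B2[OF zB(2)] by simp
qed

end

section \<open>The comparison function\<close>

definition chord_profile :: "real \<Rightarrow> real \<Rightarrow> real \<Rightarrow> real" where
  "chord_profile \<alpha> L l = L / \<alpha> * arctan (\<alpha> / pi * sin (pi * l / L))"

definition chord_profile_deriv :: "real \<Rightarrow> real \<Rightarrow> real \<Rightarrow> real" where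
  "chord_profile_deriv \<alpha> L l = cos (pi * l / L) / (1 + (\<alpha> / pi * sin (pi * l / L))\<^sup>2)"

definition chord_profile_deriv2 :: "real \<Rightarrow> real \<Rightarrow> real \<Rightarrow> real" where
  "chord_profile_deriv2 \<alpha> L l = - (pi / L) * sin (pi * l / L) *
     (1 / (1 + (\<alpha> / pi * sin (pi * l / L))\<^sup>2)
      + 2 * (\<alpha> / pi)\<^sup>2 * (cos (pi * l / L))\<^sup>2 / (1 + (\<alpha> / pi * sin (pi * l / L))\<^sup>2)\<^sup>2)"

lemma chord_profile_DERIV:
  assumes "\<alpha> > 0" "L > 0"
  shows "(chord_profile \<alpha> L has_real_derivative chord_profile_deriv \<alpha> L l) (at l within S)"
proof -
  have "((\<lambda>l. pi * l / L) has_real_derivative pi / L) (at l within S)"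
    using assms by (auto intro!: derivative_eq_intros)
  from DERIV_cmult[OF DERIV_chain2[OF DERIV_arctan DERIV_cmult[OF DERIV_chain2[OF DERIV_sin this]]],
    of "L / \<alpha>" "\<alpha> / pi"]
  show ?thesis
    unfolding chord_profile_def[abs_def] chord_profile_deriv_def
    using assms by (simp add: inverse_eq_divide)
qed

lemma chord_profile_deriv_DERIV:
  assumes "L > 0"
  shows "(chord_profile_deriv \<alpha> L has_real_derivative chord_profile_deriv2 \<alpha> L l) (at l within S)"
proof -
  define B where "B = \<alpha> / pi"
  define u where "u = pi * l / L"
  let ?q = "1 + (B * sin u)\<^sup>2"
  have q: "?q \<noteq> 0" by (rule one_plus_square_neq_0)
  have "(chord_profile_deriv \<alpha> L has_real_derivative
     (- sin u * (pi / L) * ?q - cos u * (2 * (B * sin u) * (B * (cos u * (pi / L))))) / ?q\<^sup>2) (at l within S)"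
  proof -
    have du: "((\<lambda>l. pi * l / L) has_real_derivative pi / L) (at l within S)"
      using assms by (auto intro!: derivative_eq_intros)
    have c: "((\<lambda>l. cos (pi * l / L)) has_real_derivative - sin u * (pi / L)) (at l within S)"
      unfolding u_def by (rule DERIV_chain2[OF DERIV_cos du])
    have "((\<lambda>l. 1 + (B * sin (pi * l / L))\<^sup>2) has_real_derivative 2 * (B * sin u) * (B * (cos u * (pi / L)))) (at l within S)"
      using DERIV_cmult[OF DERIV_chain2[OF DERIV_sin du], of B] unfolding u_def
      using assms by (auto intro!: derivative_eq_intros)
    from DERIV_divide[OF c this one_plus_square_neq_0] show ?thesis
      unfolding chord_profile_deriv_def[abs_def] B_def u_def by (simp add: power2_eq_square mult.commute)
  qed
  also have "(- sin u * (pi / L) * ?q - cos u * (2 * (B * sin u) * (B * (cos u * (pi / L))))) / ?q\<^sup>2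
      = - (pi / L) * sin u * (?q / ?q\<^sup>2 + 2 * B\<^sup>2 * (cos u)\<^sup>2 / ?q\<^sup>2)"
    by (simp add: diff_divide_distrib add_divide_distrib power2_eq_square[of B] power2_eq_square[of "cos u"] algebra_simps)
  also have "?q / ?q\<^sup>2 = 1 / ?q" using q by (simp add: power2_eq_square)
  finally show ?thesis unfolding chord_profile_deriv2_def B_def u_def .
qed

text \<open>For fixed \<open>\<alpha>\<close> the profile is homogeneous of degree one in
  \<open>L\<close> and \<open>l\<close>, so by Euler's relation its derivative in \<open>L\<close>
  is \<open>(P - l * P1) / L\<close>, with \<open>P\<close> the profile and \<open>P1\<close> its
  derivative in \<open>l\<close>. The last summand is the contribution of \<open>\<alpha>\<close>,
  which satisfies the equation of \<open>a\<close> times the exponential of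
  \<open>- 4 * pi\<^sup>2\<close> times the rescaled time.\<close>

lemma chord_profile_flow_DERIV:
  fixes \<alpha> L l :: "real \<Rightarrow> real"
  assumes pos: "\<alpha> t > 0" "L t > 0"
    and d: "(\<alpha> has_real_derivative - 4 * pi\<^sup>2 / (L t)\<^sup>2 * \<alpha> t) (at t within S)"
      "(L has_real_derivative L') (at t within S)" "(l has_real_derivative l') (at t within S)"
  shows "((\<lambda>s. chord_profile (\<alpha> s) (L s) (l s)) has_real_derivative
     L' / L t * (chord_profile (\<alpha> t) (L t) (l t) - l t * chord_profile_deriv (\<alpha> t) (L t) (l t))
     + l' * chord_profile_deriv (\<alpha> t) (L t) (l t)
     + 4 * pi\<^sup>2 / (L t)\<^sup>2 * (chord_profile (\<alpha> t) (L t) (l t)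
         - L t / pi * (sin (pi * l t / L t) / (1 + (\<alpha> t / pi * sin (pi * l t / L t))\<^sup>2)))) (at t within S)"
proof -
  define u where "u = pi * l t / L t"
  define m where "m = \<alpha> t / pi * sin u"
  define \<alpha>' where "\<alpha>' = - 4 * pi\<^sup>2 / (L t)\<^sup>2 * \<alpha> t"
  define q where "q = 1 + m\<^sup>2"
  have q: "q \<noteq> 0" unfolding q_def by (rule one_plus_square_neq_0)
  define u' where "u' = pi * (l' * L t - l t * L') / (L t)\<^sup>2"
  have du: "((\<lambda>s. pi * l s / L s) has_real_derivative u') (at t within S)"
    unfolding u'_def using pos by (auto intro!: derivative_eq_intros d simp: power2_eq_square algebra_simps)
  have dm: "((\<lambda>s. \<alpha> s / pi * sin (pi * l s / L s)) has_real_derivative \<alpha>' / pi * sin u + \<alpha> t / pi * (cos u * u')) (at t within S)"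
    using DERIV_mult[OF DERIV_cdivide[OF d(1), of pi] DERIV_chain2[OF DERIV_sin du]]
    unfolding u_def \<alpha>'_def by (simp add: mult_ac)
  have dL: "((\<lambda>s. L s / \<alpha> s) has_real_derivative (L' * \<alpha> t - L t * \<alpha>') / (\<alpha> t * \<alpha> t)) (at t within S)"
    unfolding \<alpha>'_def by (rule DERIV_divide[OF d(2,1)]) (use pos in auto)
  have da: "((\<lambda>s. arctan (\<alpha> s / pi * sin (pi * l s / L s))) has_real_derivative
      inverse q * (\<alpha>' / pi * sin u + \<alpha> t / pi * (cos u * u'))) (at t within S)"
    using DERIV_chain2[OF DERIV_arctan dm] unfolding q_def m_def u_def by simp
  have eq: "(L' * \<alpha> t - L t * \<alpha>') / (\<alpha> t * \<alpha> t) * arctan m + inverse q * (\<alpha>' / pi * sin u + \<alpha> t / pi * (cos u * u')) * (L t / \<alpha> t)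
    = L' / L t * (L t / \<alpha> t * arctan m - l t * (cos u / q)) + l' * (cos u / q)
      + 4 * pi\<^sup>2 / (L t)\<^sup>2 * (L t / \<alpha> t * arctan m - L t / pi * (sin u / q))"
  proof -
    define w where "w = 1 / q"
    have "(L' * \<alpha> t - L t * \<alpha>') / (\<alpha> t * \<alpha> t) = L' / \<alpha> t + 4 * pi\<^sup>2 / (L t * \<alpha> t)"
      using pos by (simp add: \<alpha>'_def field_simps power2_eq_square)
    moreover have "(\<alpha>' / pi * sin u) * (L t / \<alpha> t) = - 4 * pi / L t * sin u"
      using pos by (simp add: \<alpha>'_def field_simps power2_eq_square)
    moreover have "(\<alpha> t / pi * (cos u * u')) * (L t / \<alpha> t) = cos u * (l' - l t * L' / L t)"
      using pos by (simp add: u'_def field_simps power2_eq_square)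
    ultimately have "(L' * \<alpha> t - L t * \<alpha>') / (\<alpha> t * \<alpha> t) * arctan m + w * (\<alpha>' / pi * sin u + \<alpha> t / pi * (cos u * u')) * (L t / \<alpha> t)
      = (L' / \<alpha> t + 4 * pi\<^sup>2 / (L t * \<alpha> t)) * arctan m + w * (- 4 * pi / L t * sin u + cos u * (l' - l t * L' / L t))"
      by (simp only: mult.assoc[of w] distrib_right)
    also have "\<dots> = L' / L t * (L t / \<alpha> t * arctan m - l t * (cos u * w)) + l' * (cos u * w)
      + 4 * pi\<^sup>2 / (L t)\<^sup>2 * (L t / \<alpha> t * arctan m - L t / pi * (sin u * w))"
      using pos by (simp add: field_simps power2_eq_square)
    finally show ?thesis by (simp add: w_def inverse_eq_divide)
  qed
  show ?thesis
    using DERIV_mult[OF dL da] unfolding chord_profile_def chord_profile_deriv_def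
      u_def[symmetric] m_def[symmetric] q_def[symmetric] eq by simp
qed

lemma chord_profile_le:
  assumes "\<alpha> > 0" "L > 0" "0 \<le> l" "l \<le> L"
  shows "chord_profile \<alpha> L l \<le> l"
proof -
  have "0 \<le> pi * l / L" "pi * l / L \<le> pi" using assms by (auto simp: field_simps)
  then have s: "0 \<le> sin (pi * l / L)" "sin (pi * l / L) \<le> pi * l / L"
    by (auto intro: sin_ge_zero sin_x_le_x)
  have "arctan (\<alpha> / pi * sin (pi * l / L)) \<le> \<alpha> / pi * sin (pi * l / L)"
    using s assms by (intro arctan_le_self) auto
  also have "\<dots> \<le> \<alpha> / pi * (pi * l / L)" using s assms by (intro mult_left_mono) auto
  finally have "L / \<alpha> * arctan (\<alpha> / pi * sin (pi * l / L)) \<le> L / \<alpha> * (\<alpha> / pi * (pi * l / L))"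
    using assms by (intro mult_left_mono) auto
  then show ?thesis using assms by (simp add: chord_profile_def)
qed

lemma chord_profile_pos:
  assumes "\<alpha> > 0" "L > 0" "0 < l" "l < L"
  shows "0 < chord_profile \<alpha> L l"
proof -
  have "0 < pi * l / L" "pi * l / L < pi" using assms by (auto simp: field_simps)
  then show ?thesis unfolding chord_profile_def using assms by (simp add: sin_gt_zero)
qed

lemma chord_profile_reflect: "L > 0 \<Longrightarrow> chord_profile \<alpha> L (L - l) = chord_profile \<alpha> L l"
  by (simp add: chord_profile_def right_diff_distrib diff_divide_distrib)

text \<open>\<open>K\<close> and \<open>k\<close> stand for the integrals of the squared curvature
  in space over the whole curve and over the arc. With them \<open>L - K\<close> and
  \<open>l - k\<close> are the time derivatives of the two lengths, and the left-hand side is the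
  time derivative of \<open>P\<close>.\<close>

lemma chord_profile_supersolution:
  fixes \<alpha> L l \<mu> K k :: real
  assumes "\<alpha> > 0" "L > 0" "0 < l" "l \<le> L / 2" "0 < \<mu>" "\<mu> \<le> 1"
  defines "P \<equiv> chord_profile \<alpha> L l" and "P1 \<equiv> chord_profile_deriv \<alpha> L l"
    and "P2 \<equiv> chord_profile_deriv2 \<alpha> L l"
  assumes K: "K * L \<ge> 4 * pi\<^sup>2" and k: "k * l \<ge> 4 * (arccos (\<mu> * P1))\<^sup>2"
  shows "(L - K) / L * (P - l * P1) + (l - k) * P1
     + 4 * pi\<^sup>2 / L\<^sup>2 * (P - L / pi * (sin (pi * l / L) / (1 + (\<alpha> / pi * sin (pi * l / L))\<^sup>2)))
     \<le> P + 4 * P2"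
proof -
  define u where "u = pi * l / L"
  define S C where "S = sin u" and "C = cos u"
  define B where "B = \<alpha> / pi"
  define m where "m = B * S"
  define q where "q = 1 + m\<^sup>2"
  define \<omega> where "\<omega> = arccos (\<mu> * P1)"
  have u: "0 < u" "u \<le> pi / 2" using assms by (auto simp: u_def field_simps)
  have S: "0 < S" and C: "0 \<le> C" "C \<le> 1" using u by (auto simp: S_def C_def intro: sin_gt_zero cos_ge_zero)
  have B: "0 < B" using assms by (simp add: B_def)
  have m: "0 < m" using S B by (simp add: m_def)
  have q: "1 \<le> q" "0 < q" by (auto simp: q_def add_pos_nonneg)
  have P: "P = L / \<alpha> * arctan m" and P1: "P1 = C / q"
    by (simp_all add: P_def P1_def chord_profile_def chord_profile_deriv_def m_def B_def S_def C_def u_def q_def)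
  have P2: "P2 = - (pi / L) * S * (1 / q + 2 * B\<^sup>2 * C\<^sup>2 / q\<^sup>2)"
    by (simp add: P2_def chord_profile_deriv2_def m_def B_def S_def C_def u_def q_def)
  have P1b: "0 \<le> P1" "P1 \<le> C" using C q by (auto simp: P1 divide_le_eq mult_le_cancel_left1)
  have "\<mu> * P1 \<le> P1" using assms(5,6) P1b by (simp add: mult_left_le_one_le)
  then have muP: "0 \<le> \<mu> * P1" "\<mu> * P1 \<le> C / q" "\<mu> * P1 \<le> C" using assms(5) P1b mult_nonneg_nonneg[of \<mu> P1] unfolding P1 by linarith+
  then have cosw: "cos \<omega> = \<mu> * P1" using C by (simp add: \<omega>_def)
  have w: "u \<le> \<omega>" "\<omega> \<le> pi / 2"
  proof -
    have "arccos C \<le> \<omega>" unfolding \<omega>_def using muP C by (intro arccos_le_arccos) auto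
    moreover have "arccos C = u" unfolding C_def using u by (intro arccos_cos) auto
    ultimately show "u \<le> \<omega>" by simp
    have "arccos (\<mu> * P1) \<le> arccos 0" using muP C by (intro arccos_le_arccos) auto
    then show "\<omega> \<le> pi / 2" by (simp add: \<omega>_def)
  qed
  have concave: "l * P1 \<le> P"
  proof -
    have "u * C \<le> S" unfolding S_def C_def using u by (intro x_cos_le_sin) auto
    moreover have "m \<le> q * arctan m"
    proof -
      have "(\<lambda>y. (1 + y\<^sup>2) * arctan y - y) 0 \<le> (\<lambda>y. (1 + y\<^sup>2) * arctan y - y) m"
      proof (rule DERIV_nonneg_imp_nondecreasing[OF less_imp_le[OF m]])
        fix y assume y: "0 \<le> y" "y \<le> m"
        have "((\<lambda>y. (1 + y\<^sup>2) * arctan y - y) has_real_derivative 2 * y * arctan y) (at y)"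
          using one_plus_square_neq_0[of y] by (auto intro!: derivative_eq_intros)
        moreover have "2 * y * arctan y \<ge> 0" using y by simp
        ultimately show "\<exists>d. ((\<lambda>y. (1 + y\<^sup>2) * arctan y - y) has_real_derivative d) (at y) \<and> 0 \<le> d" by blast
      qed
      then show ?thesis by (simp add: q_def)
    qed
    ultimately have "B * (u * C) \<le> q * arctan m"
      using B unfolding m_def by (metis mult_left_mono less_imp_le order_trans)
    then have "B * u * (C / q) \<le> arctan m" using q by (simp add: field_simps)
    then have "L / \<alpha> * (B * u * (C / q)) \<le> P" unfolding P using assms by (intro mult_left_mono) auto
    moreover have "L / \<alpha> * (B * u * (C / q)) = l * P1" using assms by (simp add: B_def u_def P1)
    ultimately show ?thesis by simp
  qed
  \<comment> \<open>Convexity of arccos^2 at \<open>C\<close>, with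
    \<open>cos \<omega> = \<mu> * P1\<close> at most \<open>C / q\<close>. The gap
    \<open>C - C / q = C * m\<^sup>2 / q\<close> yields precisely the part of \<open>P2\<close> that
    contains \<open>B\<^sup>2\<close>.\<close>
  have key: "2 * u * B\<^sup>2 * S * C / q \<le> \<omega>\<^sup>2 - u\<^sup>2"
  proof -
    have "2 * u / S * (C * (m\<^sup>2 / q)) \<le> 2 * u / S * (C - cos \<omega>)"
    proof (rule mult_left_mono)
      have "C * (m\<^sup>2 / q) = C - C / q" using q by (simp add: q_def field_simps)
      then show "C * (m\<^sup>2 / q) \<le> C - cos \<omega>" using muP cosw by simp
    qed (use u S in simp)
    also have "\<dots> \<le> \<omega>\<^sup>2 - u\<^sup>2" using angle_square_convexity[OF u(1) w] by (simp add: S_def C_def)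
    finally show ?thesis using S by (simp add: m_def power2_eq_square mult_ac)
  qed
  have 1: "- (K / L) * (P - l * P1) \<le> - (4 * pi\<^sup>2 / L\<^sup>2) * (P - l * P1)"
  proof -
    have "4 * pi\<^sup>2 / L\<^sup>2 \<le> K / L" using K assms by (simp add: field_simps power2_eq_square)
    then show ?thesis using mult_right_mono[of "4 * pi\<^sup>2 / L\<^sup>2" "K / L" "P - l * P1"] concave by simp
  qed
  have 2: "- k * P1 \<le> - (4 * \<omega>\<^sup>2 / l) * P1"
  proof -
    have "4 * \<omega>\<^sup>2 / l \<le> k" using k assms by (simp add: field_simps \<omega>_def)
    then show ?thesis using P1b mult_right_mono[of "4 * \<omega>\<^sup>2 / l" k P1] by simp
  qed
  have 3: "P1 * (4 / l) * (2 * u * B\<^sup>2 * S * C / q) \<le> P1 * (4 / l) * (\<omega>\<^sup>2 - u\<^sup>2)"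
    using key P1b assms by (intro mult_left_mono) auto
  have 4: "4 * pi\<^sup>2 / L\<^sup>2 * l = 4 / l * u\<^sup>2"
    using assms by (simp add: u_def power2_eq_square field_simps)
  have 5: "4 * pi\<^sup>2 / L\<^sup>2 * (L / pi * (S / q)) = 4 * pi / L * (S / q)"
    using assms by (simp add: power2_eq_square field_simps)
  have "(4 / l) * (2 * u) = 8 * pi / L" using assms by (simp add: u_def field_simps)
  moreover have "P1 * (4 / l) * (2 * u * B\<^sup>2 * S * C / q) = (4 / l) * (2 * u) * (S * B\<^sup>2 * C\<^sup>2 / q\<^sup>2)"
    by (simp add: P1 power2_eq_square mult_ac)
  ultimately have 6: "P1 * (4 / l) * (2 * u * B\<^sup>2 * S * C / q) = 8 * pi / L * (S * B\<^sup>2 * C\<^sup>2 / q\<^sup>2)"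
    by (simp only:)
  have 7: "4 * P2 = - (4 * pi / L * (S / q)) - 8 * pi / L * (S * B\<^sup>2 * C\<^sup>2 / q\<^sup>2)"
    by (simp add: P2 algebra_simps)
  have 8: "(L - K) / L = 1 - K / L" using assms by (simp add: diff_divide_distrib)
  have split: "(1 - x) * (P - l * P1) + (l - k) * P1 + y * (P - z)
    = P - x * (P - l * P1) - k * P1 + y * P - y * z" for x y z
    by (simp add: algebra_simps)
  have "(L - K) / L * (P - l * P1) + (l - k) * P1 + 4 * pi\<^sup>2 / L\<^sup>2 * (P - L / pi * (S / q))
    = P - K / L * (P - l * P1) - k * P1 + 4 * pi\<^sup>2 / L\<^sup>2 * P - 4 * pi\<^sup>2 / L\<^sup>2 * (L / pi * (S / q))"
    unfolding 8 by (rule split)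
  also have "\<dots> \<le> P - 4 * pi\<^sup>2 / L\<^sup>2 * (P - l * P1) - 4 * \<omega>\<^sup>2 / l * P1 + 4 * pi\<^sup>2 / L\<^sup>2 * P - 4 * pi / L * (S / q)"
    using 1 2 unfolding 5 by simp
  \<comment> \<open>The decay of \<open>\<alpha>\<close> and the bound for \<open>K\<close> cancel
    in the terms with \<open>P\<close>. What is left of them is
    \<open>4 * pi\<^sup>2 / L\<^sup>2 * l\<close>, which is \<open>4 / l * u\<^sup>2\<close> and
    turns the bound for \<open>k\<close> into the difference
    \<open>\<omega>\<^sup>2 - u\<^sup>2\<close>.\<close>
  also have "\<dots> = P + P1 * (4 * pi\<^sup>2 / L\<^sup>2 * l) - 4 * \<omega>\<^sup>2 / l * P1 - 4 * pi / L * (S / q)"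
  proof -
    have "P - y * (P - l * P1) - w + y * P - z = P + P1 * (y * l) - w - z" for w y z
      by (simp add: algebra_simps)
    then show ?thesis .
  qed
  also have "\<dots> = P - P1 * (4 / l) * (\<omega>\<^sup>2 - u\<^sup>2) - 4 * pi / L * (S / q)"
    unfolding 4 by (simp add: algebra_simps)
  also have "\<dots> \<le> P + 4 * P2" using 3 unfolding 6 7 by simp
  finally show ?thesis unfolding S_def q_def m_def B_def u_def .
qed

section \<open>Total curvature\<close>

text \<open>The spherical distance from the starting point grows at most as fast as the path moves.
  It need not be differentiable where the inner product is 1 or -1, as it is at the start; the
  factors \<open>\<eta> n\<close> below 1 keep the argument of arccos inside, and then tend to
  1.\<close>

lemma arccos_inner_le_length:
  fixes \<tau> \<tau>' :: "real \<Rightarrow> 'a::real_inner"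
  assumes ab: "a \<le> b"
    and \<tau>: "\<And>z. (\<tau> has_vector_derivative \<tau>' z) (at z)"
    and unit: "\<And>z. norm (\<tau> z) = 1"
    and cont: "continuous_on {a..b} \<tau>'"
  shows "arccos (\<tau> a \<bullet> \<tau> b) \<le> integral {a..b} (\<lambda>z. norm (\<tau>' z))"
proof -
  define e where "e = \<tau> a"
  define \<eta> where "\<eta> = (\<lambda>n. 1 - inverse (real (Suc n)))"
  have \<eta>: "0 \<le> \<eta> n" "\<eta> n < 1" for n by (auto simp: \<eta>_def inverse_le_1_iff)
  have e1: "e \<bullet> e = 1" using unit[of a] by (simp add: e_def norm_eq_1)
  have eb: "\<bar>e \<bullet> \<tau> z\<bar> \<le> 1" for z
    using Cauchy_Schwarz_ineq2[of e "\<tau> z"] unit[of z] unit[of a] by (simp add: e_def)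
  have step: "arccos (\<eta> n * (e \<bullet> \<tau> b)) - arccos (\<eta> n * (e \<bullet> \<tau> a)) \<le> integral {a..b} (\<lambda>z. norm (\<tau>' z))" for n
  proof -
    define f' where "f' = (\<lambda>z. inverse (- sqrt (1 - (\<eta> n * (e \<bullet> \<tau> z))\<^sup>2)) * (\<eta> n * (e \<bullet> \<tau>' z)))"
    have small: "\<bar>\<eta> n * (e \<bullet> \<tau> z)\<bar> < 1" for z
    proof -
      have "\<bar>\<eta> n * (e \<bullet> \<tau> z)\<bar> \<le> \<eta> n * 1"
        unfolding abs_mult using \<eta>[of n] eb[of z] by (intro mult_mono) auto
      then show ?thesis using \<eta>[of n] by simp
    qed
    have D: "((\<lambda>z. arccos (\<eta> n * (e \<bullet> \<tau> z))) has_real_derivative f' z) (at z)" for z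
    proof -
      have "((\<lambda>z. \<eta> n * (e \<bullet> \<tau> z)) has_real_derivative \<eta> n * (e \<bullet> \<tau>' z)) (at z)"
        unfolding has_field_derivative_def
        by (rule derivative_eq_intros \<tau>[of z, unfolded has_vector_derivative_def] refl)+ (simp add: fun_eq_iff)
      then show ?thesis unfolding f'_def
        using small[of z] by (intro DERIV_chain2[OF DERIV_arccos]) auto
    qed
    have I1: "(f' has_integral (arccos (\<eta> n * (e \<bullet> \<tau> b)) - arccos (\<eta> n * (e \<bullet> \<tau> a)))) {a..b}"
      using D ab by (intro fundamental_theorem_of_calculus)
        (auto simp: has_real_derivative_iff_has_vector_derivative[symmetric] intro: has_field_derivative_at_within)
    have I2: "((\<lambda>z. norm (\<tau>' z)) has_integral integral {a..b} (\<lambda>z. norm (\<tau>' z))) {a..b}"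
      by (intro integrable_integral integrable_continuous_interval continuous_intros cont)
    have I3: "f' z \<le> norm (\<tau>' z)" for z
    proof -
      define g where "g = e \<bullet> \<tau> z"
      have tt: "\<tau> z \<bullet> \<tau> z = 1" using unit[of z] by (simp add: norm_eq_1)
      have "\<tau> z \<bullet> \<tau>' z = 0"
      proof -
        have "((\<lambda>z. \<tau> z \<bullet> \<tau> z) has_derivative (\<lambda>h. \<tau> z \<bullet> (h *\<^sub>R \<tau>' z) + (h *\<^sub>R \<tau>' z) \<bullet> \<tau> z)) (at z)"
          by (intro has_derivative_inner \<tau>[of z, unfolded has_vector_derivative_def])
        moreover have "((\<lambda>z. \<tau> z \<bullet> \<tau> z) has_derivative (\<lambda>h. 0)) (at z)"
          using unit by (simp add: norm_eq_1)
        ultimately have "\<tau> z \<bullet> (1 *\<^sub>R \<tau>' z) + (1 *\<^sub>R \<tau>' z) \<bullet> \<tau> z = 0"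
          by (rule fun_cong[OF has_derivative_unique])
        then show ?thesis by (simp add: inner_commute)
      qed
      \<comment> \<open>Since \<open>\<tau>'\<close> is orthogonal to \<open>\<tau>\<close>, only
        the part of \<open>e\<close> orthogonal to \<open>\<tau>\<close> counts. Its norm
        \<open>sqrt (1 - g\<^sup>2)\<close> is at most the denominator in \<open>f'\<close>.\<close>
      then have "\<bar>e \<bullet> \<tau>' z\<bar> = \<bar>(e - g *\<^sub>R \<tau> z) \<bullet> \<tau>' z\<bar>" by (simp add: inner_diff_left)
      also have "\<dots> \<le> norm (e - g *\<^sub>R \<tau> z) * norm (\<tau>' z)" by (rule Cauchy_Schwarz_ineq2)
      also have "norm (e - g *\<^sub>R \<tau> z) = sqrt (1 - g\<^sup>2)"
      proof -
        have "(e - g *\<^sub>R \<tau> z) \<bullet> (e - g *\<^sub>R \<tau> z) = e \<bullet> e - 2 * g * (e \<bullet> \<tau> z) + g\<^sup>2 * (\<tau> z \<bullet> \<tau> z)"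
          unfolding inner_diff_left inner_diff_right inner_scaleR_left inner_scaleR_right inner_commute[of "\<tau> z" e]
          by algebra
        also have "\<dots> = 1 - g\<^sup>2" by (simp add: e1 tt g_def power2_eq_square)
        finally show ?thesis unfolding norm_eq_sqrt_inner by (rule arg_cong)
      qed
      finally have 1: "\<bar>e \<bullet> \<tau>' z\<bar> \<le> sqrt (1 - g\<^sup>2) * norm (\<tau>' z)" .
      have "(\<eta> n * g)\<^sup>2 < 1" using small[of z] by (simp add: g_def abs_square_less_1)
      then have pos: "sqrt (1 - (\<eta> n * g)\<^sup>2) > 0" by simp
      have "(\<eta> n * g)\<^sup>2 \<le> g\<^sup>2"
        unfolding power_mult_distrib using \<eta>[of n] by (intro mult_left_le_one_le) (auto simp: power_le_one)
      then have le: "sqrt (1 - g\<^sup>2) \<le> sqrt (1 - (\<eta> n * g)\<^sup>2)" by simp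
      have "f' z \<le> \<bar>f' z\<bar>" by simp
      also have "\<bar>f' z\<bar> = \<eta> n * \<bar>e \<bullet> \<tau>' z\<bar> / sqrt (1 - (\<eta> n * g)\<^sup>2)"
        using pos \<eta>[of n] by (simp add: f'_def abs_mult g_def[symmetric] divide_inverse)
      also have "\<dots> \<le> \<bar>e \<bullet> \<tau>' z\<bar> / sqrt (1 - (\<eta> n * g)\<^sup>2)"
        using pos \<eta>[of n] by (intro divide_right_mono mult_left_le_one_le) auto
      also have "\<dots> \<le> norm (\<tau>' z)"
        using pos order_trans[OF 1 mult_right_mono[OF le norm_ge_zero]] by (simp only: divide_le_eq mult.commute) simp
      finally show ?thesis .
    qed
    show ?thesis by (rule has_integral_le[OF I1 I2]) (rule I3)
  qed
  have "\<eta> \<longlonglongrightarrow> 1"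
    unfolding \<eta>_def using tendsto_diff[OF tendsto_const LIMSEQ_inverse_real_of_nat, of 1] by simp
  have lim: "(\<lambda>n. arccos (\<eta> n * (e \<bullet> \<tau> z))) \<longlonglongrightarrow> arccos (e \<bullet> \<tau> z)" for z
  proof (rule continuous_on_tendsto_compose[OF continuous_on_arccos'])
    show "(\<lambda>n. \<eta> n * (e \<bullet> \<tau> z)) \<longlonglongrightarrow> e \<bullet> \<tau> z"
      using tendsto_mult[OF \<open>\<eta> \<longlonglongrightarrow> 1\<close> tendsto_const, of "e \<bullet> \<tau> z"] by simp
    show "e \<bullet> \<tau> z \<in> {-1..1}" using eb[of z] by auto
    have "\<bar>\<eta> n * (e \<bullet> \<tau> z)\<bar> \<le> 1" for n
      unfolding abs_mult using \<eta>[of n] eb[of z] by (intro mult_le_one) auto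
    then show "\<forall>\<^sub>F n in sequentially. \<eta> n * (e \<bullet> \<tau> z) \<in> {-1..1}" by (auto simp: abs_le_iff intro: order_trans)
  qed
  have "arccos (e \<bullet> \<tau> b) - arccos (e \<bullet> \<tau> a) \<le> integral {a..b} (\<lambda>z. norm (\<tau>' z))"
    by (rule LIMSEQ_le_const2[OF tendsto_diff[OF lim lim]]) (use step in auto)
  moreover have "arccos (e \<bullet> \<tau> a) = 0" using e1 by (simp add: e_def)
  ultimately show ?thesis by (simp add: e_def)
qed

text \<open>Obtained by integrating \<open>v z * (l * k z - A)\<^sup>2\<close>, the weighted squared
  deviation of \<open>k\<close> from its mean \<open>A / l\<close>, scaled by
  \<open>l\<close>.\<close>

lemma weighted_Cauchy_Schwarz_integral:
  fixes v k :: "real \<Rightarrow> real"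
  assumes "continuous_on {a..b} v" "continuous_on {a..b} k"
    and v: "\<And>z. z \<in> {a..b} \<Longrightarrow> 0 \<le> v z" and pos: "0 < integral {a..b} v"
  shows "(integral {a..b} (\<lambda>z. v z * k z))\<^sup>2 \<le> integral {a..b} (\<lambda>z. v z * (k z)\<^sup>2) * integral {a..b} v"
proof -
  define l A K where "l = integral {a..b} v" and "A = integral {a..b} (\<lambda>z. v z * k z)"
    and "K = integral {a..b} (\<lambda>z. v z * (k z)\<^sup>2)"
  have h: "(v has_integral l) {a..b}" "((\<lambda>z. v z * k z) has_integral A) {a..b}"
    "((\<lambda>z. v z * (k z)\<^sup>2) has_integral K) {a..b}"
    unfolding l_def A_def K_def
    by (intro integrable_integral integrable_continuous_interval continuous_intros assms)+
  have "((\<lambda>z. l\<^sup>2 * (v z * (k z)\<^sup>2) - 2 * l * A * (v z * k z) + A\<^sup>2 * v z) has_integral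
      (l\<^sup>2 * K - 2 * l * A * A + A\<^sup>2 * l)) {a..b}"
    by (intro has_integral_add has_integral_diff has_integral_mult_right h)
  then have "0 \<le> l\<^sup>2 * K - 2 * l * A * A + A\<^sup>2 * l"
  proof (rule has_integral_nonneg)
    fix z assume "z \<in> {a..b}"
    then have "0 \<le> v z * (l * k z - A)\<^sup>2" using v by simp
    also have "\<dots> = l\<^sup>2 * (v z * (k z)\<^sup>2) - 2 * l * A * (v z * k z) + A\<^sup>2 * v z"
      by (simp add: power2_eq_square algebra_simps)
    finally show "0 \<le> \<dots>" .
  qed
  also have "\<dots> = l * (K * l - A\<^sup>2)" by (simp add: power2_eq_square algebra_simps)
  finally have "0 \<le> K * l - A\<^sup>2" using pos by (simp add: l_def zero_le_mult_iff)
  then show ?thesis by (simp add: l_def A_def K_def)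
qed

text \<open>Fenchel's theorem for the tangent indicatrix. \<open>v\<close> plays the role of the
  speed, and \<open>balanced\<close> expresses that the curve with unit tangent
  \<open>\<tau>\<close> and speed \<open>v\<close> closes up, which prevents \<open>\<tau>\<close>
  from staying in an open half space.\<close>

lemma two_pi_le_closed_tangent_length:
  fixes \<tau> \<tau>' :: "real \<Rightarrow> 'a::real_inner" and v :: "real \<Rightarrow> real"
  assumes ab: "a < b"
    and \<tau>: "\<And>z. (\<tau> has_vector_derivative \<tau>' z) (at z)"
    and unit: "\<And>z. norm (\<tau> z) = 1"
    and cont: "continuous_on {a..b} \<tau>'"
    and closed: "\<tau> a = \<tau> b"
    and v: "continuous_on {a..b} v" "\<And>z. z \<in> {a..b} \<Longrightarrow> 0 < v z"
    and balanced: "\<And>w. ((\<lambda>z. v z * (\<tau> z \<bullet> w)) has_integral 0) {a..b}"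
  shows "2 * pi \<le> integral {a..b} (\<lambda>z. norm (\<tau>' z))"
proof -
  define A where "A = (\<lambda>x y. integral {x..y} (\<lambda>z. norm (\<tau>' z)))"
  have int: "(\<lambda>z. norm (\<tau>' z)) integrable_on {a..b}"
    by (intro integrable_continuous_interval continuous_intros cont)
  have add: "A x y + A y z = A x z" if "a \<le> x" "x \<le> y" "y \<le> z" "z \<le> b" for x y z
    unfolding A_def
    by (rule Henstock_Kurzweil_Integration.integral_combine)
      (use that in \<open>auto intro: integrable_subinterval_real[OF int]\<close>)
  have angle: "arccos (\<tau> x \<bullet> \<tau> y) \<le> A x y" if "a \<le> x" "x \<le> y" "y \<le> b" for x y
    unfolding A_def using that
    by (intro arccos_inner_le_length \<tau> unit continuous_on_subset[OF cont]) auto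
  have "continuous_on {a..b} (A a)" unfolding A_def by (rule indefinite_integral_continuous_1[OF int])
  moreover have "A a a = 0" by (simp add: A_def)
  moreover have "0 \<le> A a b" unfolding A_def by (intro integral_nonneg int) auto
  ultimately obtain m where m: "a \<le> m" "m \<le> b" "A a m = A a b / 2"
    using IVT'[of "A a" a "A a b / 2" b] ab by auto
  then have m': "A m b = A a b / 2" using add[of a m b] by simp
  \<comment> \<open>\<open>a\<close> and \<open>m\<close> cut the closed path into halves of equal
    length. Some \<open>\<tau> s\<close> has nonpositive inner product with
    \<open>\<tau> a + \<tau> m\<close>, so its distances to \<open>\<tau> a\<close> and
    \<open>\<tau> m\<close> add up to at least \<pi>, and one half joins all three points. Otherwise
    the integrand of \<open>balanced\<close> would be positive throughout.\<close>
  have "pi \<le> A a b / 2"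
  proof (cases "\<exists>s\<in>{a..b}. \<tau> s \<bullet> (\<tau> a + \<tau> m) \<le> 0")
    case True
    then obtain s where s: "a \<le> s" "s \<le> b" "\<tau> s \<bullet> \<tau> a + \<tau> s \<bullet> \<tau> m \<le> 0" by (auto simp: inner_add_right)
    have bd: "\<bar>\<tau> x \<bullet> \<tau> y\<bar> \<le> 1" for x y
      using Cauchy_Schwarz_ineq2[of "\<tau> x" "\<tau> y"] by (simp add: unit)
    have "arccos (\<tau> a \<bullet> \<tau> s) \<ge> arccos (- (\<tau> s \<bullet> \<tau> m))"
      using s(3) bd[of s m] bd[of a s] by (intro arccos_le_arccos) (auto simp: inner_commute)
    then have "pi \<le> arccos (\<tau> a \<bullet> \<tau> s) + arccos (\<tau> s \<bullet> \<tau> m)"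
      using bd[of s m] by (simp add: arccos_minus)
    also have "\<dots> \<le> A a b / 2"
    proof (cases "s \<le> m")
      case True
      then show ?thesis using angle[of a s] angle[of s m] add[of a s m] s m by simp
    next
      case False
      then have "arccos (\<tau> a \<bullet> \<tau> s) \<le> A s b" "arccos (\<tau> s \<bullet> \<tau> m) \<le> A m s"
        using angle[of s b] angle[of m s] s m by (auto simp: closed inner_commute)
      then show ?thesis using add[of m s b] s m m' False by simp
    qed
    finally show ?thesis .
  next
    case False
    define f where "f = (\<lambda>z. v z * (\<tau> z \<bullet> (\<tau> a + \<tau> m)))"
    have pos: "0 < f z" if "z \<in> {a..b}" for z
      unfolding f_def using that False v(2) by (intro mult_pos_pos) (auto simp: not_le)
    have "continuous_on {a..b} \<tau>"
      by (meson \<tau> continuous_at_imp_continuous_on has_vector_derivative_continuous)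
    then have "continuous_on {a..b} f" unfolding f_def by (intro continuous_intros v(1))
    then obtain x where x: "x \<in> {a..b}" "\<And>z. z \<in> {a..b} \<Longrightarrow> f x \<le> f z"
      using continuous_attains_inf[of "{a..b}" f] ab by auto
    have "((\<lambda>z. f x) has_integral (b - a) * f x) {a..b}"
      using has_integral_const_real[of "f x" a b] ab by simp
    from has_integral_le[OF this balanced[of "\<tau> a + \<tau> m", folded f_def] x(2)]
    have "(b - a) * f x \<le> 0" .
    then show ?thesis using pos[OF x(1)] ab by (simp add: mult_le_0_iff)
  qed
  then show ?thesis by (simp add: A_def)
qed

section \<open>Curve shortening flow on the sphere\<close>

lemma has_real_derivative_inner:
  fixes f h :: "real \<Rightarrow> 'a::real_inner"
  assumes "(f has_vector_derivative f') (at x within S)" "(h has_vector_derivative h') (at x within S)"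
  shows "((\<lambda>z. f z \<bullet> h z) has_real_derivative f x \<bullet> h' + f' \<bullet> h x) (at x within S)"
  using has_derivative_inner[OF assms[unfolded has_vector_derivative_def]]
  unfolding has_field_derivative_def by (rule has_derivative_eq_rhs) (simp add: fun_eq_iff algebra_simps)

lemma has_real_derivative_norm:
  fixes f :: "real \<Rightarrow> 'a::real_inner"
  assumes "(f has_vector_derivative f') (at x within S)" "f x \<noteq> 0"
  shows "((\<lambda>z. norm (f z)) has_real_derivative (f x \<bullet> f') / norm (f x)) (at x within S)"
proof -
  have "((\<lambda>z. norm (f z)) has_derivative (\<lambda>h. (h *\<^sub>R f') \<bullet> sgn (f x))) (at x within S)"
    using has_derivative_compose[OF assms(1)[unfolded has_vector_derivative_def] has_derivative_norm[OF assms(2)]] .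
  then show ?thesis
    unfolding has_field_derivative_def
    by (rule has_derivative_eq_rhs) (simp add: fun_eq_iff sgn_div_norm divide_inverse inner_commute mult_ac)
qed

lemma inner_const_derivative:
  fixes f h :: "real \<Rightarrow> 'a::real_inner"
  assumes "(f has_vector_derivative f') (at x)" "(h has_vector_derivative h') (at x)" "\<And>z. f z \<bullet> h z = c"
  shows "f x \<bullet> h' + f' \<bullet> h x = 0"
  using DERIV_unique[OF has_real_derivative_inner[OF assms(1,2)], of 0] assms(3) by simp

lemma periodic_int_shift:
  fixes f :: "real \<Rightarrow> 'a" and k :: int
  assumes "\<And>x. f (x + p) = f x"
  shows "f (x + of_int k * p) = f x"
proof (induction k rule: int_induct[where k = 0])
  case (step1 i) then show ?case using assms[of "x + of_int i * p"] by (simp add: algebra_simps)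
next
  case (step2 i) then show ?case using assms[of "x + of_int (i - 1) * p"] by (simp add: algebra_simps)
qed simp

lemma periodic_representative:
  fixes x p :: real
  assumes "p > 0"
  obtains k :: int where "0 \<le> x + of_int k * p" "x + of_int k * p < p"
proof -
  have "of_int \<lfloor>x / p\<rfloor> \<le> x / p" "x / p < of_int \<lfloor>x / p\<rfloor> + 1" by linarith+
  then have "of_int \<lfloor>x / p\<rfloor> * p \<le> x" "x < (of_int \<lfloor>x / p\<rfloor> + 1) * p"
    using assms by (simp_all only: pos_le_divide_eq pos_divide_less_eq)
  then show ?thesis using that[of "- \<lfloor>x / p\<rfloor>"] by (simp add: algebra_simps)
qed

text \<open>
  Besides the flow \<open>g\<close> there are \<open>V = g\<^sub>x\<close>, \<open>A = g\<^sub>x\<^sub>x\<close>, \<open>W = g\<^sub>t\<close> and \<open>X = g\<^sub>x\<^sub>t\<close>. The right-hand side of the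
  last assumption is \<open>g\<^sub>s\<^sub>s + g\<close>, which is the geodesic curvature vector since
  \<open>\<langle>g\<^sub>s\<^sub>s, g\<rangle> = -1\<close>; hence \<open>curv\<close> below is the integral of the squared geodesic curvature.
\<close>

locale sphere_curve_flow =
  fixes J :: "real set" and g V A W X :: "real \<Rightarrow> real \<Rightarrow> real^3"
  assumes J_nonneg: "\<And>t. t \<in> J \<Longrightarrow> 0 \<le> t"
    and J_down: "\<And>s t. \<lbrakk>t \<in> J; 0 \<le> s; s \<le> t\<rbrakk> \<Longrightarrow> s \<in> J"
    and g_x: "\<And>x t. t \<in> J \<Longrightarrow> ((\<lambda>z. g z t) has_vector_derivative V x t) (at x)"
    and V_x: "\<And>x t. t \<in> J \<Longrightarrow> ((\<lambda>z. V z t) has_vector_derivative A x t) (at x)"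
    and W_x: "\<And>x t. t \<in> J \<Longrightarrow> ((\<lambda>z. W z t) has_vector_derivative X x t) (at x)"
    and g_t: "\<And>x t. t \<in> J \<Longrightarrow> (g x has_vector_derivative W x t) (at t within J)"
    and V_t: "\<And>x t. t \<in> J \<Longrightarrow> (V x has_vector_derivative X x t) (at t within J)"
    and g_cont: "continuous_on (UNIV \<times> J) (\<lambda>(x, t). g x t)"
    and V_cont: "continuous_on (UNIV \<times> J) (\<lambda>(x, t). V x t)"
    and W_cont: "continuous_on (UNIV \<times> J) (\<lambda>(x, t). W x t)"
    and periodic: "\<And>x t. t \<in> J \<Longrightarrow> g (x + 2 * pi) t = g x t"
    and unit: "\<And>x t. t \<in> J \<Longrightarrow> norm (g x t) = 1"
    and immersed: "\<And>x t. t \<in> J \<Longrightarrow> V x t \<noteq> 0"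
    and flow: "\<And>x t. t \<in> J \<Longrightarrow> W x t =
      A x t /\<^sub>R (norm (V x t))\<^sup>2 - ((A x t \<bullet> V x t) / (norm (V x t)) ^ 4) *\<^sub>R V x t + g x t"
begin

definition len :: "real \<Rightarrow> real \<Rightarrow> real \<Rightarrow> real" where
  "len x y t = integral {x..y} (\<lambda>z. norm (V z t))"

definition curv :: "real \<Rightarrow> real \<Rightarrow> real \<Rightarrow> real" where
  "curv x y t = integral {x..y} (\<lambda>z. norm (V z t) * (norm (W z t))\<^sup>2)"

definition L :: "real \<Rightarrow> real" where "L t = len 0 (2 * pi) t"

lemma J_convex: "convex J"
  unfolding is_interval_convex_1[symmetric] is_interval_1
  by (meson J_down J_nonneg order_trans)

context
  fixes t assumes t: "t \<in> J"
begin

lemma V_periodic: "V (x + 2 * pi) t = V x t"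
proof -
  have "((\<lambda>z. g (z + 2 * pi) t) has_vector_derivative 1 *\<^sub>R V (x + 2 * pi) t) (at x)"
    by (rule vector_diff_chain_at[of "\<lambda>z. z + 2 * pi" 1 x "\<lambda>z. g z t", unfolded o_def])
      (auto intro!: derivative_eq_intros g_x t)
  then show ?thesis using g_x[OF t, of x] periodic[OF t] by (simp add: vector_derivative_unique_at)
qed

lemma speed_pos: "norm (V x t) > 0"
  using immersed[OF t] by simp

lemma g_inner_self: "g x t \<bullet> g x t = 1"
  using unit[OF t] by (simp add: norm_eq_1)

lemma g_inner_V: "g x t \<bullet> V x t = 0"
  using inner_const_derivative[OF g_x[OF t] g_x[OF t] g_inner_self, of x] by (simp add: inner_commute)

lemma g_inner_A: "g x t \<bullet> A x t = - (norm (V x t))\<^sup>2"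
  using inner_const_derivative[OF g_x[OF t] V_x[OF t] g_inner_V, of x] by (simp add: power2_norm_eq_inner)

lemma g_inner_W: "g x t \<bullet> W x t = 0"
  using speed_pos[of x] by (simp add: flow[OF t] inner_add_right inner_diff_right g_inner_A g_inner_V g_inner_self)

lemma W_inner_V: "W x t \<bullet> V x t = 0"
proof -
  have "V x t \<bullet> V x t = (norm (V x t))\<^sup>2" by (simp add: power2_norm_eq_inner)
  then show ?thesis using speed_pos[of x] g_inner_V[of x]
    by (simp add: flow[OF t] inner_add_left inner_diff_left power4_eq_xxxx power2_eq_square field_simps)
qed

lemma A_eq: "A x t = (norm (V x t))\<^sup>2 *\<^sub>R (W x t - g x t) + ((A x t \<bullet> V x t) / (norm (V x t))\<^sup>2) *\<^sub>R V x t"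
proof -
  have n: "norm (V x t) \<noteq> 0" using speed_pos[of x] by simp
  have "W x t - g x t = A x t /\<^sub>R (norm (V x t))\<^sup>2 - ((A x t \<bullet> V x t) / (norm (V x t)) ^ 4) *\<^sub>R V x t"
    by (simp add: flow[OF t])
  moreover have "(norm (V x t))\<^sup>2 * ((A x t \<bullet> V x t) / (norm (V x t)) ^ 4) = (A x t \<bullet> V x t) / (norm (V x t))\<^sup>2"
    using n by (simp add: power4_eq_xxxx power2_eq_square)
  ultimately show ?thesis using n by (simp only: scaleR_diff_right scaleR_scaleR) simp
qed

lemma W_inner_A: "W x t \<bullet> A x t = (norm (V x t))\<^sup>2 * (norm (W x t))\<^sup>2"
  by (subst A_eq) (simp add: inner_add_right inner_diff_right W_inner_V g_inner_W inner_commute[of "W x t" "g x t"]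
      power2_norm_eq_inner)

text \<open>\<open>X\<close> is both the time derivative of \<open>V\<close> and the parameter
  derivative of \<open>W\<close>. Differentiating \<open>W_inner_V\<close> along the curve therefore
  gives the evolution of the speed.\<close>

lemma V_inner_X: "V x t \<bullet> X x t = - (norm (V x t))\<^sup>2 * (norm (W x t))\<^sup>2"
  using inner_const_derivative[OF W_x[OF t] V_x[OF t] W_inner_V, of x] W_inner_A[of x]
  by (simp add: inner_commute)

text \<open>\<open>W - g\<close> is the curvature vector in space. The summand 1 is the curvature of
  the sphere itself; integrated over an arc it adds the length to \<open>curv\<close>.\<close>

lemma norm_W_minus_g: "(norm (W x t - g x t))\<^sup>2 = (norm (W x t))\<^sup>2 + 1"
  using g_inner_W[of x] g_inner_self[of x]
  by (simp add: power2_norm_eq_inner inner_diff inner_commute)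

lemma speed_t: "((\<lambda>s. norm (V x s)) has_real_derivative - (norm (V x t) * (norm (W x t))\<^sup>2)) (at t within J)"
proof -
  have "(V x t \<bullet> X x t) / norm (V x t) = - (norm (V x t) * (norm (W x t))\<^sup>2)"
    using speed_pos[of x] unfolding V_inner_X by (simp add: power2_eq_square)
  then show ?thesis using has_real_derivative_norm[OF V_t[OF t] immersed[OF t], of x] by simp
qed

lemma speed_x: "((\<lambda>z. norm (V z t)) has_real_derivative (A x t \<bullet> V x t) / norm (V x t)) (at x)"
  using has_real_derivative_norm[OF V_x[OF t] immersed[OF t], of x] by (simp add: inner_commute)

lemma tangent_x: "((\<lambda>z. V z t /\<^sub>R norm (V z t)) has_vector_derivative norm (V x t) *\<^sub>R (W x t - g x t)) (at x)"
proof -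
  have n: "norm (V x t) \<noteq> 0" using speed_pos[of x] by simp
  have "((\<lambda>z. inverse (norm (V z t))) has_real_derivative
      - ((A x t \<bullet> V x t) / norm (V x t) * inverse ((norm (V x t))\<^sup>2))) (at x)"
    using DERIV_inverse_fun[OF speed_x n] by (simp add: numeral_2_eq_2)
  then have "((\<lambda>z. inverse (norm (V z t)) *\<^sub>R V z t) has_vector_derivative
     inverse (norm (V x t)) *\<^sub>R A x t + (- ((A x t \<bullet> V x t) / norm (V x t) * inverse ((norm (V x t))\<^sup>2))) *\<^sub>R V x t) (at x)"
    by (rule has_vector_derivative_scaleR[OF _ V_x[OF t]])
  also have "inverse (norm (V x t)) *\<^sub>R A x t + (- ((A x t \<bullet> V x t) / norm (V x t) * inverse ((norm (V x t))\<^sup>2))) *\<^sub>R V x t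
      = norm (V x t) *\<^sub>R (W x t - g x t)"
  proof -
    have "norm (V x t) * inverse ((norm (V x t))\<^sup>2) = inverse (norm (V x t))"
      "norm (V x t) * ((A x t \<bullet> V x t) / norm (V x t) ^ 4)
        = (A x t \<bullet> V x t) / norm (V x t) * inverse ((norm (V x t))\<^sup>2)"
      using n by (simp_all add: divide_inverse power4_eq_xxxx power2_eq_square)
    moreover have "W x t - g x t = inverse ((norm (V x t))\<^sup>2) *\<^sub>R A x t - ((A x t \<bullet> V x t) / (norm (V x t)) ^ 4) *\<^sub>R V x t"
      by (simp add: flow[OF t])
    ultimately show ?thesis by (simp only: scaleR_diff_right scaleR_scaleR) simp
  qed
  finally show ?thesis .
qed

lemma V_cont_x: "continuous_on S (\<lambda>z. V z t)"
  using V_x[OF t] by (meson continuous_at_imp_continuous_on has_vector_derivative_continuous)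

lemma W_cont_x: "continuous_on S (\<lambda>z. W z t)"
  using W_x[OF t] by (meson continuous_at_imp_continuous_on has_vector_derivative_continuous)

lemma g_cont_x: "continuous_on S (\<lambda>z. g z t)"
  using g_x[OF t] by (meson continuous_at_imp_continuous_on has_vector_derivative_continuous)

lemma speed_integrable: "(\<lambda>z. norm (V z t)) integrable_on {x..y}"
  by (intro integrable_continuous_interval continuous_intros V_cont_x)

lemma len_combine: "x \<le> y \<Longrightarrow> y \<le> z \<Longrightarrow> len x y t + len y z t = len x z t"
  unfolding len_def by (rule Henstock_Kurzweil_Integration.integral_combine[OF _ _ speed_integrable])

lemma len_pos: "x < y \<Longrightarrow> 0 < len x y t"
proof -
  assume xy: "x < y"
  have "\<exists>z\<in>{x..y}. \<forall>w\<in>{x..y}. norm (V z t) \<le> norm (V w t)"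
    using xy by (intro continuous_attains_inf continuous_on_norm V_cont_x) auto
  then obtain z where z: "\<And>w. w \<in> {x..y} \<Longrightarrow> norm (V z t) \<le> norm (V w t)" by blast
  have "((\<lambda>w. norm (V z t)) has_integral (y - x) * norm (V z t)) {x..y}"
    using has_integral_const_real[of "norm (V z t)" x y] xy by simp
  from has_integral_le[OF this integrable_integral[OF speed_integrable] z]
  have "(y - x) * norm (V z t) \<le> len x y t" by (simp add: len_def)
  moreover have "0 < (y - x) * norm (V z t)" using xy speed_pos by simp
  ultimately show ?thesis by linarith
qed

lemma len_same [simp]: "len x x t = 0"
  by (simp add: len_def)

lemma len_shift: "len (x + 2 * pi) (y + 2 * pi) t = len x y t"
proof -
  have "((\<lambda>z. norm (V z t)) has_integral len (x + 2 * pi) (y + 2 * pi) t) {x + 2 * pi..y + 2 * pi}"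
    unfolding len_def by (rule integrable_integral[OF speed_integrable])
  then have "((\<lambda>z. norm (V z t)) \<circ> (+) (2 * pi) has_integral len (x + 2 * pi) (y + 2 * pi) t) {x..y}"
    by (rule iffD2[OF has_integral_shift_Icc_real])
  moreover have "(\<lambda>z. norm (V z t)) \<circ> (+) (2 * pi) = (\<lambda>z. norm (V z t))"
    using V_periodic by (auto simp: add.commute)
  ultimately have "((\<lambda>z. norm (V z t)) has_integral len (x + 2 * pi) (y + 2 * pi) t) {x..y}" by simp
  from integral_unique[OF this] show ?thesis by (simp add: len_def)
qed

lemma len_period: "len x (x + 2 * pi) t = L t"
proof -
  have base: "len x (x + 2 * pi) t = L t" if "0 \<le> x" "x < 2 * pi" for x
    using len_combine[of 0 x "2 * pi"] len_combine[of x "2 * pi" "x + 2 * pi"] len_shift[of 0 x] that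
    by (simp add: L_def)
  obtain k :: int where k: "0 \<le> x + k * (2 * pi)" "x + k * (2 * pi) < 2 * pi"
    using periodic_representative[of "2 * pi" x] by auto
  have "len (x + 2 * pi) (x + 2 * pi + 2 * pi) t = len x (x + 2 * pi) t" for x
    using len_shift[of x "x + 2 * pi"] by simp
  from periodic_int_shift[of "\<lambda>x. len x (x + 2 * pi) t", OF this, of x k] show ?thesis
    using base[OF k] by simp
qed

lemma len_other_arc: "\<lbrakk>x \<le> y; y \<le> x + 2 * pi\<rbrakk> \<Longrightarrow> len y (x + 2 * pi) t = L t - len x y t"
  using len_combine[of x y "x + 2 * pi"] by (simp add: len_period)

lemma L_pos: "0 < L t"
  unfolding L_def by (intro len_pos) auto

lemma len_less_L: "\<lbrakk>x \<le> y; y < x + 2 * pi\<rbrakk> \<Longrightarrow> len x y t < L t"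
  using len_other_arc[of x y] len_pos[of y "x + 2 * pi"] by simp

lemma len_DERIV_y:
  assumes "a < y"
  shows "((\<lambda>y. len a y t) has_real_derivative norm (V y t)) (at y)"
proof -
  have "((\<lambda>u. integral {a..u} (\<lambda>z. norm (V z t))) has_vector_derivative norm (V y t)) (at y within {a..y + 1})"
    by (rule integral_has_vector_derivative) (use assms in \<open>auto intro!: continuous_intros V_cont_x\<close>)
  then have "((\<lambda>u. integral {a..u} (\<lambda>z. norm (V z t))) has_vector_derivative norm (V y t)) (at y)"
    using at_within_Icc_at[of a y "y + 1"] assms by simp
  then show ?thesis unfolding len_def by (simp add: has_real_derivative_iff_has_vector_derivative)
qed

lemma tangent_norm: "norm (V x t /\<^sub>R norm (V x t)) = 1"
  using speed_pos[of x] by simp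

lemma tangent_length_eq:
  "integral {x..y} (\<lambda>z. norm (norm (V z t) *\<^sub>R (W z t - g z t)))
     = integral {x..y} (\<lambda>z. norm (V z t) * norm (W z t - g z t))"
  by simp

text \<open>The squared integral on the left is that of the total absolute curvature of the arc in
  space, in other words of the length traced by its unit tangent.\<close>

lemma total_curvature_Cauchy_Schwarz:
  assumes "x < y"
  shows "(integral {x..y} (\<lambda>z. norm (norm (V z t) *\<^sub>R (W z t - g z t))))\<^sup>2
      \<le> (curv x y t + len x y t) * len x y t"
proof -
  have "integral {x..y} (\<lambda>z. norm (V z t) * (norm (W z t - g z t))\<^sup>2)
      = integral {x..y} (\<lambda>z. norm (V z t) * (norm (W z t))\<^sup>2 + norm (V z t))"
    by (simp add: norm_W_minus_g distrib_left)
  also have "\<dots> = curv x y t + len x y t"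
    unfolding curv_def len_def
    by (intro integral_add speed_integrable integrable_continuous_interval continuous_intros V_cont_x W_cont_x)
  finally show ?thesis
    using weighted_Cauchy_Schwarz_integral[of x y "\<lambda>z. norm (V z t)" "\<lambda>z. norm (W z t - g z t)"] len_pos[OF assms]
    unfolding tangent_length_eq len_def[symmetric]
    by (simp add: continuous_on_norm continuous_on_diff V_cont_x W_cont_x g_cont_x)
qed

lemma tangent_angle_bound:
  assumes "x < y"
  shows "(arccos ((V x t /\<^sub>R norm (V x t)) \<bullet> (V y t /\<^sub>R norm (V y t))))\<^sup>2 \<le> (curv x y t + len x y t) * len x y t"
proof -
  have "\<bar>(V x t /\<^sub>R norm (V x t)) \<bullet> (V y t /\<^sub>R norm (V y t))\<bar> \<le> 1"
    using Cauchy_Schwarz_ineq2 tangent_norm by (metis mult_1)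
  then have "0 \<le> arccos ((V x t /\<^sub>R norm (V x t)) \<bullet> (V y t /\<^sub>R norm (V y t)))"
    by (intro arccos_lbound) linarith+
  moreover have "arccos ((V x t /\<^sub>R norm (V x t)) \<bullet> (V y t /\<^sub>R norm (V y t)))
      \<le> integral {x..y} (\<lambda>z. norm (norm (V z t) *\<^sub>R (W z t - g z t)))"
    by (rule arccos_inner_le_length[where \<tau> = "\<lambda>z. V z t /\<^sub>R norm (V z t)"])
      (use assms in \<open>auto intro!: tangent_x continuous_intros V_cont_x W_cont_x g_cont_x simp: speed_pos[simplified]\<close>)
  ultimately show ?thesis
    using total_curvature_Cauchy_Schwarz[OF assms] power_mono order_trans by blast
qed

text \<open>Fenchel's theorem applies because the velocity of a closed curve integrates to
  zero.\<close>

lemma total_curvature_bound: "4 * pi\<^sup>2 \<le> (curv 0 (2 * pi) t + L t) * L t"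
proof -
  have "2 * pi \<le> integral {0..2 * pi} (\<lambda>z. norm (norm (V z t) *\<^sub>R (W z t - g z t)))"
  proof (rule two_pi_le_closed_tangent_length[where \<tau> = "\<lambda>z. V z t /\<^sub>R norm (V z t)" and v = "\<lambda>z. norm (V z t)"])
    fix w :: "real^3"
    have "((\<lambda>z. V z t \<bullet> w) has_integral (g (2 * pi) t \<bullet> w - g 0 t \<bullet> w)) {0..2 * pi}"
    proof (rule fundamental_theorem_of_calculus)
      fix x
      have "((\<lambda>z. g z t \<bullet> w) has_real_derivative V x t \<bullet> w) (at x)"
        using has_real_derivative_inner[OF g_x[OF t, of x] has_vector_derivative_const[of w]] by simp
      then show "((\<lambda>z. g z t \<bullet> w) has_vector_derivative V x t \<bullet> w) (at x within {0..2 * pi})"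
        by (simp add: has_real_derivative_iff_has_vector_derivative has_vector_derivative_at_within)
    qed simp
    moreover have "norm (V z t) * ((V z t /\<^sub>R norm (V z t)) \<bullet> w) = V z t \<bullet> w" for z
      using speed_pos[of z] by simp
    ultimately show "((\<lambda>z. norm (V z t) * ((V z t /\<^sub>R norm (V z t)) \<bullet> w)) has_integral 0) {0..2 * pi}"
      using periodic[OF t, of 0] by (simp only:) simp
  next
    show "V 0 t /\<^sub>R norm (V 0 t) = V (2 * pi) t /\<^sub>R norm (V (2 * pi) t)"
      using V_periodic[of 0] by simp
  qed (auto intro!: tangent_x continuous_intros V_cont_x W_cont_x g_cont_x simp: immersed[OF t])
  then have "(2 * pi)\<^sup>2 \<le> (integral {0..2 * pi} (\<lambda>z. norm (norm (V z t) *\<^sub>R (W z t - g z t))))\<^sup>2"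
    by (intro power_mono) auto
  also have "\<dots> \<le> (curv 0 (2 * pi) t + L t) * L t"
    unfolding L_def by (rule total_curvature_Cauchy_Schwarz) simp
  finally show ?thesis by (simp add: power_mult_distrib)
qed

end

lemma len_t:
  assumes t: "t \<in> J"
  shows "((\<lambda>s. len x y s) has_real_derivative - curv x y t) (at t within J)"
proof -
  have "((\<lambda>s. integral (cbox x y) (\<lambda>z. norm (V z s))) has_field_derivative
      integral (cbox x y) (\<lambda>z. - (norm (V z t) * (norm (W z t))\<^sup>2))) (at t within J)"
  proof (rule leibniz_rule_field_derivative[OF speed_t _ _ t J_convex])
    show "(\<lambda>z. norm (V z s)) integrable_on cbox x y" if "s \<in> J" for s
      using speed_integrable[OF that] by simp
    have sw: "continuous_on (J \<times> cbox x y) (\<lambda>p. F (snd p) (fst p))"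
      if "continuous_on (UNIV \<times> J) (\<lambda>(x, t). F x t)" for F :: "real \<Rightarrow> real \<Rightarrow> real^3"
    proof -
      have "continuous_on (J \<times> cbox x y) (\<lambda>p. (snd p, fst p))" by (intro continuous_intros)
      moreover have "(\<lambda>p. (snd p, fst p)) ` (J \<times> cbox x y) \<subseteq> UNIV \<times> J" by auto
      ultimately have "continuous_on (J \<times> cbox x y) (\<lambda>p. case (snd p, fst p) of (x, t) \<Rightarrow> F x t)"
        by (rule continuous_on_compose2[OF that])
      then show ?thesis by simp
    qed
    show "continuous_on (J \<times> cbox x y) (\<lambda>(s, z). - (norm (V z s) * (norm (W z s))\<^sup>2))"
      unfolding case_prod_unfold by (intro continuous_intros sw V_cont W_cont)
  qed
  then show ?thesis by (simp add: len_def curv_def)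
qed


section \<open>Pairs of points at which the chord bound is attained\<close>

context
  fixes t assumes t: "t \<in> J"
begin

lemma dist_eq_sin: "dist (g x t) (g y t) = 2 * sin (arccos (g x t \<bullet> g y t) / 2)"
proof -
  define c where "c = g x t \<bullet> g y t"
  have c: "\<bar>c\<bar> \<le> 1" using Cauchy_Schwarz_ineq2[of "g x t" "g y t"] unit[OF t] by (simp add: c_def)
  define h where "h = arccos c / 2"
  have h: "0 \<le> h" "h \<le> pi / 2" using arccos_lbound[of c] arccos_ubound[of c] c by (auto simp: h_def)
  have "c = cos (2 * h)" using c by (simp add: h_def)
  then have "c = 1 - 2 * (sin h)\<^sup>2" by (simp add: cos_double_sin)
  moreover have "(dist (g x t) (g y t))\<^sup>2 = 2 - 2 * c"
    unfolding dist_norm power2_norm_eq_inner using g_inner_self[OF t]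
    by (simp add: inner_diff inner_commute c_def)
  ultimately have sq: "(dist (g x t) (g y t))\<^sup>2 = (2 * sin h)\<^sup>2" by (simp add: power_mult_distrib)
  have "0 \<le> sin h" using h by (intro sin_ge_zero) auto
  then have "dist (g x t) (g y t) = 2 * sin h" by (intro power2_eq_imp_eq[OF sq]) auto
  then show ?thesis unfolding h_def c_def .
qed

lemma arcsin_half_dist: "arcsin (dist (g x t) (g y t) / 2) = arccos (g x t \<bullet> g y t) / 2"
proof -
  have "\<bar>g x t \<bullet> g y t\<bar> \<le> 1" using Cauchy_Schwarz_ineq2[of "g x t" "g y t"] unit[OF t] by simp
  then have "0 \<le> arccos (g x t \<bullet> g y t)" "arccos (g x t \<bullet> g y t) \<le> pi"
    by (intro arccos_lbound arccos_ubound; linarith)+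
  then show ?thesis unfolding dist_eq_sin by (simp add: arcsin_sin)
qed

lemma exists_half_length: obtains y where "x < y" "y < x + 2 * pi" "len x y t = L t / 2"
proof -
  have "continuous_on {x..x + 2 * pi} (\<lambda>y. len x y t)"
    unfolding len_def by (intro indefinite_integral_continuous_1 speed_integrable[OF t])
  then obtain y where y: "x \<le> y" "y \<le> x + 2 * pi" "len x y t = L t / 2"
    using IVT'[of "\<lambda>y. len x y t" x "L t / 2" "x + 2 * pi"] L_pos[OF t] len_period[OF t] len_same[OF t] by force
  then have "y \<noteq> x" "y \<noteq> x + 2 * pi" using L_pos[OF t] len_period[OF t] len_same[OF t] by auto
  then show ?thesis using that[of y] y by (simp add: order_less_le)
qed

end

context
  fixes t \<alpha> \<mu> x0 y0 :: real
  assumes t: "t \<in> J" and \<alpha>: "0 < \<alpha>" and \<mu>: "0 < \<mu>" "\<mu> \<le> 1"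
    and below: "\<And>x y. \<lbrakk>x < y; y < x + 2 * pi\<rbrakk> \<Longrightarrow>
      \<mu> * chord_profile \<alpha> (L t) (len x y t) \<le> dist (g x t) (g y t)"
begin

text \<open>The curve is embedded at time \<open>t\<close> because of the bound itself: the profile
  is positive at distinct points.\<close>

lemma chord_pos: "\<lbrakk>x < y; y < x + 2 * pi\<rbrakk> \<Longrightarrow> 0 < dist (g x t) (g y t)"
  using below[of x y] chord_profile_pos[OF \<alpha> L_pos[OF t] len_pos[OF t] len_less_L[OF t], of x y] \<mu>(1)
  by (meson less_imp_le mult_pos_pos order_less_le_trans)

private lemma profile_scaled:
  "\<mu> * chord_profile \<alpha> (L t) l / 2 = \<mu> * L t / (2 * \<alpha>) * arctan (\<alpha> / pi * sin (pi * l / L t))"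
  by (simp add: chord_profile_def)

text \<open>Two points at half length from each other are compared with the diameter of the sphere.
  This is the assumption \<open>b * arctan A \<le> 1\<close> of the subadditivity lemma.\<close>

private lemma amplitude_le_1: "\<mu> * L t / (2 * \<alpha>) * arctan (\<alpha> / pi) \<le> 1"
proof -
  obtain y where y: "0 < y" "y < 0 + 2 * pi" "len 0 y t = L t / 2"
    using exists_half_length[OF t] by blast
  have "\<mu> * chord_profile \<alpha> (L t) (L t / 2) / 2 \<le> dist (g 0 t) (g y t) / 2"
    using below[of 0 y] y by simp
  also have "dist (g 0 t) (g y t) \<le> 2"
    using norm_triangle_ineq4[of "g 0 t" "g y t"] unit[OF t] by (simp add: dist_norm)
  finally show ?thesis unfolding profile_scaled using L_pos[OF t] by simp
qed

text \<open>Half the spherical distance is arcsin of half the chord. It is at least the prescribed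
  value on each of the two partial arcs and equal to it on the whole arc, so additivity of distances
  would contradict strict subadditivity.\<close>

lemma touching_not_between:
  assumes touch: "dist (g x t) (g y t) = \<mu> * chord_profile \<alpha> (L t) (len x y t)"
    and z: "x < z" "z < y" "y < x + 2 * pi"
  shows "arccos (g x t \<bullet> g z t) + arccos (g z t \<bullet> g y t) \<noteq> arccos (g x t \<bullet> g y t)"
proof
  assume eq: "arccos (g x t \<bullet> g z t) + arccos (g z t \<bullet> g y t) = arccos (g x t \<bullet> g y t)"
  define b where "b = \<mu> * L t / (2 * \<alpha>)"
  define A where "A = \<alpha> / pi"
  define u where "u = (\<lambda>x y. pi * len x y t / L t)"
  have L: "L t > 0" by (rule L_pos[OF t])
  have b: "0 < b" and A: "0 < A" and bA: "b * arctan A \<le> 1"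
    using L \<alpha> \<mu> amplitude_le_1 by (simp_all add: b_def A_def)
  have u: "0 < u x z" "0 < u z y" "u x y < pi"
    using len_pos[OF t] len_less_L[OF t, of x y] L z by (auto simp: u_def field_simps)
  have add: "u x y = u x z + u z y"
    using len_combine[OF t, of x z y] z by (simp add: u_def add_divide_distrib[symmetric] distrib_left[symmetric])
  have le: "arcsin (b * arctan (A * sin (u x' y'))) \<le> arccos (g x' t \<bullet> g y' t) / 2"
    if "x' < y'" "y' < x' + 2 * pi" for x' y'
  proof -
    have "b * arctan (A * sin (u x' y')) = \<mu> * chord_profile \<alpha> (L t) (len x' y' t) / 2"
      unfolding profile_scaled by (simp add: b_def A_def u_def)
    moreover have "0 \<le> \<mu> * chord_profile \<alpha> (L t) (len x' y' t)"
      using \<mu> chord_profile_pos[OF \<alpha> L len_pos[OF t] len_less_L[OF t], of x' y'] that by simp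
    moreover have "dist (g x' t) (g y' t) / 2 \<le> 1"
      using norm_triangle_ineq4[of "g x' t" "g y' t"] unit[OF t] by (simp add: dist_norm)
    ultimately show ?thesis
      unfolding arcsin_half_dist[OF t, symmetric] using below[OF that] by (intro arcsin_le_arcsin) auto
  qed
  have "arccos (g x t \<bullet> g y t) / 2 = arcsin (b * arctan (A * sin (u x y)))"
  proof -
    have "b * arctan (A * sin (u x y)) = dist (g x t) (g y t) / 2"
      unfolding touch profile_scaled by (simp add: b_def A_def u_def)
    then show ?thesis by (simp only: arcsin_half_dist[OF t])
  qed
  also have "\<dots> < arcsin (b * arctan (A * sin (u x z))) + arcsin (b * arctan (A * sin (u z y)))"
    unfolding add by (rule arcsin_arctan_sin_subadd[OF A b bA]) (use u add in auto)
  also have "\<dots> \<le> arccos (g x t \<bullet> g z t) / 2 + arccos (g z t \<bullet> g y t) / 2"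
    using z by (intro add_mono le) auto
  also have "\<dots> = arccos (g x t \<bullet> g y t) / 2" using eq by simp
  finally show False by simp
qed

context
  assumes xy: "x0 < y0" "y0 < x0 + 2 * pi"
    and touch: "dist (g x0 t) (g y0 t) = \<mu> * chord_profile \<alpha> (L t) (len x0 y0 t)"
    and half: "len x0 y0 t \<le> L t / 2"
begin

private abbreviation "p \<equiv> g x0 t"
private abbreviation "q \<equiv> g y0 t"
private abbreviation "l \<equiv> len x0 y0 t"
private abbreviation "P \<equiv> chord_profile \<alpha> (L t) l"
private abbreviation "P1 \<equiv> chord_profile_deriv \<alpha> (L t) l"
private abbreviation "P2 \<equiv> chord_profile_deriv2 \<alpha> (L t) l"

text \<open>Points beyond \<open>y0\<close> lie on the complementary arc. It has the same chord and,
  by the symmetry of the sine, the same profile, so its end points touch as well.\<close>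

lemma touching_no_crossing:
  assumes "x0 < z" "z < x0 + 2 * pi" "z \<noteq> y0"
  shows "arccos (p \<bullet> g z t) + arccos (g z t \<bullet> q) \<noteq> arccos (p \<bullet> q)"
proof (cases "z < y0")
  case True
  then show ?thesis using touching_not_between[OF touch] assms xy by simp
next
  case False
  have "dist (g y0 t) (g (x0 + 2 * pi) t) = \<mu> * chord_profile \<alpha> (L t) (len y0 (x0 + 2 * pi) t)"
    using touch xy
    by (simp add: periodic[OF t] len_other_arc[OF t] chord_profile_reflect[OF L_pos[OF t]] dist_commute)
  from touching_not_between[OF this, of z] show ?thesis
    using False assms xy by (simp add: periodic[OF t] inner_commute add.commute)
qed

lemma touching_not_parallel: "\<bar>p \<bullet> q\<bar> < 1"
proof -
  have "\<bar>p \<bullet> q\<bar> \<le> 1" using Cauchy_Schwarz_ineq2[of p q] unit[OF t] by simp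
  moreover have "p \<bullet> q \<noteq> 1"
  proof
    assume "p \<bullet> q = 1"
    then have "dist p q = 0" by (simp add: dist_eq_sin[OF t])
    then show False using chord_pos[OF xy] by simp
  qed
  \<comment> \<open>Every point of the sphere lies between two antipodal points, so any interior
    point of the arc would contradict \<open>touching_not_between\<close>.\<close>
  moreover have "p \<bullet> q \<noteq> - 1"
  proof
    assume "p \<bullet> q = - 1"
    then have "(p + q) \<bullet> (p + q) = 0"
      using g_inner_self[OF t] by (simp add: inner_add inner_commute)
    then have "p + q = 0" by simp
    then have q: "q = - p" by (simp add: add_eq_0_iff)
    define z where "z = (x0 + y0) / 2"
    have z: "x0 < z" "z < y0" using xy by (auto simp: z_def)
    have "\<bar>p \<bullet> g z t\<bar> \<le> 1" using Cauchy_Schwarz_ineq2[of p "g z t"] unit[OF t] by simp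
    then have "arccos (p \<bullet> g z t) + arccos (g z t \<bullet> q) = pi"
      unfolding q by (simp add: inner_commute arccos_minus abs_le_iff)
    moreover have "arccos (p \<bullet> q) = pi" using \<open>p \<bullet> q = - 1\<close> by simp
    ultimately show False using touching_not_between[OF touch z xy(2)] by simp
  qed
  ultimately show ?thesis by linarith
qed

lemma touching_opposite_sides: "(V x0 t \<bullet> cross3 p q) * (V y0 t \<bullet> cross3 p q) \<le> 0"
proof (rule ccontr)
  assume "\<not> ?thesis"
  then obtain n where n: "n = cross3 p q \<or> n = - cross3 p q" "0 < n \<bullet> V x0 t" "0 < n \<bullet> V y0 t"
    by (auto simp: not_le zero_less_mult_iff inner_commute intro: that[of "cross3 p q"] that[of "- cross3 p q"])
  show False
  proof (rule chord_not_crossed_from_same_side[of "\<lambda>z. g z t" "\<lambda>z. V z t" "x0 + 2 * pi" x0 y0 n])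
    show "((\<lambda>z. g z t) has_vector_derivative V z t) (at z)" for z by (rule g_x[OF t])
    show "continuous_on UNIV (\<lambda>z. V z t)" by (rule V_cont_x[OF t])
    show "\<bar>p \<bullet> q\<bar> < 1" by (rule touching_not_parallel)
    show "g z t \<noteq> g w t" if "x0 \<le> z" "z < w" "w < x0 + 2 * pi" for z w
      using chord_pos[of z w] that by auto
    show "g z t \<noteq> A *\<^sub>R p + B *\<^sub>R q" if "x0 < z" "z < x0 + 2 * pi" "z \<noteq> y0" "0 < A" "0 < B" for z A B
      using touching_no_crossing[OF that(1-3)]
        arccos_add_geodesic[OF unit[OF t] unit[OF t] touching_not_parallel unit[OF t] that(4,5)] by blast
    show "n \<bullet> p = 0" "n \<bullet> q = 0" using n(1) by (auto simp: inner_commute dot_cross_self)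
    show "a \<bullet> cross3 p q = 0" if "a \<bullet> n = 0" for a using n(1) that by auto
  qed (use n xy periodic[OF t] V_periodic[OF t] unit[OF t] in simp_all)
qed

text \<open>First and second variation when the two parameters move with velocities
  \<open>\<xi>\<close> and \<open>\<eta>\<close>. They are computed for half the difference of the
  squares of chord and bound, which is zero at the pair and nonnegative nearby.\<close>

lemma touching_variation:
  fixes \<xi> \<eta> :: real
  shows "(q - p) \<bullet> (\<eta> *\<^sub>R V y0 t - \<xi> *\<^sub>R V x0 t)
      = \<mu>\<^sup>2 * P * P1 * (\<eta> * norm (V y0 t) - \<xi> * norm (V x0 t))" (is ?first)
    and "0 \<le> (norm (\<eta> *\<^sub>R V y0 t - \<xi> *\<^sub>R V x0 t))\<^sup>2
      + (q - p) \<bullet> (\<eta>\<^sup>2 *\<^sub>R A y0 t - \<xi>\<^sup>2 *\<^sub>R A x0 t)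
      - \<mu>\<^sup>2 * (P1\<^sup>2 + P * P2) * (\<eta> * norm (V y0 t) - \<xi> * norm (V x0 t))\<^sup>2
      - \<mu>\<^sup>2 * P * P1 * (\<eta>\<^sup>2 * ((A y0 t \<bullet> V y0 t) / norm (V y0 t)) - \<xi>\<^sup>2 * ((A x0 t \<bullet> V x0 t) / norm (V x0 t)))" (is ?second)
proof -
  define X Y where "X = (\<lambda>h. x0 + \<xi> * h)" and "Y = (\<lambda>h. y0 + \<eta> * h)"
  \<comment> \<open>A base point to the left of both moving parameters: the arc length between them
    becomes a difference of two lengths with fixed lower limit.\<close>
  define a where "a = x0 - 1"
  have "\<forall>\<^sub>F h in nhds 0. a < X h \<and> X h < Y h \<and> Y h < X h + 2 * pi"
  proof (intro eventually_conj)
    have c: "(X \<longlongrightarrow> x0) (nhds 0)" "(Y \<longlongrightarrow> y0) (nhds 0)"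
      unfolding X_def Y_def by (auto intro!: tendsto_eq_intros filterlim_ident)
    show "\<forall>\<^sub>F h in nhds 0. a < X h" by (rule order_tendstoD(1)[OF c(1)]) (simp add: a_def)
    have "\<forall>\<^sub>F h in nhds 0. 0 < Y h - X h"
      by (rule order_tendstoD(1)[OF tendsto_diff[OF c(2,1)]]) (use xy in simp)
    then show "\<forall>\<^sub>F h in nhds 0. X h < Y h" by simp
    have "\<forall>\<^sub>F h in nhds 0. Y h - X h < 2 * pi"
      by (rule order_tendstoD(2)[OF tendsto_diff[OF c(2,1)]]) (use xy in simp)
    then show "\<forall>\<^sub>F h in nhds 0. Y h < X h + 2 * pi" by (simp add: algebra_simps)
  qed
  then obtain \<delta> where \<delta>: "\<delta> > 0" "\<And>h. \<bar>h\<bar> < \<delta> \<Longrightarrow> a < X h \<and> X h < Y h \<and> Y h < X h + 2 * pi"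
    by (auto simp: eventually_nhds_metric dist_real_def)
  define D where "D = (\<lambda>h. g (Y h) t - g (X h) t)"
  define D' where "D' = (\<lambda>h. \<eta> *\<^sub>R V (Y h) t - \<xi> *\<^sub>R V (X h) t)"
  define \<Lambda> where "\<Lambda> = (\<lambda>h. len (X h) (Y h) t)"
  define \<Lambda>' where "\<Lambda>' = (\<lambda>h. \<eta> * norm (V (Y h) t) - \<xi> * norm (V (X h) t))"
  have XY0: "X 0 = x0" "Y 0 = y0" by (simp_all add: X_def Y_def)
  have dX: "(X has_real_derivative \<xi>) (at h)" and dY: "(Y has_real_derivative \<eta>) (at h)" for h
    unfolding X_def Y_def by (auto intro!: derivative_eq_intros)
  note dX' = dX[unfolded has_real_derivative_iff_has_vector_derivative]
    and dY' = dY[unfolded has_real_derivative_iff_has_vector_derivative]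
  have dD: "(D has_vector_derivative D' h) (at h)" for h
    unfolding D_def D'_def
    using vector_diff_chain_at[OF dX' g_x[OF t]] vector_diff_chain_at[OF dY' g_x[OF t]]
    by (intro has_vector_derivative_diff) (simp_all add: o_def)
  have dD': "(D' has_vector_derivative \<eta>\<^sup>2 *\<^sub>R A y0 t - \<xi>\<^sup>2 *\<^sub>R A x0 t) (at 0)"
  proof -
    have "((\<lambda>h. V (X h) t) has_vector_derivative \<xi> *\<^sub>R A x0 t) (at 0)"
      "((\<lambda>h. V (Y h) t) has_vector_derivative \<eta> *\<^sub>R A y0 t) (at 0)"
      using vector_diff_chain_at[OF dX' V_x[OF t], of 0] vector_diff_chain_at[OF dY' V_x[OF t], of 0]
      by (simp_all add: o_def XY0)
    then have "(D' has_vector_derivative \<eta> *\<^sub>R \<eta> *\<^sub>R A y0 t - \<xi> *\<^sub>R \<xi> *\<^sub>R A x0 t) (at 0)"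
      unfolding D'_def
      by (intro has_vector_derivative_diff bounded_linear.has_vector_derivative[OF bounded_linear_scaleR_right])
    then show ?thesis by (simp add: power2_eq_square)
  qed
  have d\<Lambda>: "(\<Lambda> has_real_derivative \<Lambda>' h) (at h)" if "\<bar>h\<bar> < \<delta>" for h
  proof -
    have "((\<lambda>h. len a (Y h) t - len a (X h) t) has_real_derivative norm (V (Y h) t) * \<eta> - norm (V (X h) t) * \<xi>) (at h)"
      using \<delta>(2)[OF that]
      by (intro DERIV_diff DERIV_chain2[OF len_DERIV_y[OF t] dY] DERIV_chain2[OF len_DERIV_y[OF t] dX]) auto
    then have "((\<lambda>h. len a (Y h) t - len a (X h) t) has_real_derivative \<Lambda>' h) (at h)"
      by (simp add: \<Lambda>'_def mult.commute)
    then show ?thesis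
    proof (rule has_field_derivative_transform_within_open[where S = "{-\<delta><..<\<delta>}"])
      show "len a (Y h) t - len a (X h) t = \<Lambda> h" if "h \<in> {-\<delta><..<\<delta>}" for h
        using len_combine[OF t, of a "X h" "Y h"] \<delta>(2)[of h] that by (simp add: \<Lambda>_def abs_less_iff)
    qed (use that in \<open>auto simp: abs_less_iff\<close>)
  qed
  have d\<Lambda>': "(\<Lambda>' has_real_derivative \<eta>\<^sup>2 * ((A y0 t \<bullet> V y0 t) / norm (V y0 t))
      - \<xi>\<^sup>2 * ((A x0 t \<bullet> V x0 t) / norm (V x0 t))) (at 0)"
    unfolding \<Lambda>'_def
    using DERIV_diff[OF DERIV_cmult[OF DERIV_chain2[OF speed_x[OF t] dY], of \<eta>] DERIV_cmult[OF DERIV_chain2[OF speed_x[OF t] dX], of \<xi>], of 0]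
    by (simp add: XY0 power2_eq_square mult_ac)
  define Q where "Q = chord_profile \<alpha> (L t)"
  define Q1 where "Q1 = chord_profile_deriv \<alpha> (L t)"
  have dQ: "(Q has_real_derivative Q1 s) (at s)" for s
    unfolding Q_def Q1_def by (rule chord_profile_DERIV[OF \<alpha> L_pos[OF t]])
  have dQ1: "(Q1 has_real_derivative chord_profile_deriv2 \<alpha> (L t) s) (at s)" for s
    unfolding Q1_def by (rule chord_profile_deriv_DERIV[OF L_pos[OF t]])
  define f where "f = (\<lambda>h. (D h \<bullet> D h - \<mu>\<^sup>2 * (Q (\<Lambda> h) * Q (\<Lambda> h))) / 2)"
  define f' where "f' = (\<lambda>h. D h \<bullet> D' h - \<mu>\<^sup>2 * (Q (\<Lambda> h) * (Q1 (\<Lambda> h) * \<Lambda>' h)))"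
  have df: "(f has_real_derivative f' h) (at h)" if "\<bar>h\<bar> < \<delta>" for h
  proof -
    have 1: "((\<lambda>h. D h \<bullet> D h) has_real_derivative 2 * (D h \<bullet> D' h)) (at h)"
      using has_real_derivative_inner[OF dD dD, of h] by (simp add: inner_commute)
    have 2: "((\<lambda>h. Q (\<Lambda> h) * Q (\<Lambda> h)) has_real_derivative 2 * (Q (\<Lambda> h) * (Q1 (\<Lambda> h) * \<Lambda>' h))) (at h)"
      using DERIV_mult[OF DERIV_chain2[OF dQ d\<Lambda>[OF that]] DERIV_chain2[OF dQ d\<Lambda>[OF that]]] by (simp add: mult_ac)
    show ?thesis unfolding f_def f'_def
      using DERIV_cdivide[OF DERIV_diff[OF 1 DERIV_cmult[OF 2, of "\<mu>\<^sup>2"]], of 2] by (simp add: diff_divide_distrib)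
  qed
  have df': "(f' has_real_derivative (D 0 \<bullet> (\<eta>\<^sup>2 *\<^sub>R A y0 t - \<xi>\<^sup>2 *\<^sub>R A x0 t) + D' 0 \<bullet> D' 0)
      - \<mu>\<^sup>2 * ((Q1 (\<Lambda> 0) * \<Lambda>' 0) * (Q1 (\<Lambda> 0) * \<Lambda>' 0)
          + ((chord_profile_deriv2 \<alpha> (L t) (\<Lambda> 0) * \<Lambda>' 0) * \<Lambda>' 0
             + (\<eta>\<^sup>2 * ((A y0 t \<bullet> V y0 t) / norm (V y0 t)) - \<xi>\<^sup>2 * ((A x0 t \<bullet> V x0 t) / norm (V x0 t))) * Q1 (\<Lambda> 0)) * Q (\<Lambda> 0))) (at 0)"
    unfolding f'_def
    by (rule DERIV_diff[OF has_real_derivative_inner[OF dD dD'] DERIV_cmult[OF DERIV_mult[OF DERIV_chain2[OF dQ d\<Lambda>]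
      DERIV_mult[OF DERIV_chain2[OF dQ1 d\<Lambda>] d\<Lambda>']]]]) (use \<delta> in auto)
  have ff: "f h = ((dist (g (X h) t) (g (Y h) t))\<^sup>2 - (\<mu> * Q (\<Lambda> h))\<^sup>2) / 2" for h
    by (simp add: f_def D_def dist_commute[of "g (X h) t"] dist_norm norm_minus_commute[of "g (X h) t"]
        power2_norm_eq_inner power_mult_distrib power2_eq_square[of "Q (\<Lambda> h)"])
  have f0: "f 0 = 0" using touch by (simp add: ff XY0 \<Lambda>_def Q_def)
  have fpos: "f 0 \<le> f h" if "\<bar>h\<bar> < \<delta>" for h
  proof -
    have "0 \<le> \<mu> * Q (\<Lambda> h)" "\<mu> * Q (\<Lambda> h) \<le> dist (g (X h) t) (g (Y h) t)"
      unfolding Q_def \<Lambda>_def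
      using \<delta>(2)[OF that] below[of "X h" "Y h"] \<mu>(1)
        chord_profile_pos[OF \<alpha> L_pos[OF t] len_pos[OF t] len_less_L[OF t], of "X h" "Y h"] by auto
    then have "(\<mu> * Q (\<Lambda> h))\<^sup>2 \<le> (dist (g (X h) t) (g (Y h) t))\<^sup>2" by (intro power_mono)
    then show ?thesis unfolding f0 by (simp add: ff)
  qed
  note test = second_derivative_test_min[OF \<delta>(1) df df' fpos]
  show ?first
    using test(1) by (simp add: f'_def D_def D'_def \<Lambda>_def \<Lambda>'_def Q_def Q1_def XY0 mult_ac)
  have "D' 0 \<bullet> D' 0 = (norm (\<eta> *\<^sub>R V y0 t - \<xi> *\<^sub>R V x0 t))\<^sup>2"
    by (simp add: D'_def XY0 power2_norm_eq_inner)
  then show ?second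
    using test(2) by (simp add: D_def \<Lambda>_def \<Lambda>'_def Q_def Q1_def XY0 power2_eq_square algebra_simps)
qed

lemma touching_first_order:
  "(q - p) \<bullet> V x0 t = norm (V x0 t) * (\<mu>\<^sup>2 * P * P1)" "(q - p) \<bullet> V y0 t = norm (V y0 t) * (\<mu>\<^sup>2 * P * P1)"
  using touching_variation(1)[of 0 "- 1"] touching_variation(1)[of 1 0] by (simp_all add: mult_ac)

text \<open>By the first order conditions the tangent at \<open>p\<close> has inner product
  \<open>\<mu>\<^sup>2 * P * P1\<close> with \<open>q\<close>, and the chord is
  \<open>\<mu> * P\<close>; the quotient is \<open>\<mu> * P1\<close>.\<close>

lemma touching_tangents:
  "(V x0 t /\<^sub>R norm (V x0 t)) \<bullet> (V y0 t /\<^sub>R norm (V y0 t)) = 2 * (\<mu> * P1)\<^sup>2 - 1"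
proof -
  let ?a = "V x0 t /\<^sub>R norm (V x0 t)" and ?b = "V y0 t /\<^sub>R norm (V y0 t)"
  have n: "norm (V x0 t) > 0" "norm (V y0 t) > 0" using speed_pos[OF t] by auto
  have a: "?a \<bullet> q = \<mu>\<^sup>2 * P * P1"
  proof -
    have "V x0 t \<bullet> q = norm (V x0 t) * (\<mu>\<^sup>2 * P * P1)"
      using touching_first_order(1) g_inner_V[OF t, of x0] by (simp add: inner_diff inner_commute)
    then show ?thesis using n(1) by simp
  qed
  have b: "?b \<bullet> p = - (\<mu>\<^sup>2 * P * P1)"
  proof -
    have "V y0 t \<bullet> p = - (norm (V y0 t) * (\<mu>\<^sup>2 * P * P1))"
      using touching_first_order(2) g_inner_V[OF t, of y0] by (simp add: inner_diff inner_commute)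
    then show ?thesis using n(2) by simp
  qed
  have "(?a \<bullet> cross3 p q) * (?b \<bullet> cross3 p q)
      = (V x0 t \<bullet> cross3 p q) * (V y0 t \<bullet> cross3 p q) / (norm (V x0 t) * norm (V y0 t))"
    by (simp add: divide_inverse mult_ac)
  also have "\<dots> \<le> 0" using touching_opposite_sides n by (simp add: divide_le_0_iff zero_less_mult_iff)
  finally have "?a \<bullet> ?b = 2 * ((?a \<bullet> q) / dist p q)\<^sup>2 - 1"
    using a b n g_inner_V[OF t] unit[OF t]
    by (intro inner_tangents_opposite_sides touching_not_parallel) (auto simp: inner_commute)
  moreover have "P > 0" using chord_pos[OF xy] touch \<mu>(1) by (simp add: zero_less_mult_iff)
  ultimately show ?thesis using \<mu>(1) unfolding a touch by (simp add: power2_eq_square)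
qed

text \<open>The parameters move with unit speed in opposite senses, so the arc shortens at rate 2
  and the velocity of the chord is, up to sign, the sum of the unit tangents. Its squared norm
  \<open>4 * (\<mu> * P1)\<^sup>2\<close> cancels the term with \<open>P1\<^sup>2\<close>; the
  curvature vectors in space differ from \<open>W\<close> by the position, whence
  \<open>(\<mu> * P)\<^sup>2\<close>.\<close>

lemma touching_second_order:
  "4 * \<mu>\<^sup>2 * P * P2 + (\<mu> * P)\<^sup>2 \<le> (q - p) \<bullet> (W y0 t - W x0 t)"
proof -
  define r s where "r = norm (V x0 t)" and "s = norm (V y0 t)"
  define a b where "a = A x0 t \<bullet> V x0 t" and "b = A y0 t \<bullet> V y0 t"
  define E where "E = \<mu>\<^sup>2 * P * P1"
  have n: "r > 0" "s > 0" using speed_pos[OF t] by (auto simp: r_def s_def)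
  have "(norm ((- inverse s) *\<^sub>R V y0 t - inverse r *\<^sub>R V x0 t))\<^sup>2
      = (inverse r *\<^sub>R V x0 t + inverse s *\<^sub>R V y0 t) \<bullet> (inverse r *\<^sub>R V x0 t + inverse s *\<^sub>R V y0 t)"
    by (simp add: power2_norm_eq_inner inner_add inner_diff algebra_simps)
  also have "\<dots> = 2 + 2 * ((inverse r *\<^sub>R V x0 t) \<bullet> (inverse s *\<^sub>R V y0 t))"
  proof -
    have "(inverse r *\<^sub>R V x0 t) \<bullet> (inverse r *\<^sub>R V x0 t) = 1" "(inverse s *\<^sub>R V y0 t) \<bullet> (inverse s *\<^sub>R V y0 t) = 1"
      using tangent_norm[OF t] by (simp_all only: r_def s_def norm_eq_1)
    moreover have "(u + w) \<bullet> (u + w) = u \<bullet> u + w \<bullet> w + 2 * (u \<bullet> w)" for u w :: "real^3"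
      by (simp add: inner_add inner_commute)
    ultimately show ?thesis by (simp only:)
  qed
  also have "\<dots> = 4 * (\<mu> * P1)\<^sup>2" using touching_tangents by (simp add: r_def s_def)
  finally have sq: "(norm ((- inverse s) *\<^sub>R V y0 t - inverse r *\<^sub>R V x0 t))\<^sup>2 = 4 * (\<mu> * P1)\<^sup>2" .
  \<comment> \<open>The tangential acceleration of the parametrisation is evaluated by the first
    order condition, and it will cancel against the acceleration of the arc length.\<close>
  have Ax: "(q - p) \<bullet> ((inverse r)\<^sup>2 *\<^sub>R A x0 t) = (q - p) \<bullet> (W x0 t - p) + a / r ^ 3 * E"
  proof -
    have "(inverse r)\<^sup>2 *\<^sub>R A x0 t = (W x0 t - p) + (a / r ^ 4) *\<^sub>R V x0 t"
      by (simp add: flow[OF t] a_def r_def power_inverse)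
    then show ?thesis
      using n touching_first_order(1) unfolding r_def[symmetric] E_def[symmetric]
      by (simp add: inner_add_right power4_eq_xxxx power3_eq_cube)
  qed
  have Ay: "(q - p) \<bullet> ((inverse s)\<^sup>2 *\<^sub>R A y0 t) = (q - p) \<bullet> (W y0 t - q) + b / s ^ 3 * E"
  proof -
    have "(inverse s)\<^sup>2 *\<^sub>R A y0 t = (W y0 t - q) + (b / s ^ 4) *\<^sub>R V y0 t"
      by (simp add: flow[OF t] b_def s_def power_inverse)
    then show ?thesis
      using n touching_first_order(2) unfolding s_def[symmetric] E_def[symmetric]
      by (simp add: inner_add_right power4_eq_xxxx power3_eq_cube)
  qed
  have l: "(- inverse s * s - inverse r * r)\<^sup>2 = 4" using n by simp
  have m: "(inverse s)\<^sup>2 * (b / s) = b / s ^ 3" "(inverse r)\<^sup>2 * (a / r) = a / r ^ 3"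
    by (simp_all add: power2_eq_square power3_eq_cube divide_inverse)
  have "0 \<le> 4 * (\<mu> * P1)\<^sup>2 + ((q - p) \<bullet> ((inverse s)\<^sup>2 *\<^sub>R A y0 t) - (q - p) \<bullet> ((inverse r)\<^sup>2 *\<^sub>R A x0 t))
      - \<mu>\<^sup>2 * (P1\<^sup>2 + P * P2) * 4 - E * (b / s ^ 3 - a / r ^ 3)"
    using touching_variation(2)[of "- inverse s" "inverse r"]
    unfolding r_def[symmetric] s_def[symmetric] a_def[symmetric] b_def[symmetric] E_def[symmetric]
    by (simp only: sq l m power2_minus inner_diff_right)
  also have "\<dots> = (q - p) \<bullet> (W y0 t - W x0 t) - (q - p) \<bullet> (q - p) - 4 * \<mu>\<^sup>2 * P * P2"
    unfolding Ax Ay by (simp add: inner_diff_right power_mult_distrib algebra_simps)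
  also have "(q - p) \<bullet> (q - p) = (\<mu> * P)\<^sup>2"
    unfolding touch[symmetric] dist_norm norm_minus_commute[of p] by (simp add: power2_norm_eq_inner)
  finally show ?thesis by simp
qed

text \<open>The bracket is the time derivative of \<open>P\<close> along the flow, and the
  right-hand side is half the time derivative of the squared chord.\<close>

lemma touching_flow_inequality:
  "\<mu>\<^sup>2 * P * (- curv 0 (2 * pi) t / L t * (P - l * P1) + (- curv x0 y0 t) * P1
     + 4 * pi\<^sup>2 / (L t)\<^sup>2 * (P - L t / pi * (sin (pi * l / L t) / (1 + (\<alpha> / pi * sin (pi * l / L t))\<^sup>2))))
   \<le> (q - p) \<bullet> (W y0 t - W x0 t)" (is "\<mu>\<^sup>2 * P * ?R \<le> _")
proof -
  have P: "P > 0" using chord_pos[OF xy] touch \<mu>(1) by (simp add: zero_less_mult_iff)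
  have l: "0 < l" "0 < L t" using len_pos[OF t xy(1)] L_pos[OF t] by auto
  \<comment> \<open>Here \<open>half\<close> enters: with \<open>P1\<close> nonnegative the angle
    \<open>\<omega>\<close> is at most \<pi> / 2, so that \<open>2 * \<omega>\<close> remains in the
    range of arccos.\<close>
  have P1: "0 \<le> P1" "P1 \<le> 1"
  proof -
    have "0 \<le> pi * l / L t" "pi * l / L t \<le> pi / 2" using l half by (auto simp: field_simps)
    then have "0 \<le> cos (pi * l / L t)" by (intro cos_ge_zero) auto
    then show "0 \<le> P1" unfolding chord_profile_deriv_def by (intro divide_nonneg_nonneg) auto
    have "cos (pi * l / L t) \<le> 1 + (\<alpha> / pi * sin (pi * l / L t))\<^sup>2"
      by (rule order_trans[OF cos_le_one]) simp
    then show "P1 \<le> 1" unfolding chord_profile_deriv_def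
      by (intro divide_le_eq_1_pos[THEN iffD2]) (auto simp: add_pos_nonneg)
  qed
  have c: "0 \<le> \<mu> * P1" "\<mu> * P1 \<le> 1" using P1 \<mu> by (auto intro: mult_le_one)
  define \<omega> where "\<omega> = arccos (\<mu> * P1)"
  have "2 * (\<mu> * P1)\<^sup>2 - 1 = cos (2 * \<omega>)"
    using c by (simp add: \<omega>_def cos_double_cos)
  moreover have "0 \<le> 2 * \<omega>" "2 * \<omega> \<le> pi"
    using c arccos_lbound[of "\<mu> * P1"] arccos_le_pi2[of "\<mu> * P1"] by (auto simp: \<omega>_def)
  ultimately have "arccos (2 * (\<mu> * P1)\<^sup>2 - 1) = 2 * \<omega>" by (simp add: arccos_cos)
  then have k: "4 * \<omega>\<^sup>2 \<le> (curv x0 y0 t + l) * l"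
    using tangent_angle_bound[OF t xy(1)] unfolding touching_tangents by (simp add: power_mult_distrib)
  have "?R \<le> P + 4 * P2"
    using chord_profile_supersolution[OF \<alpha> l(2,1) half \<mu> total_curvature_bound[OF t] k[unfolded \<omega>_def]]
    by simp
  then have "\<mu>\<^sup>2 * P * ?R \<le> \<mu>\<^sup>2 * P * (P + 4 * P2)"
    using P by (intro mult_left_mono) auto
  also have "\<dots> = 4 * \<mu>\<^sup>2 * P * P2 + (\<mu> * P)\<^sup>2" by (simp add: power2_eq_square algebra_simps)
  also have "\<dots> \<le> (q - p) \<bullet> (W y0 t - W x0 t)" by (rule touching_second_order)
  finally show ?thesis .
qed

end
end
end

section \<open>The first touching time\<close>

context sphere_curve_flow begin

definition rtime :: "real \<Rightarrow> real" where
  "rtime t = integral {0..t} (\<lambda>s. 1 / (L s)\<^sup>2)"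

definition profile :: "real \<Rightarrow> real \<Rightarrow> real \<Rightarrow> real \<Rightarrow> real" where
  "profile a x y t = chord_profile (a * exp (- 4 * pi\<^sup>2 * rtime t)) (L t) (len x y t)"

lemma L_t: "t \<in> J \<Longrightarrow> (L has_real_derivative - curv 0 (2 * pi) t) (at t within J)"
  unfolding L_def[abs_def] by (rule len_t)

lemma L_cont: "continuous_on J L"
  using L_t by (meson DERIV_continuous_on)

lemma Icc_subset_J: "t \<in> J \<Longrightarrow> {0..t} \<subseteq> J"
  using J_down by auto

lemma inverse_L_cont: "t \<in> J \<Longrightarrow> continuous_on {0..t} (\<lambda>s. 1 / (L s)\<^sup>2)"
proof (intro continuous_intros continuous_on_subset[OF L_cont] Icc_subset_J)
  show "\<forall>s\<in>{0..t}. (L s)\<^sup>2 \<noteq> 0" if "t \<in> J"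
    using L_pos Icc_subset_J[OF that] by (fastforce simp: subset_iff)
qed

lemma rtime_cont: "t \<in> J \<Longrightarrow> continuous_on {0..t} rtime"
  unfolding rtime_def[abs_def]
  by (intro indefinite_integral_continuous_1 integrable_continuous_interval inverse_L_cont)

lemma rtime_deriv:
  assumes "t \<in> J"
  shows "(rtime has_real_derivative 1 / (L t)\<^sup>2) (at t within {0..t})"
  using integral_has_vector_derivative[OF inverse_L_cont[OF assms], of t] J_nonneg[OF assms]
  unfolding rtime_def[abs_def] by (simp add: has_real_derivative_iff_has_vector_derivative)

lemma profile_pos:
  assumes "t \<in> J" "0 < a" "x < y" "y < x + 2 * pi"
  shows "0 < profile a x y t"
  unfolding profile_def using assms
  by (intro chord_profile_pos len_pos len_less_L L_pos) auto

lemma profile_other_arc: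
  assumes "t \<in> J" "x \<le> y" "y \<le> x + 2 * pi"
  shows "profile a y (x + 2 * pi) t = profile a x y t"
  unfolding profile_def using assms by (simp add: len_other_arc chord_profile_reflect[OF L_pos])

lemma profile_shift:
  assumes "t \<in> J"
  shows "profile a (x + 2 * pi) (y + 2 * pi) t = profile a x y t"
  unfolding profile_def using assms by (simp add: len_shift)

text \<open>Half the difference of the squares of chord and bound is zero at \<open>t\<close> and
  nonnegative before, yet its derivative at \<open>t\<close> is at least
  \<open>\<epsilon> * \<Lambda> t * (P t)\<^sup>2\<close>. The slope of \<open>\<Lambda>\<close>
  thus turns the weak flow inequality into a contradiction. Only the past matters, so derivatives
  are taken within \<open>{0..t}\<close>.\<close>

lemma no_first_touching_half:
  fixes a \<epsilon> :: real
  defines "\<Lambda> \<equiv> \<lambda>s. 1 - \<epsilon> * (1 + s)"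
  assumes t: "t \<in> J" "0 < t" and a: "0 < a" and \<epsilon>: "0 < \<epsilon>" "\<epsilon> * (1 + t) < 1"
    and below: "\<And>x y. \<lbrakk>x < y; y < x + 2 * pi\<rbrakk> \<Longrightarrow> \<Lambda> t * profile a x y t \<le> dist (g x t) (g y t)"
    and prev: "\<And>s. \<lbrakk>0 \<le> s; s < t\<rbrakk> \<Longrightarrow> \<Lambda> s * profile a x0 y0 s \<le> dist (g x0 s) (g y0 s)"
    and xy: "x0 < y0" "y0 < x0 + 2 * pi"
    and touch: "dist (g x0 t) (g y0 t) = \<Lambda> t * profile a x0 y0 t"
    and half: "len x0 y0 t \<le> L t / 2"
  shows False
proof -
  define \<alpha> where "\<alpha> = (\<lambda>s. a * exp (- 4 * pi\<^sup>2 * rtime s))"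
  have \<alpha>_eq: "a * exp (- 4 * pi\<^sup>2 * rtime s) = \<alpha> s" for s by (simp add: \<alpha>_def)
  have \<alpha>: "0 < \<alpha> t" using a by (simp add: \<alpha>_def)
  have \<mu>: "0 < \<Lambda> t" "\<Lambda> t \<le> 1" using \<epsilon> t by (auto simp: \<Lambda>_def)
  define R where "R = - curv 0 (2 * pi) t / L t * (chord_profile (\<alpha> t) (L t) (len x0 y0 t)
        - len x0 y0 t * chord_profile_deriv (\<alpha> t) (L t) (len x0 y0 t))
     + (- curv x0 y0 t) * chord_profile_deriv (\<alpha> t) (L t) (len x0 y0 t)
     + 4 * pi\<^sup>2 / (L t)\<^sup>2 * (chord_profile (\<alpha> t) (L t) (len x0 y0 t)
        - L t / pi * (sin (pi * len x0 y0 t / L t) / (1 + (\<alpha> t / pi * sin (pi * len x0 y0 t / L t))\<^sup>2)))"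
  define P where "P = profile a x0 y0"
  define D where "D = (\<lambda>s. g y0 s - g x0 s)"
  have ineq: "(\<Lambda> t)\<^sup>2 * P t * R \<le> D t \<bullet> (W y0 t - W x0 t)"
    unfolding R_def P_def D_def profile_def \<alpha>_eq
    by (rule touching_flow_inequality[OF t(1) \<alpha> \<mu> _ xy _ half])
      (use below touch in \<open>simp_all add: profile_def \<alpha>_def\<close>)
  have sub: "{0..t} \<subseteq> J" using Icc_subset_J t by simp
  have d\<alpha>: "(\<alpha> has_real_derivative - 4 * pi\<^sup>2 / (L t)\<^sup>2 * \<alpha> t) (at t within {0..t})"
    unfolding \<alpha>_def by (auto intro!: derivative_eq_intros rtime_deriv t)
  have dP: "(P has_real_derivative R) (at t within {0..t})"
    unfolding P_def profile_def[abs_def] \<alpha>_eq R_def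
    by (rule chord_profile_flow_DERIV[where L = L and l = "len x0 y0", OF \<alpha> L_pos[OF t(1)] d\<alpha>])
      (rule DERIV_subset[OF L_t[OF t(1)] sub] DERIV_subset[OF len_t[OF t(1)] sub])+
  have dD: "(D has_vector_derivative (W y0 t - W x0 t)) (at t within {0..t})"
    unfolding D_def by (intro has_vector_derivative_diff has_vector_derivative_within_subset[OF g_t[OF t(1)] sub])
  define F where "F = (\<lambda>s. (D s \<bullet> D s - (\<Lambda> s * P s) * (\<Lambda> s * P s)) / 2)"
  have dL: "(\<Lambda> has_real_derivative - \<epsilon>) (at t within {0..t})"
    unfolding \<Lambda>_def by (auto intro!: derivative_eq_intros)
  have dF: "(F has_real_derivative (D t \<bullet> (W y0 t - W x0 t) - (\<Lambda> t * P t) * (- \<epsilon> * P t + \<Lambda> t * R))) (at t within {0..t})"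
  proof -
    have 1: "((\<lambda>s. D s \<bullet> D s) has_real_derivative 2 * (D t \<bullet> (W y0 t - W x0 t))) (at t within {0..t})"
      using has_real_derivative_inner[OF dD dD] by (simp add: inner_commute)
    have 2: "((\<lambda>s. \<Lambda> s * P s) has_real_derivative - \<epsilon> * P t + \<Lambda> t * R) (at t within {0..t})"
      using DERIV_mult[OF dL dP] by (simp add: mult.commute)
    show ?thesis unfolding F_def
      by (rule DERIV_cong[OF DERIV_cdivide[OF DERIV_diff[OF 1 DERIV_mult[OF 2 2]], of 2]]) (simp add: field_simps)
  qed
  have P: "P t > 0" unfolding P_def by (rule profile_pos[OF t(1) a xy])
  have "D t \<bullet> (W y0 t - W x0 t) - (\<Lambda> t * P t) * (- \<epsilon> * P t + \<Lambda> t * R)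
      \<ge> (\<Lambda> t)\<^sup>2 * P t * R - (\<Lambda> t * P t) * (- \<epsilon> * P t + \<Lambda> t * R)"
    using ineq by simp
  also have "(\<Lambda> t)\<^sup>2 * P t * R - (\<Lambda> t * P t) * (- \<epsilon> * P t + \<Lambda> t * R) = \<epsilon> * \<Lambda> t * (P t)\<^sup>2"
    by (simp add: power2_eq_square algebra_simps)
  finally have "D t \<bullet> (W y0 t - W x0 t) - (\<Lambda> t * P t) * (- \<epsilon> * P t + \<Lambda> t * R) > 0"
    using \<epsilon>(1) \<mu>(1) P by (smt (verit) mult_pos_pos zero_less_power)
  from has_real_derivative_pos_inc_left[OF dF this] obtain d where d: "d > 0"
    "\<And>h. \<lbrakk>0 < h; t - h \<in> {0..t}; h < d\<rbrakk> \<Longrightarrow> F (t - h) < F t" by blast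
  define h where "h = min d t / 2"
  have h: "0 < h" "h < d" "h < t" using d(1) t by (auto simp: h_def min_def)
  have DD: "D s \<bullet> D s = (dist (g x0 s) (g y0 s))\<^sup>2" for s
    by (simp add: D_def dist_norm norm_minus_commute[of "g x0 s"] power2_norm_eq_inner)
  have "F t = 0" unfolding F_def DD touch P_def by (simp add: power2_eq_square)
  then have "F (t - h) < 0" using d(2)[of h] h t by simp
  moreover have "F (t - h) \<ge> 0"
  proof -
    have J: "t - h \<in> J" using J_down[OF t(1), of "t - h"] h by simp
    have "\<epsilon> * (1 + (t - h)) \<le> \<epsilon> * (1 + t)" using \<epsilon>(1) h by (intro mult_left_mono) auto
    then have "0 \<le> \<Lambda> (t - h)" using \<epsilon>(2) by (simp add: \<Lambda>_def)
    then have "0 \<le> \<Lambda> (t - h) * P (t - h)"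
      unfolding P_def using profile_pos[OF J a xy] by simp
    moreover have "\<Lambda> (t - h) * P (t - h) \<le> dist (g x0 (t - h)) (g y0 (t - h))"
      unfolding P_def using prev[of "t - h"] h by simp
    ultimately have "(\<Lambda> (t - h) * P (t - h))\<^sup>2 \<le> (dist (g x0 (t - h)) (g y0 (t - h)))\<^sup>2"
      by (intro power_mono)
    then show ?thesis unfolding F_def DD by (simp add: power2_eq_square)
  qed
  ultimately show False by simp
qed

text \<open>If the arc from \<open>x0\<close> to \<open>y0\<close> is the longer one, its complement
  from \<open>y0\<close> to \<open>x0 + 2 * pi\<close> is used instead; chord and profile are the
  same.\<close>

lemma no_first_touching:
  fixes a \<epsilon> :: real
  defines "\<Lambda> \<equiv> \<lambda>s. 1 - \<epsilon> * (1 + s)"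
  assumes t: "t \<in> J" "0 < t" and a: "0 < a" and \<epsilon>: "0 < \<epsilon>" "\<epsilon> * (1 + t) < 1"
    and below: "\<And>x y. \<lbrakk>x < y; y < x + 2 * pi\<rbrakk> \<Longrightarrow> \<Lambda> t * profile a x y t \<le> dist (g x t) (g y t)"
    and prev: "\<And>s. \<lbrakk>0 \<le> s; s < t\<rbrakk> \<Longrightarrow> \<Lambda> s * profile a x0 y0 s \<le> dist (g x0 s) (g y0 s)"
    and xy: "x0 < y0" "y0 < x0 + 2 * pi"
    and touch: "dist (g x0 t) (g y0 t) = \<Lambda> t * profile a x0 y0 t"
  shows False
proof (cases "len x0 y0 t \<le> L t / 2")
  case True
  then show ?thesis using no_first_touching_half[OF t a \<epsilon>, of x0 y0] assms(6-) by (simp add: \<Lambda>_def)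
next
  case False
  have other: "profile a y0 (x0 + 2 * pi) s = profile a x0 y0 s"
    "dist (g y0 s) (g (x0 + 2 * pi) s) = dist (g x0 s) (g y0 s)" if "s \<in> J" for s
    using profile_other_arc[OF that] xy periodic[OF that] by (simp_all add: dist_commute)
  show ?thesis
  proof (rule no_first_touching_half[OF t a \<epsilon>, of y0 "x0 + 2 * pi"])
    show "(1 - \<epsilon> * (1 + s)) * profile a y0 (x0 + 2 * pi) s \<le> dist (g y0 s) (g (x0 + 2 * pi) s)"
      if "0 \<le> s" "s < t" for s
      using prev[OF that] J_down[OF t(1), of s] that by (simp add: other \<Lambda>_def)
    show "len y0 (x0 + 2 * pi) t \<le> L t / 2"
      using False len_other_arc[OF t(1), of x0 y0] xy by simp
  qed (use below touch xy t in \<open>simp_all add: other \<Lambda>_def\<close>)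
qed

section \<open>Joint continuity and the behaviour near the diagonal\<close>

lemma len_cont: "continuous_on {(x::real, y, t). x \<le> y \<and> t \<in> J} (\<lambda>(x, y, t). len x y t)"
proof -
  \<comment> \<open>An affine substitution moves the varying limits of integration to the fixed
    interval from 0 to 1.\<close>
  define f where "f = (\<lambda>(x, y, t) s. norm (V (x + s * (y - x)) t))"
  have "continuous_on ((UNIV \<times> UNIV \<times> J) \<times> cbox (0::real) 1) (\<lambda>(p, s). f p s)"
  proof -
    have 1: "continuous_on ((UNIV \<times> UNIV \<times> J) \<times> cbox (0::real) 1)
      (\<lambda>p. (fst (fst p) + snd p * (fst (snd (fst p)) - fst (fst p)), snd (snd (fst p))))"
      by (intro continuous_intros)
    have "(\<lambda>p. (fst (fst p) + snd p * (fst (snd (fst p)) - fst (fst p)), snd (snd (fst p))))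
        ` ((UNIV \<times> UNIV \<times> J) \<times> cbox (0::real) 1) \<subseteq> UNIV \<times> J" by auto
    from continuous_on_norm[OF continuous_on_compose2[OF V_cont 1 this]]
    show ?thesis by (simp add: f_def case_prod_unfold)
  qed
  from integral_continuous_on_param[OF this]
  have "continuous_on (UNIV \<times> UNIV \<times> J) (\<lambda>p. (fst (snd p) - fst p) * integral {0..1} (f p))"
    by (intro continuous_intros) simp
  then have "continuous_on {(x::real, y, t). x \<le> y \<and> t \<in> J} (\<lambda>p. (fst (snd p) - fst p) * integral {0..1} (f p))"
    by (rule continuous_on_subset) auto
  then show ?thesis
  proof (rule continuous_on_eq)
    fix p assume "p \<in> {(x::real, y, t). x \<le> y \<and> t \<in> J}"
    then obtain x y t where p: "p = (x, y, t)" "x \<le> y" "t \<in> J" by auto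
    define a where "a = x - 1"
    have "((\<lambda>s. (y - x) * norm (V (x + s * (y - x)) t)) has_integral
        (len a (x + 1 * (y - x)) t - len a (x + 0 * (y - x)) t)) {0..1}"
    proof (rule fundamental_theorem_of_calculus)
      fix s :: real assume s: "s \<in> {0..1}"
      have "0 \<le> s * (y - x)" using p s by simp
      then have "a < x + s * (y - x)" by (simp add: a_def)
      then have "((\<lambda>s. len a (x + s * (y - x)) t) has_real_derivative norm (V (x + s * (y - x)) t) * (y - x)) (at s)"
        by (intro DERIV_chain2[OF len_DERIV_y[OF p(3)]]) (auto intro!: derivative_eq_intros)
      then show "((\<lambda>s. len a (x + s * (y - x)) t) has_vector_derivative (y - x) * norm (V (x + s * (y - x)) t)) (at s within {0..1})"
        by (simp add: has_real_derivative_iff_has_vector_derivative has_vector_derivative_at_within mult.commute)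
    qed simp
    from integral_unique[OF this] have "(y - x) * integral {0..1} (f p) = len a y t - len a x t"
      by (simp add: f_def p)
    also have "\<dots> = len x y t" using len_combine[OF p(3), of a x y] p by (simp add: a_def)
    finally show "(fst (snd p) - fst p) * integral {0..1} (f p) = (\<lambda>(x, y, t). len x y t) p"
      by (simp add: p)
  qed
qed

lemma profile_cont:
  assumes b: "b \<in> J" and a: "0 < a"
  shows "continuous_on {(x::real, y, t). x \<le> y \<and> t \<in> {0..b}} (\<lambda>(x, y, t). profile a x y t)"
proof -
  let ?S = "{(x::real, y, t). x \<le> y \<and> t \<in> {0..b}}"
  have t: "continuous_on ?S (\<lambda>p. snd (snd p))" by (intro continuous_intros)
  have ti: "(\<lambda>p. snd (snd p)) ` ?S \<subseteq> {0..b}" by auto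
  have len: "continuous_on ?S (\<lambda>p. len (fst p) (fst (snd p)) (snd (snd p)))"
    using continuous_on_subset[OF len_cont, of ?S] Icc_subset_J[OF b] by (auto simp: case_prod_unfold subset_iff)
  have L: "continuous_on ?S (\<lambda>p. L (snd (snd p)))"
    by (rule continuous_on_compose2[OF continuous_on_subset[OF L_cont Icc_subset_J[OF b]] t ti])
  have r: "continuous_on ?S (\<lambda>p. rtime (snd (snd p)))"
    by (rule continuous_on_compose2[OF rtime_cont[OF b] t ti])
  have nz: "L (snd (snd p)) \<noteq> 0" if "p \<in> ?S" for p
    using L_pos[of "snd (snd p)"] Icc_subset_J[OF b] that by (auto simp: subset_iff)
  define \<alpha> where "\<alpha> = (\<lambda>p :: real \<times> real \<times> real. a * exp (- 4 * pi\<^sup>2 * rtime (snd (snd p))))"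
  have \<alpha>: "continuous_on ?S \<alpha>" unfolding \<alpha>_def
    by (rule continuous_on_mult[OF continuous_on_const continuous_on_exp[OF continuous_on_mult[OF continuous_on_const r]]])
  have q: "continuous_on ?S (\<lambda>p. sin (pi * len (fst p) (fst (snd p)) (snd (snd p)) / L (snd (snd p))))"
    by (rule continuous_on_sin[OF continuous_on_divide[OF continuous_on_mult[OF continuous_on_const len] L]])
      (use nz in blast)
  have "continuous_on ?S (\<lambda>p. profile a (fst p) (fst (snd p)) (snd (snd p)))"
    unfolding profile_def chord_profile_def
    using continuous_on_mult[OF continuous_on_divide[OF L \<alpha>] continuous_on_arctan[OF continuous_on_mult[OF
      continuous_on_divide[OF \<alpha> continuous_on_const, of pi] q]]] a
    by (simp add: \<alpha>_def)
  then show ?thesis by (simp add: case_prod_unfold)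
qed

text \<open>By continuity of the velocity, its component along the unit tangent \<open>e\<close> at
  the centre exceeds \<open>\<nu>\<close> times the speed nearby in place and time; integration
  along the arc gives the claim. The uniformity in time serves pairs that collapse while time
  varies.\<close>

lemma chord_near_diagonal:
  assumes t: "t \<in> J" and \<nu>: "\<nu> < 1"
  obtains \<delta> where "\<delta> > 0"
    "\<And>x y s. \<lbrakk>\<bar>x - z\<bar> < \<delta>; \<bar>y - z\<bar> < \<delta>; s \<in> J; \<bar>s - t\<bar> < \<delta>; x < y\<rbrakk> \<Longrightarrow> \<nu> * len x y s \<le> dist (g x s) (g y s)"
proof -
  define e where "e = V z t /\<^sub>R norm (V z t)"
  define f where "f = (\<lambda>p. V (fst p) (snd p) \<bullet> e - \<nu> * norm (V (fst p) (snd p)))"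
  have e: "norm e = 1" unfolding e_def by (rule tangent_norm[OF t])
  have Vc: "continuous_on (UNIV \<times> J) (\<lambda>p. V (fst p) (snd p))"
    using V_cont by (simp add: case_prod_unfold)
  have "continuous_on (UNIV \<times> J) f" unfolding f_def by (intro continuous_intros Vc)
  then have "(f \<longlongrightarrow> f (z, t)) (at (z, t) within UNIV \<times> J)" using t by (simp add: continuous_on_def)
  moreover have "f (z, t) > 0"
  proof -
    have "V z t \<bullet> e = norm (V z t)"
      using speed_pos[OF t, of z] by (simp add: e_def power2_norm_eq_inner[symmetric] power2_eq_square)
    then have "f (z, t) = (1 - \<nu>) * norm (V z t)" by (simp add: f_def algebra_simps)
    then show ?thesis using \<nu> speed_pos[OF t, of z] by simp
  qed
  ultimately have "\<forall>\<^sub>F p in at (z, t) within UNIV \<times> J. f p > 0" by (rule order_tendstoD(1))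
  then obtain d where d: "d > 0" "\<And>p. \<lbrakk>p \<in> UNIV \<times> J; p \<noteq> (z, t); dist p (z, t) < d\<rbrakk> \<Longrightarrow> f p > 0"
    unfolding eventually_at by blast
  have pos: "f (x, s) > 0" if "\<bar>x - z\<bar> < d / 2" "\<bar>s - t\<bar> < d / 2" "s \<in> J" for x s
  proof (cases "(x, s) = (z, t)")
    case True then show ?thesis using \<open>f (z, t) > 0\<close> by simp
  next
    case False
    have "dist (x, s) (z, t) \<le> dist x z + dist s t"
      unfolding dist_Pair_Pair by (rule sqrt_sum_squares_le_sum) auto
    then have "dist (x, s) (z, t) < d" using that by (simp add: dist_real_def)
    then show ?thesis using d(2)[of "(x, s)"] False that by simp
  qed
  show ?thesis
  proof (rule that[of "d / 2"])
    show "d / 2 > 0" using d by simp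
    fix x y s assume h: "\<bar>x - z\<bar> < d / 2" "\<bar>y - z\<bar> < d / 2" "s \<in> J" "\<bar>s - t\<bar> < d / 2" "x < y"
    have 1: "((\<lambda>u. V u s \<bullet> e) has_integral (g y s \<bullet> e - g x s \<bullet> e)) {x..y}"
    proof (rule fundamental_theorem_of_calculus)
      fix u
      have "((\<lambda>u. g u s \<bullet> e) has_real_derivative V u s \<bullet> e) (at u)"
        using has_real_derivative_inner[OF g_x[OF h(3), of u] has_vector_derivative_const[of e]] by simp
      then show "((\<lambda>u. g u s \<bullet> e) has_vector_derivative V u s \<bullet> e) (at u within {x..y})"
        by (simp add: has_real_derivative_iff_has_vector_derivative has_vector_derivative_at_within)
    qed (use h in simp)
    have 2: "((\<lambda>u. \<nu> * norm (V u s)) has_integral \<nu> * len x y s) {x..y}"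
      unfolding len_def by (intro has_integral_mult_right integrable_integral speed_integrable[OF h(3)])
    have "\<nu> * len x y s \<le> g y s \<bullet> e - g x s \<bullet> e"
    proof (rule has_integral_le[OF 2 1])
      fix u assume "u \<in> {x..y}"
      then have "\<bar>u - z\<bar> < d / 2" using h(1,2) unfolding abs_less_iff atLeastAtMost_iff by linarith
      from pos[OF this h(4,3)] show "\<nu> * norm (V u s) \<le> V u s \<bullet> e" by (simp add: f_def)
    qed
    also have "\<dots> = (g y s - g x s) \<bullet> e" by (simp add: inner_diff_left)
    also have "\<dots> \<le> norm (g y s - g x s) * norm e" by (rule norm_cauchy_schwarz)
    finally show "\<nu> * len x y s \<le> dist (g x s) (g y s)" using e by (simp add: dist_norm norm_minus_commute)
  qed
qed


lemma dist_profile_cont: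
  assumes b: "b \<in> J" and a: "0 < a"
  shows "continuous_on {(x::real, y, t). x \<le> y \<and> t \<in> {0..b}}
    (\<lambda>(x, y, t). dist (g x t) (g y t) - (1 - \<epsilon> * (1 + t)) * profile a x y t)"
proof -
  let ?S = "{(x::real, y, t). x \<le> y \<and> t \<in> {0..b}}"
  have gc: "continuous_on ?S (\<lambda>p. g (h p) (snd (snd p)))" if "continuous_on ?S h" for h
  proof -
    have "(\<lambda>p. (h p, snd (snd p))) ` ?S \<subseteq> UNIV \<times> J" using Icc_subset_J[OF b] by auto
    from continuous_on_compose2[OF g_cont continuous_on_Pair[OF that continuous_on_snd[OF continuous_on_snd[OF continuous_on_id]]] this]
    show ?thesis by simp
  qed
  have 1: "continuous_on ?S (\<lambda>p. dist (g (fst p) (snd (snd p))) (g (fst (snd p)) (snd (snd p))))"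
    by (intro continuous_on_dist gc continuous_on_fst continuous_on_snd continuous_on_id)
  have 2: "continuous_on ?S (\<lambda>p. profile a (fst p) (fst (snd p)) (snd (snd p)))"
    using profile_cont[OF b a] by (simp add: case_prod_unfold)
  have 3: "continuous_on ?S (\<lambda>p. 1 - \<epsilon> * (1 + snd (snd p)))"
    by (intro continuous_intros)
  show ?thesis
    using continuous_on_diff[OF 1 continuous_on_mult[OF 3 2]] by (simp add: case_prod_unfold)
qed

text \<open>The infimum \<open>t\<close> of the bad times is a first touching time, attained by
  compactness. The factor \<open>1 - \<epsilon> * (1 + s)\<close> is at most
  \<open>1 - \<epsilon>\<close> already at time 0; this gap makes \<open>t\<close> positive and
  keeps the limit pair off the diagonal.\<close>

lemma chord_bound_preserved_strict:
  assumes b: "b \<in> J" and a: "0 < a" and \<epsilon>: "0 < \<epsilon>" "\<epsilon> * (1 + b) < 1"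
    and init: "\<And>x y. \<lbrakk>x < y; y < x + 2 * pi\<rbrakk> \<Longrightarrow> profile a x y 0 \<le> dist (g x 0) (g y 0)"
    and xy: "x < y" "y < x + 2 * pi"
  shows "(1 - \<epsilon> * (1 + b)) * profile a x y b < dist (g x b) (g y b)"
proof (rule ccontr)
  define \<Lambda> where "\<Lambda> = (\<lambda>s. 1 - \<epsilon> * (1 + s))"
  define bad where "bad = (\<lambda>s. \<exists>x y. x < y \<and> y < x + 2 * pi \<and> dist (g x s) (g y s) \<le> \<Lambda> s * profile a x y s)"
  define B where "B = {s. 0 \<le> s \<and> s \<le> b \<and> bad s}"
  assume "\<not> ?thesis"
  then have "bad b" unfolding bad_def \<Lambda>_def using xy by (auto simp: not_less)
  then have B: "b \<in> B" "B \<noteq> {}" "bdd_below B"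
    using J_nonneg[OF b] by (auto simp: B_def bdd_below_def)
  have inJ: "s \<in> J" if "0 \<le> s" "s \<le> b" for s using J_down[OF b that] .
  define t where "t = Inf B"
  have t: "0 \<le> t" "t \<le> b"
    unfolding t_def using B by (auto intro: cInf_greatest cInf_lower simp: B_def)
  have tJ: "t \<in> J" by (rule inJ[OF t])
  have \<Lambda>_le: "\<Lambda> s \<le> 1 - \<epsilon>" if "0 \<le> s" for s
    using that \<epsilon>(1) by (simp add: \<Lambda>_def distrib_left)
  \<comment> \<open>Shifting both parameters by the same number of periods brings bad pairs into a
    compact set.\<close>
  have bad_normalized: "\<exists>x y. 0 \<le> x \<and> x < 2 * pi \<and> x < y \<and> y < x + 2 * pi
      \<and> dist (g x s) (g y s) \<le> \<Lambda> s * profile a x y s" if "bad s" "s \<in> J" for s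
  proof -
    obtain x y where xy: "x < y" "y < x + 2 * pi" "dist (g x s) (g y s) \<le> \<Lambda> s * profile a x y s"
      using \<open>bad s\<close> by (auto simp: bad_def)
    obtain k :: int where k: "0 \<le> x + k * (2 * pi)" "x + k * (2 * pi) < 2 * pi"
      using periodic_representative[of "2 * pi" x] by auto
    define f where "f = (\<lambda>z. dist (g z s) (g (z + (y - x)) s) - \<Lambda> s * profile a z (z + (y - x)) s)"
    have "f (z + 2 * pi) = f z" for z
      using periodic[OF \<open>s \<in> J\<close>, of z] periodic[OF \<open>s \<in> J\<close>, of "z + (y - x)"]
        profile_shift[OF \<open>s \<in> J\<close>, of a z "z + (y - x)"]
      by (simp add: f_def algebra_simps)
    then have "f (x + k * (2 * pi)) = f x" by (rule periodic_int_shift)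
    then have "f (x + k * (2 * pi)) \<le> 0" using xy by (simp add: f_def)
    then show ?thesis using k xy
      by (intro exI[of _ "x + k * (2 * pi)"] exI[of _ "x + k * (2 * pi) + (y - x)"]) (simp add: f_def)
  qed
  have "\<exists>s\<in>B. s < t + 1 / real (Suc n)" for n
    using cInf_lessD[OF B(2), of "t + 1 / real (Suc n)"] by (auto simp: t_def)
  then obtain s where s: "\<And>n. s n \<in> B" "\<And>n. s n < t + 1 / real (Suc n)" by metis
  have s_ge: "t \<le> s n" for n unfolding t_def by (rule cInf_lower[OF s(1) B(3)])
  have sJ: "0 \<le> s n" "s n \<le> b" "s n \<in> J" "bad (s n)" for n using s(1)[of n] inJ by (auto simp: B_def)
  have up: "(\<lambda>n. t + 1 / real (Suc n)) \<longlonglongrightarrow> t"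
    using tendsto_add[OF tendsto_const LIMSEQ_inverse_real_of_nat, of t] by (simp add: inverse_eq_divide)
  have s_lim: "s \<longlonglongrightarrow> t"
  proof (rule tendsto_sandwich[OF _ _ tendsto_const up])
    show "\<forall>\<^sub>F n in sequentially. t \<le> s n" using s_ge by simp
    show "\<forall>\<^sub>F n in sequentially. s n \<le> t + 1 / real (Suc n)"
      using less_imp_le[OF s(2)] by (intro always_eventually allI)
  qed
  have "\<forall>n. \<exists>x y. 0 \<le> x \<and> x < 2 * pi \<and> x < y \<and> y < x + 2 * pi
      \<and> dist (g x (s n)) (g y (s n)) \<le> \<Lambda> (s n) * profile a x y (s n)"
    using bad_normalized sJ by blast
  then obtain X Y where XY: "\<And>n. 0 \<le> X n" "\<And>n. X n < 2 * pi" "\<And>n. X n < Y n" "\<And>n. Y n < X n + 2 * pi"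
    "\<And>n. dist (g (X n) (s n)) (g (Y n) (s n)) \<le> \<Lambda> (s n) * profile a (X n) (Y n) (s n)" by metis
  have "compact ({0..2 * pi} \<times> {0..4 * pi} :: (real \<times> real) set)" by (intro compact_Times compact_Icc)
  moreover have "\<forall>n. (X n, Y n) \<in> {0..2 * pi} \<times> {0..4 * pi}"
    using XY(1-4) by (smt (verit) SigmaI atLeastAtMost_iff)
  ultimately obtain z r where r: "strict_mono r" "((\<lambda>n. (X n, Y n)) \<circ> r) \<longlonglongrightarrow> z"
    by (rule seq_compactE[OF compact_imp_seq_compact])
  define x where "x = fst z"
  define y where "y = snd z"
  have Xl: "(\<lambda>n. X (r n)) \<longlonglongrightarrow> x" and Yl: "(\<lambda>n. Y (r n)) \<longlonglongrightarrow> y"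
    using tendsto_fst[OF r(2)] tendsto_snd[OF r(2)] by (simp_all add: o_def x_def y_def)
  have sl: "(\<lambda>n. s (r n)) \<longlonglongrightarrow> t" using LIMSEQ_subseq_LIMSEQ[OF s_lim r(1)] by (simp add: o_def)
  have le: "x \<le> y" "y \<le> x + 2 * pi"
    using LIMSEQ_le[OF Xl Yl] LIMSEQ_le[OF Yl tendsto_add[OF Xl tendsto_const, of "2 * pi"]]
      less_imp_le[OF XY(3)] less_imp_le[OF XY(4)]
    by blast+
  have no_diagonal: False
    if lim: "P \<longlonglongrightarrow> w" "Q \<longlonglongrightarrow> w" and less: "\<And>n. P n < Q n" "\<And>n. Q n < P n + 2 * pi"
      and bound: "\<And>n. dist (g (P n) (s (r n))) (g (Q n) (s (r n))) \<le> \<Lambda> (s (r n)) * profile a (P n) (Q n) (s (r n))"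
    for P Q w
  proof -
    \<comment> \<open>\<open>1 - \<epsilon> / 2\<close> lies strictly between the factor
      \<open>1 - \<epsilon>\<close> of the bound and the asymptotic ratio 1 of chord to arc.\<close>
    obtain \<delta> where \<delta>: "\<delta> > 0" "\<And>x y s. \<lbrakk>\<bar>x - w\<bar> < \<delta>; \<bar>y - w\<bar> < \<delta>; s \<in> J; \<bar>s - t\<bar> < \<delta>; x < y\<rbrakk>
      \<Longrightarrow> (1 - \<epsilon> / 2) * len x y s \<le> dist (g x s) (g y s)"
      using chord_near_diagonal[OF tJ, of "1 - \<epsilon> / 2" w] \<epsilon>(1) by auto
    have "\<forall>\<^sub>F n in sequentially. dist (P n) w < \<delta> \<and> dist (Q n) w < \<delta> \<and> dist (s (r n)) t < \<delta>"
      using tendstoD[OF lim(1) \<delta>(1)] tendstoD[OF lim(2) \<delta>(1)] tendstoD[OF sl \<delta>(1)]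
      by eventually_elim simp
    then obtain n where n: "\<bar>P n - w\<bar> < \<delta>" "\<bar>Q n - w\<bar> < \<delta>" "\<bar>s (r n) - t\<bar> < \<delta>"
      by (auto simp: eventually_sequentially dist_real_def)
    let ?l = "len (P n) (Q n) (s (r n))"
    have l: "0 < ?l" "?l < L (s (r n))" using len_pos[OF sJ(3)] len_less_L[OF sJ(3)] less[of n] by auto
    have p: "0 < profile a (P n) (Q n) (s (r n))" by (rule profile_pos[OF sJ(3) a less])
    have "(1 - \<epsilon> / 2) * ?l \<le> \<Lambda> (s (r n)) * profile a (P n) (Q n) (s (r n))"
      using \<delta>(2)[OF n(1,2) sJ(3) n(3) less(1)] bound[of n] by simp
    also have "\<dots> \<le> (1 - \<epsilon>) * profile a (P n) (Q n) (s (r n))"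
      using \<Lambda>_le[OF sJ(1)] p by (intro mult_right_mono) auto
    also have "\<dots> \<le> (1 - \<epsilon>) * ?l"
    proof (rule mult_left_mono)
      show "profile a (P n) (Q n) (s (r n)) \<le> ?l"
        unfolding profile_def using a l L_pos[OF sJ(3)] by (intro chord_profile_le) auto
      have "\<epsilon> \<le> \<epsilon> * (1 + b)" using \<epsilon>(1) J_nonneg[OF b] by simp
      then show "0 \<le> 1 - \<epsilon>" using \<epsilon>(2) by simp
    qed
    finally have "\<epsilon> / 2 * ?l \<le> 0" by (simp add: algebra_simps)
    moreover have "\<epsilon> / 2 * ?l > 0" using \<epsilon>(1) l by simp
    ultimately show False by simp
  qed
  have "x \<noteq> y" using no_diagonal[of "\<lambda>n. X (r n)" x "\<lambda>n. Y (r n)"] Xl Yl XY by auto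
  \<comment> \<open>In this limit it is the complementary arc that shrinks to a point; it is
    parametrised from \<open>Y\<close> to \<open>X + 2 * pi\<close>.\<close>
  moreover have "y \<noteq> x + 2 * pi"
  proof
    assume eq: "y = x + 2 * pi"
    show False
    proof (rule no_diagonal[of "\<lambda>n. Y (r n)" y "\<lambda>n. X (r n) + 2 * pi"])
      show "(\<lambda>n. X (r n) + 2 * pi) \<longlonglongrightarrow> y" unfolding eq by (intro tendsto_intros Xl)
      show "dist (g (Y (r n)) (s (r n))) (g (X (r n) + 2 * pi) (s (r n)))
          \<le> \<Lambda> (s (r n)) * profile a (Y (r n)) (X (r n) + 2 * pi) (s (r n))" for n
        using XY(5)[of "r n"] XY(3,4)[of "r n"] periodic[OF sJ(3)]
        by (simp add: profile_other_arc[OF sJ(3)] dist_commute)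
    qed (use Yl XY in simp_all)
  qed
  ultimately have xy': "x < y" "y < x + 2 * pi" using le by auto
  define h where "h = (\<lambda>(x, y, t). dist (g x t) (g y t) - (1 - \<epsilon> * (1 + t)) * profile a x y t)"
  have h: "continuous_on {(x::real, y, t). x \<le> y \<and> t \<in> {0..b}} h"
    unfolding h_def by (rule dist_profile_cont[OF b a])
  have h_le: "h (x, y, t) \<le> 0"
  proof (rule LIMSEQ_le_const2)
    show "(\<lambda>n. h (X (r n), Y (r n), s (r n))) \<longlonglongrightarrow> h (x, y, t)"
      by (rule continuous_on_tendsto_compose[OF h tendsto_Pair[OF Xl tendsto_Pair[OF Yl sl]]])
        (use le t sJ less_imp_le[OF XY(3)] in simp_all)
    show "\<exists>N. \<forall>n\<ge>N. h (X (r n), Y (r n), s (r n)) \<le> 0"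
      using XY(5) by (auto simp: h_def \<Lambda>_def)
  qed
  have "0 < t"
  proof (rule ccontr)
    assume "\<not> 0 < t"
    then have 0: "t = 0" using t by simp
    have p: "0 < profile a x y 0" using profile_pos[OF tJ a xy'] by (simp add: 0)
    have "dist (g x 0) (g y 0) \<le> (1 - \<epsilon>) * profile a x y 0" using h_le by (simp add: h_def 0)
    also have "\<dots> < profile a x y 0" using p \<epsilon>(1) by simp
    finally show False using init[OF xy'] by simp
  qed
  have before: "0 < h (u, v, s)" if "0 \<le> s" "s < t" "u < v" "v < u + 2 * pi" for s u v
  proof (rule ccontr)
    assume "\<not> ?thesis"
    then have "s \<in> B" using that t unfolding B_def bad_def by (auto simp: h_def \<Lambda>_def not_less)
    then have "t \<le> s" unfolding t_def by (rule cInf_lower[OF _ B(3)])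
    then show False using that by simp
  qed
  have at_t: "0 \<le> h (u, v, t)" if uv: "u < v" "v < u + 2 * pi" for u v
  proof (rule LIMSEQ_le_const)
    define q where "q = (\<lambda>n. t * (1 - inverse (real (Suc n))))"
    have q: "0 \<le> q n" "q n < t" for n
      using \<open>0 < t\<close> by (auto simp: q_def inverse_le_1_iff right_diff_distrib)
    have "q \<longlonglongrightarrow> t * (1 - 0)"
      unfolding q_def by (intro tendsto_intros LIMSEQ_inverse_real_of_nat)
    then have "q \<longlonglongrightarrow> t" by simp
    then show "(\<lambda>n. h (u, v, q n)) \<longlonglongrightarrow> h (u, v, t)"
      using q t uv order_trans[OF less_imp_le[OF q(2)] t(2)]
      by (intro continuous_on_tendsto_compose[OF h tendsto_Pair[OF tendsto_const tendsto_Pair[OF tendsto_const]]]) auto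
    show "\<exists>N. \<forall>n\<ge>N. 0 \<le> h (u, v, q n)"
      using before[OF q uv] by (auto intro: less_imp_le)
  qed
  have "\<epsilon> * (1 + t) \<le> \<epsilon> * (1 + b)" using \<epsilon>(1) t by (intro mult_left_mono) auto
  then have \<epsilon>t: "\<epsilon> * (1 + t) < 1" using \<epsilon>(2) by simp
  show False
  proof (rule no_first_touching[OF tJ \<open>0 < t\<close> a \<epsilon>(1) \<epsilon>t _ _ xy'])
    show "(1 - \<epsilon> * (1 + t)) * profile a u v t \<le> dist (g u t) (g v t)" if "u < v" "v < u + 2 * pi" for u v
      using at_t[OF that] by (simp add: h_def)
    show "(1 - \<epsilon> * (1 + s)) * profile a x y s \<le> dist (g x s) (g y s)" if "0 \<le> s" "s < t" for s
      using before[OF that xy'] by (simp add: h_def)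
    show "dist (g x t) (g y t) = (1 - \<epsilon> * (1 + t)) * profile a x y t"
      using at_t[OF xy'] h_le by (simp add: h_def)
  qed
qed

lemma chord_bound_preserved:
  assumes b: "b \<in> J" and a: "0 < a"
    and init: "\<And>x y. \<lbrakk>x < y; y < x + 2 * pi\<rbrakk> \<Longrightarrow> profile a x y 0 \<le> dist (g x 0) (g y 0)"
    and xy: "x < y" "y < x + 2 * pi"
  shows "profile a x y b \<le> dist (g x b) (g y b)"
proof (rule ccontr)
  define r where "r = dist (g x b) (g y b) / profile a x y b"
  have p: "0 < profile a x y b" by (rule profile_pos[OF b a xy])
  assume "\<not> ?thesis"
  then have r: "0 \<le> r" "r < 1" using p by (auto simp: r_def)
  \<comment> \<open>Chosen so that the factor at time \<open>b\<close> is
    \<open>(1 + r) / 2\<close>, which is larger than \<open>r\<close>.\<close>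
  define \<epsilon> where "\<epsilon> = (1 - r) / (2 * (1 + b))"
  have b0: "0 < 1 + b" using J_nonneg[OF b] by simp
  have e: "\<epsilon> * (1 + b) = (1 - r) / 2" using b0 by (simp add: \<epsilon>_def field_simps)
  have \<epsilon>: "0 < \<epsilon>" "\<epsilon> * (1 + b) < 1" unfolding e using r b0 by (simp_all add: \<epsilon>_def)
  have "(1 - \<epsilon> * (1 + b)) * profile a x y b < dist (g x b) (g y b)"
    by (rule chord_bound_preserved_strict[OF b a \<epsilon> init xy])
  also have "\<dots> = r * profile a x y b" using p by (simp add: r_def)
  finally have "1 - (1 - r) / 2 < r" using p unfolding e by simp
  then show False using r by (simp add: field_simps)
qed


section \<open>Translation between the flow locale and the notions of the theorem\<close>

context
  fixes t assumes t: "t \<in> J"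
begin

lemma velocity_eq: "velocity (\<lambda>y. g y t) x = V x t"
  unfolding velocity_def by (rule vector_derivative_at[OF g_x[OF t]])

lemma arc_length_eq: "arc_length (\<lambda>y. g y t) x y = len x y t"
  by (simp add: arc_length_def len_def velocity_eq)

lemma total_length_eq: "total_length (\<lambda>y. g y t) = L t"
  by (simp add: total_length_def arc_length_eq L_def)

lemma chord_arc_iff:
  assumes xy: "0 \<le> x" "x < y" "y < 2 * pi" and \<alpha>: "0 < \<alpha>"
  shows "1 / \<alpha> * arctan (\<alpha> / pi * sin (pi * arclength_dist (\<lambda>y. g y t) x y / total_length (\<lambda>y. g y t)))
      \<le> dist (g x t) (g y t) / total_length (\<lambda>y. g y t)
    \<longleftrightarrow> chord_profile \<alpha> (L t) (len x y t) \<le> dist (g x t) (g y t)"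
proof -
  have m: "min x y = x" "max x y = y" using xy by auto
  have "arclength_dist (\<lambda>y. g y t) x y = min (len x y t) (L t - len x y t)"
    unfolding arclength_dist_def m arc_length_eq using len_other_arc[OF t, of x y] xy by simp
  moreover have "sin (pi * (L t - len x y t) / L t) = sin (pi * len x y t / L t)"
    using L_pos[OF t] by (simp add: right_diff_distrib diff_divide_distrib)
  ultimately have "sin (pi * arclength_dist (\<lambda>y. g y t) x y / L t) = sin (pi * len x y t / L t)"
    by (auto simp: min_def)
  then show ?thesis
    unfolding total_length_eq chord_profile_def using L_pos[OF t] \<alpha> by (simp add: field_simps)
qed

lemma chord_arc_boundI:
  assumes \<alpha>: "0 < \<alpha>" and bound: "\<And>x y. \<lbrakk>x < y; y < x + 2 * pi\<rbrakk> \<Longrightarrow>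
    chord_profile \<alpha> (L t) (len x y t) \<le> dist (g x t) (g y t)"
  shows "chord_arc_bound \<alpha> (\<lambda>x. g x t)"
  unfolding chord_arc_bound_def
proof (intro ballI)
  fix x y assume "x \<in> circle_params" "y \<in> circle_params"
  then have x: "0 \<le> x" "x < 2 * pi" and y: "0 \<le> y" "y < 2 * pi" by (auto simp: circle_params_def)
  consider "x < y" | "y < x" | "x = y" by linarith
  then show "1 / \<alpha> * arctan (\<alpha> / pi * sin (pi * arclength_dist (\<lambda>x. g x t) x y / total_length (\<lambda>x. g x t)))
    \<le> dist (g x t) (g y t) / total_length (\<lambda>x. g x t)"
  proof cases
    case 1
    have "chord_profile \<alpha> (L t) (len x y t) \<le> dist (g x t) (g y t)" by (rule bound) (use x y 1 in auto)
    then show ?thesis by (rule iffD2[OF chord_arc_iff[OF x(1) 1 y(2) \<alpha>]])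
  next
    case 2
    have "chord_profile \<alpha> (L t) (len y x t) \<le> dist (g y t) (g x t)" by (rule bound) (use x y 2 in auto)
    then have "1 / \<alpha> * arctan (\<alpha> / pi * sin (pi * arclength_dist (\<lambda>x. g x t) y x / total_length (\<lambda>x. g x t)))
        \<le> dist (g y t) (g x t) / total_length (\<lambda>x. g x t)"
      by (rule iffD2[OF chord_arc_iff[OF y(1) 2 x(2) \<alpha>]])
    then show ?thesis by (simp only: arclength_dist_def min.commute max.commute dist_commute)
  next
    case 3
    have "len y (y + 2 * pi) t = L t" by (rule len_period[OF t])
    then have "arclength_dist (\<lambda>x. g x t) x y = 0"
      using L_pos[OF t] by (simp add: 3 arclength_dist_def arc_length_eq len_same[OF t])
    then show ?thesis by (simp add: 3)
  qed
qed

text \<open>The given bound concerns parameters in one period, whereas the argument uses all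
  oriented arcs shorter than a period. Arcs that pass through a multiple of \<open>2 * pi\<close>
  are handled by their complement, all others by a shift.\<close>

lemma chord_arc_boundD:
  assumes \<alpha>: "0 < \<alpha>" and bound: "chord_arc_bound \<alpha> (\<lambda>x. g x t)" and xy: "x < y" "y < x + 2 * pi"
  shows "chord_profile \<alpha> (L t) (len x y t) \<le> dist (g x t) (g y t)"
proof -
  have base: "chord_profile \<alpha> (L t) (len x y t) \<le> dist (g x t) (g y t)"
    if "0 \<le> x" "x < y" "y < 2 * pi" for x y
  proof (rule iffD1[OF chord_arc_iff[OF that \<alpha>]])
    show "1 / \<alpha> * arctan (\<alpha> / pi * sin (pi * arclength_dist (\<lambda>y. g y t) x y / total_length (\<lambda>y. g y t)))
      \<le> dist (g x t) (g y t) / total_length (\<lambda>y. g y t)"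
      using bound that by (auto simp: chord_arc_bound_def circle_params_def)
  qed
  have normalized: "chord_profile \<alpha> (L t) (len x y t) \<le> dist (g x t) (g y t)"
    if x: "0 \<le> x" "x < 2 * pi" and xy: "x < y" "y < x + 2 * pi" for x y
  proof -
    consider "y < 2 * pi" | "y = 2 * pi" "0 < x" | "2 * pi < y" using xy x by (cases "x = 0") force+
    then show ?thesis
    proof cases
      case 1 then show ?thesis using base x xy by simp
    next
      case 2
      have "chord_profile \<alpha> (L t) (len 0 x t) \<le> dist (g 0 t) (g x t)" using base[of 0 x] 2 x by simp
      moreover have "len x y t = L t - len 0 x t" using len_other_arc[OF t, of 0 x] 2 x by simp
      moreover have "g y t = g 0 t" using periodic[OF t, of 0] 2 by simp
      ultimately show ?thesis by (simp add: chord_profile_reflect[OF L_pos[OF t]] dist_commute)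
    next
      case 3
      define z where "z = y - 2 * pi"
      have z: "0 \<le> z" "z < x" "x \<le> z + 2 * pi" using 3 xy x by (auto simp: z_def)
      have "chord_profile \<alpha> (L t) (len z x t) \<le> dist (g z t) (g x t)" using base[of z x] z x by simp
      moreover have "len x y t = L t - len z x t" using len_other_arc[OF t, of z x] z by (simp add: z_def)
      moreover have "g y t = g z t" using periodic[OF t, of z] by (simp add: z_def)
      ultimately show ?thesis by (simp add: chord_profile_reflect[OF L_pos[OF t]] dist_commute)
    qed
  qed
  obtain k :: int where k: "0 \<le> x + k * (2 * pi)" "x + k * (2 * pi) < 2 * pi"
    using periodic_representative[of "2 * pi" x] by auto
  define f where "f = (\<lambda>z. dist (g z t) (g (z + (y - x)) t) - chord_profile \<alpha> (L t) (len z (z + (y - x)) t))"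
  have "f (z + 2 * pi) = f z" for z
    using periodic[OF t, of z] periodic[OF t, of "z + (y - x)"] len_shift[OF t, of z "z + (y - x)"]
    by (simp add: f_def algebra_simps)
  then have "f (x + k * (2 * pi)) = f x" by (rule periodic_int_shift)
  moreover have "0 \<le> f (x + k * (2 * pi))"
    using normalized[OF k, of "x + k * (2 * pi) + (y - x)"] xy by (simp add: f_def)
  ultimately show ?thesis by (simp add: f_def)
qed

end

lemma rescaled_time_eq: "t \<in> J \<Longrightarrow> rescaled_time g t = rtime t"
  unfolding rescaled_time_def rtime_def
  by (rule integral_cong) (use Icc_subset_J in \<open>auto simp: total_length_eq subset_iff\<close>)

end

lemma curve_shortening_flow_imp_sphere_curve_flow:
  assumes T: "0 < T" and flow: "curve_shortening_flow T \<gamma>"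
  obtains V A W X where "sphere_curve_flow (time_interval T) \<gamma> V A W X"
proof -
  let ?J = "time_interval T"
  have "jointly_smooth_on ?J \<gamma>" using flow by (simp only: curve_shortening_flow_def)
  then obtain D :: "nat \<Rightarrow> nat \<Rightarrow> real \<Rightarrow> real \<Rightarrow> real^3" where D:
    "\<forall>x. \<forall>t\<in>?J. D 0 0 x t = \<gamma> x t"
    "\<forall>i j. continuous_on (UNIV \<times> ?J) (\<lambda>(x, t). D i j x t)"
    "\<forall>i j x. \<forall>t\<in>?J. ((\<lambda>y. D i j y t) has_vector_derivative D (Suc i) j x t) (at x)
       \<and> ((\<lambda>s. D i j x s) has_vector_derivative D i (Suc j) x t) (at t within ?J)"
    unfolding jointly_smooth_on_def by (elim exE conjE)
  have D0: "\<And>x t. t \<in> ?J \<Longrightarrow> D 0 0 x t = \<gamma> x t"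
    and Dc: "\<And>i j. continuous_on (UNIV \<times> ?J) (\<lambda>(x, t). D i j x t)"
    and Dx: "\<And>i j x t. t \<in> ?J \<Longrightarrow> ((\<lambda>y. D i j y t) has_vector_derivative D (Suc i) j x t) (at x)"
    and Dt: "\<And>i j x t. t \<in> ?J \<Longrightarrow> ((\<lambda>s. D i j x s) has_vector_derivative D i (Suc j) x t) (at t within ?J)"
    using D by simp_all
  have f: "\<gamma> (x + 2 * pi) t = \<gamma> x t" "\<gamma> x t \<in> sphere 0 1" "velocity (\<lambda>y. \<gamma> y t) x \<noteq> 0"
    "((\<lambda>s. \<gamma> x s) has_vector_derivative geodesic_curvature_vector (\<lambda>y. \<gamma> y t) x) (at t within ?J)"
    if "t \<in> ?J" for x t
    using flow that unfolding curve_shortening_flow_def by blast+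
  have gx: "((\<lambda>y. \<gamma> y t) has_vector_derivative D (Suc 0) 0 x t) (at x)" if "t \<in> ?J" for x t
    using Dx[OF that, of 0 0 x] D0[OF that] by simp
  have gt: "((\<lambda>s. \<gamma> x s) has_vector_derivative D 0 (Suc 0) x t) (at t within ?J)" if "t \<in> ?J" for x t
    using has_vector_derivative_transform[OF that _ Dt[OF that, of 0 0 x]] D0 by simp
  have vel: "velocity (\<lambda>y. \<gamma> y t) x = D (Suc 0) 0 x t" if "t \<in> ?J" for x t
    unfolding velocity_def by (rule vector_derivative_at[OF gx[OF that]])
  \<comment> \<open>No time is isolated in the interval, so one-sided time derivatives are unique
    and the smooth derivative can be identified with the curvature vector.\<close>
  have nontrivial: "at t within ?J \<noteq> bot" if "t \<in> ?J" for t
  proof -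
    have "ereal t < T" using that by (simp add: time_interval_def)
    from ereal_dense2[OF this] obtain b where b: "t < b" "ereal b < T" by auto
    have "{t..b} \<subseteq> ?J"
      using that b le_less_trans[of _ "ereal b" T] by (auto simp: time_interval_def)
    moreover have "at t within {t..b} \<noteq> bot" using b by (simp add: trivial_limit_within islimpt_Icc)
    ultimately show ?thesis using at_le[of "{t..b}" ?J t] by (auto simp: bot_unique)
  qed
  have "sphere_curve_flow ?J \<gamma> (D (Suc 0) 0) (D (Suc (Suc 0)) 0) (D 0 (Suc 0)) (D (Suc 0) (Suc 0))"
  proof
    show "0 \<le> t" if "t \<in> ?J" for t using that by (simp add: time_interval_def)
    show "s \<in> ?J" if "t \<in> ?J" "0 \<le> s" "s \<le> t" for s t
      using that le_less_trans[of "ereal s" "ereal t" T] by (simp add: time_interval_def)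
    show "norm (\<gamma> x t) = 1" if "t \<in> ?J" for x t using f(2)[OF that] by simp
    show "continuous_on (UNIV \<times> ?J) (\<lambda>(x, t). \<gamma> x t)"
      by (rule continuous_on_eq[OF Dc[of 0 0]]) (auto simp: D0)
    show "D (Suc 0) 0 x t \<noteq> 0" if "t \<in> ?J" for x t using f(3)[OF that] vel[OF that] by simp
    show "D 0 (Suc 0) x t = D (Suc (Suc 0)) 0 x t /\<^sub>R (norm (D (Suc 0) 0 x t))\<^sup>2
      - ((D (Suc (Suc 0)) 0 x t \<bullet> D (Suc 0) 0 x t) / norm (D (Suc 0) 0 x t) ^ 4) *\<^sub>R D (Suc 0) 0 x t + \<gamma> x t"
      if t: "t \<in> ?J" for x t
    proof -
      define V where "V = D (Suc 0) 0 x t"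
      define A where "A = D (Suc (Suc 0)) 0 x t"
      define n where "n = norm V"
      have n: "n > 0" using f(3)[OF t, of x] vel[OF t] by (simp add: n_def V_def)
      have V: "((\<lambda>y. D (Suc 0) 0 y t) has_vector_derivative A) (at x)"
        unfolding A_def by (rule Dx[OF t])
      have "((\<lambda>y. inverse (norm (D (Suc 0) 0 y t))) has_real_derivative
          - ((V \<bullet> A) / n * inverse (n\<^sup>2))) (at x)"
        using DERIV_inverse_fun[OF has_real_derivative_norm[OF V]] n
        by (simp add: V_def n_def numeral_2_eq_2)
      from has_vector_derivative_scaleR[OF this V]
      have "((\<lambda>y. inverse (norm (D (Suc 0) 0 y t)) *\<^sub>R D (Suc 0) 0 y t) has_vector_derivative
          inverse n *\<^sub>R A + (- ((V \<bullet> A) / n * inverse (n\<^sup>2))) *\<^sub>R V) (at x)"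
        by (simp add: V_def n_def)
      then have ut: "vector_derivative (unit_tangent (\<lambda>y. \<gamma> y t)) (at x)
          = inverse n *\<^sub>R A + (- ((V \<bullet> A) / n * inverse (n\<^sup>2))) *\<^sub>R V"
        unfolding unit_tangent_def[abs_def] vel[OF t] by (rule vector_derivative_at)
      have unit: "\<gamma> y t \<bullet> \<gamma> y t = 1" for y using f(2)[OF t, of y] by (simp add: norm_eq_1)
      have gV: "\<gamma> y t \<bullet> D (Suc 0) 0 y t = 0" for y
        using inner_const_derivative[OF gx[OF t] gx[OF t] unit, of y] by (simp add: inner_commute)
      have gA: "\<gamma> x t \<bullet> A = - n\<^sup>2"
        using inner_const_derivative[OF gx[OF t] V gV] by (simp add: V_def n_def power2_norm_eq_inner)
      define K where "K = inverse n *\<^sub>R (inverse n *\<^sub>R A + (- ((V \<bullet> A) / n * inverse (n\<^sup>2))) *\<^sub>R V)"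
      have K: "K = A /\<^sub>R n\<^sup>2 - ((A \<bullet> V) / n ^ 4) *\<^sub>R V"
        unfolding K_def by (simp add: scaleR_add_right scaleR_diff_right power2_eq_square power4_eq_xxxx divide_inverse inner_commute mult_ac)
      \<comment> \<open>\<open>K\<close> is the second arclength derivative of the curve; as its
        component along the position is -1, the projection to the tangent plane adds the
        position.\<close>
      have "\<gamma> x t \<bullet> K = - 1"
        unfolding K using gA gV[of x] n by (simp add: inner_diff_right V_def)
      then have "geodesic_curvature_vector (\<lambda>y. \<gamma> y t) x = K + \<gamma> x t"
        unfolding geodesic_curvature_vector_def ut vel[OF t] sphere_tangential_def
          V_def[symmetric] n_def[symmetric] K_def[symmetric]
        by (simp add: inner_commute)
      moreover have "D 0 (Suc 0) x t = geodesic_curvature_vector (\<lambda>y. \<gamma> y t) x"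
        using vector_derivative_unique_within[OF nontrivial[OF t] gt[OF t] f(4)[OF t]] .
      ultimately show ?thesis by (simp add: K V_def A_def n_def)
    qed
  qed (use f(1) gx gt Dx Dt Dc in simp_all)
  then show ?thesis by (rule that)
qed

theorem theorem3p4:
  fixes \<gamma> :: "real \<Rightarrow> real \<Rightarrow> real^3" and T :: ereal and a :: real
  assumes "0 < T"
    and "curve_shortening_flow T \<gamma>"
    and "simple_closed (\<lambda>x. \<gamma> x 0)"
    and "a > 0"
    and "chord_arc_bound a (\<lambda>x. \<gamma> x 0)"
  shows "\<forall>t\<in>time_interval T.
           chord_arc_bound (a * exp (- 4 * pi\<^sup>2 * rescaled_time \<gamma> t)) (\<lambda>x. \<gamma> x t)"
proof
  fix t assume t: "t \<in> time_interval T"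
  obtain V A W X where "sphere_curve_flow (time_interval T) \<gamma> V A W X"
    by (rule curve_shortening_flow_imp_sphere_curve_flow[OF assms(1,2)])
  then interpret sphere_curve_flow "time_interval T" \<gamma> V A W X .
  have 0: "0 \<in> time_interval T" using assms(1) by (simp add: time_interval_def zero_ereal_def)
  have "chord_profile (a * exp (- 4 * pi\<^sup>2 * rtime 0)) (L 0) (len x y 0) \<le> dist (\<gamma> x 0) (\<gamma> y 0)"
    if "x < y" "y < x + 2 * pi" for x y
    using chord_arc_boundD[OF 0 assms(4,5) that] by (simp add: rtime_def)
  then have "profile a x y t \<le> dist (\<gamma> x t) (\<gamma> y t)" if "x < y" "y < x + 2 * pi" for x y
    by (intro chord_bound_preserved[OF t assms(4) _ that]) (simp add: profile_def)
  then show "chord_arc_bound (a * exp (- 4 * pi\<^sup>2 * rescaled_time \<gamma> t)) (\<lambda>x. \<gamma> x t)"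
    unfolding rescaled_time_eq[OF t]
    by (intro chord_arc_boundI[OF t]) (use assms(4) in \<open>auto simp: profile_def\<close>)
qed

end
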